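(* Let $R$ be a unital ring. Then $\sigma(R)=4$ if and only if $\sigma(R)\neq 3$ and $R$ has a quotient (by a two-sided ideal) isomorphic to one of the following four rings: $F_4\times F_4$; $M_2(F_2)$; $F_3[x,y]/(x^2,xy,y^2)$; $T_2(F_3)$.
   Context: Rings are associative; subrings are not required to contain the multiplicative identity, nor any identity. The covering number $\sigma(R)$ of a ring $R$ is the minimal number of proper subrings whose union is $R$, with $\sigma(R)=\infty$ if $R$ is not a union of finitely many proper subrings. $F_q$ denotes the field with $q$ elements, $M_2(F_2)$ the ring of $2\times 2$ matrices over $F_2$, and $T_2(F_3)$ the ring of upper triangular $2\times 2$ matrices over $F_3$. *)

theory Defs
  imports
    "HOL-Algebra.Algebra"
    "HOL-Algebra.Algebraic_Closure_Type"
    "HOL-Library.Z2"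
    "HOL-Library.Numeral_Type"
    "HOL-Library.Extended_Nat"
    "Jordan_Normal_Form.Matrix"
begin

text \<open>
  The library predicate \<^const>\<open>subring\<close> forces a subring to contain the identity of the
  ambient ring; here a subring is only an additive subgroup closed under multiplication.
\<close>

definition nonunital_subring :: "'a set \<Rightarrow> ('a, 'm) ring_scheme \<Rightarrow> bool" where
  "nonunital_subring S R \<longleftrightarrow>
     additive_subgroup S R \<and> (\<forall>x\<in>S. \<forall>y\<in>S. x \<otimes>\<^bsub>R\<^esub> y \<in> S)"

definition proper_subring_cover :: "('a, 'm) ring_scheme \<Rightarrow> 'a set set \<Rightarrow> bool" where
  "proper_subring_cover R \<C> \<longleftrightarrow>
     (\<forall>S\<in>\<C>. nonunital_subring S R \<and> S \<noteq> carrier R) \<and> \<Union>\<C> = carrier R"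

text \<open>In \<^typ>\<open>enat\<close> the infimum of the empty set is \<open>\<infinity>\<close>, which is the required value for a
  ring that is not a finite union of proper subrings.\<close>

definition covering_number :: "('a, 'm) ring_scheme \<Rightarrow> enat" where
  "covering_number R = (INF \<C> \<in> {\<C>. finite \<C> \<and> proper_subring_cover R \<C>}. enat (card \<C>))"

definition has_quotient_iso :: "('a, 'm) ring_scheme \<Rightarrow> ('b, 'n) ring_scheme \<Rightarrow> bool" where
  "has_quotient_iso R Q \<longleftrightarrow> (\<exists>I. ideal I R \<and> R Quot I \<simeq> Q)"

text \<open>
  The prime fields are the types \<^typ>\<open>bit\<close> (the integers modulo 2) and \<^typ>\<open>3\<close> (the integers
  modulo 3). The latter is only an instance of \<^class>\<open>comm_ring_1\<close> in the library, so we record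
  that it is a field with three elements.
\<close>

lemma field_F3: "field (ring_of_type_algebra :: 3 ring)"
proof -
  interpret cring "ring_of_type_algebra :: 3 ring" by (rule cring_from_type_algebra)
  have inv: "x * x = 1" if "x \<noteq> 0" for x :: 3
  proof (cases x)
    case (of_int z)
    then have "z = 0 \<or> z = 1 \<or> z = 2" by auto
    then show ?thesis using that of_int by auto
  qed
  show ?thesis
    by (rule cring_fieldI2) (use inv in \<open>auto simp: ring_of_type_algebra_def\<close>)
qed

lemma card_F3: "CARD(3) = 3"
  by simp

text \<open>\<open>F\<^sub>4 = F\<^sub>2[t]/(t\<^sup>2 + t + 1)\<close>\<close>

definition F4 :: "bit poly set ring" where
  "F4 = (let P = (ring_of_type_algebra :: bit poly ring) in P Quot (Idl\<^bsub>P\<^esub> {[:1, 1, 1:]}))"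

lemma field_F4: "field F4" and order_F4: "Coset.order F4 = 4"
proof -
  define P where "P = (ring_of_type_algebra :: bit poly ring)"
  define m :: "bit poly" where "m = [:1, 1, 1:]"
  define I where "I = Idl\<^bsub>P\<^esub> {m}"
  interpret P: cring P unfolding P_def by (rule cring_from_type_algebra)
  have P_simps: "carrier P = UNIV" "x \<otimes>\<^bsub>P\<^esub> y = x * y" "x \<oplus>\<^bsub>P\<^esub> y = x + y"
    "\<one>\<^bsub>P\<^esub> = 1" "\<zero>\<^bsub>P\<^esub> = 0" for x y
    by (auto simp: P_def ring_of_type_algebra_def)
  have F4: "F4 = P Quot I" by (simp add: F4_def P_def I_def m_def Let_def)
  have I: "ideal I P" unfolding I_def by (rule P.genideal_ideal) (simp add: P_simps)
  interpret I: ideal I P by (rule I)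
  have mem_I: "p \<in> I \<longleftrightarrow> m dvd p" for p
    using P.cgenideal_eq_genideal[of m]
    by (auto simp: I_def cgenideal_def P_simps dvd_def mult.commute)
  have eq_iff: "I +>\<^bsub>P\<^esub> p = I +>\<^bsub>P\<^esub> q \<longleftrightarrow> m dvd p - q" for p q
  proof -
    have "p \<ominus>\<^bsub>P\<^esub> q = p - q"
    proof -
      have "(p \<ominus>\<^bsub>P\<^esub> q) + q = p" using P.minus_eq[of p q]
        by (metis P.a_assoc P.l_neg P.r_zero P_simps(1,3) UNIV_I P.a_inv_closed)
      then show ?thesis by (metis add_diff_cancel_right')
    qed
    then show ?thesis
      by (metis I P.quotient_eq_iff_same_a_r_cos P_simps(1) UNIV_I mem_I)
  qed
  define E :: "bit poly set" where "E = {0, 1, [:0, 1:], [:1, 1:]}"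
  have mod_E: "p mod m \<in> E" for p
  proof -
    have "degree (p mod m) < 2 \<or> p mod m = 0"
      using degree_mod_less[of m p] by (auto simp: m_def)
    then have "degree (p mod m) < 2" by auto
    then have "p mod m = [:coeff (p mod m) 0, coeff (p mod m) 1:]"
      by (intro poly_eqI) (auto simp: coeff_pCons coeff_eq_0 split: nat.splits)
    moreover have "[:a, b:] \<in> E" for a b :: bit
      by (cases a; cases b) (auto simp: E_def)
    ultimately show ?thesis by metis
  qed
  have red: "I +>\<^bsub>P\<^esub> p = I +>\<^bsub>P\<^esub> (p mod m)" for p
    unfolding eq_iff by (simp add: minus_mod_eq_mult_div)
  have carr: "carrier F4 = (\<lambda>p. I +>\<^bsub>P\<^esub> p) ` E"
    using red mod_E by (auto simp: F4 FactRing_def A_RCOSETS_def' P_simps)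
  have deg_E: "degree p \<le> 1" if "p \<in> E" for p using that by (auto simp: E_def)
  have inj: "inj_on (\<lambda>p. I +>\<^bsub>P\<^esub> p) E"
  proof (rule inj_onI)
    fix p q assume *: "p \<in> E" "q \<in> E" "I +>\<^bsub>P\<^esub> p = I +>\<^bsub>P\<^esub> q"
    have "degree (p - q) \<le> 1" using * deg_E by (intro degree_diff_le) auto
    then have "\<not> m dvd p - q \<or> p - q = 0"
      using dvd_imp_degree_le[of m "p - q"] by (auto simp: m_def)
    then show "p = q" using * eq_iff by auto
  qed
  have "card E = 4" by (simp add: E_def one_pCons)
  with inj show "Coset.order F4 = 4" by (simp add: Coset.order_def carr card_image)
  have "cring F4" unfolding F4 by (rule I.quotient_is_cring) (rule P.is_cring)
  then interpret F: cring F4 .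
  show "field F4"
  proof (rule F.cring_fieldI2)
    have zero: "\<zero>\<^bsub>F4\<^esub> = I +>\<^bsub>P\<^esub> 0" and one: "\<one>\<^bsub>F4\<^esub> = I +>\<^bsub>P\<^esub> 1"
      using I.a_rcos_const[of 0] by (auto simp: F4 FactRing_def P_simps mem_I)
    show "\<zero>\<^bsub>F4\<^esub> \<noteq> \<one>\<^bsub>F4\<^esub>"
      using inj by (auto simp: zero one E_def inj_on_def)
    fix C assume C: "C \<in> carrier F4" "C \<noteq> \<zero>\<^bsub>F4\<^esub>"
    then obtain p where p: "p \<in> E" "C = I +>\<^bsub>P\<^esub> p" "p \<noteq> 0" by (auto simp: carr zero)
    have mult: "(I +>\<^bsub>P\<^esub> a) \<otimes>\<^bsub>F4\<^esub> (I +>\<^bsub>P\<^esub> b) = I +>\<^bsub>P\<^esub> (a * b)" for a b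
      by (simp add: F4 FactRing_def I.rcoset_mult_add P_simps)
    have "\<exists>q\<in>E. m dvd p * q - 1"
      using p by (auto simp: E_def m_def one_pCons)
    then show "\<exists>D\<in>carrier F4. C \<otimes>\<^bsub>F4\<^esub> D = \<one>\<^bsub>F4\<^esub>"
      by (auto simp: p carr mult one eq_iff)
  qed
qed
definition M2_F2 :: "bit mat ring" where
  "M2_F2 = ring_mat TYPE(bit) 2 ()"

text \<open>
  \<open>F\<^sub>3[x, y]\<close> is taken as \<open>F\<^sub>3[x][y]\<close>, so \<open>x\<close> is the constant polynomial \<open>[:[:0, 1:]:]\<close> and
  \<open>y\<close> is \<open>[:0, 1:]\<close>.
\<close>

definition F3xy_quot :: "3 poly poly set ring" where
  "F3xy_quot =
    (let P = (ring_of_type_algebra :: 3 poly poly ring);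
         x = [:[:0, 1:]:];
         y = [:0, 1:]
     in P Quot (Idl\<^bsub>P\<^esub> {x ^ 2, x * y, y ^ 2}))"

definition T2_F3 :: "3 mat ring" where
  "T2_F3 = (ring_mat TYPE(3) 2 ())\<lparr>carrier := {A \<in> carrier_mat 2 2. upper_triangular A}\<rparr>"

end

theory Submission imports Defs "HOL-Library.Product_Plus"
begin

text \<open>Let \<open>R\<close> be the union of four proper subrings but not of three. An element of three of them lies in the
  fourth, and coset counting leaves two configurations: either all pairwise intersections coincide and
  are the kernel of a map of \<open>R\<close> onto a plane over \<open>F\<^sub>3\<close> whose four lines are the images of
  the subrings, or two of the subrings have additive index 2 and share an element that lies in neither of the other two. A proper subring
  either stays proper when \<open>\<one>\<close> is adjoined or comes with a cyclic quotient, and too many of the latter would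
  give a cover by three subrings; so all four may be taken unital. Modulo the largest ideal contained in all four subrings,
  their intersection \<open>D\<close> acts faithfully enough on both sides of \<open>R / D\<close> that \<open>R\<close> has at
  most 27 or 16 elements, and its multiplication table can be read off from a basis: the first
  configuration gives \<open>T\<^sub>2(F\<^sub>3)\<close> or \<open>F\<^sub>3[x,y]/(x\<^sup>2,xy,y\<^sup>2)\<close>, the second
  \<open>F\<^sub>4 \<times> F\<^sub>4\<close> or \<open>M\<^sub>2(F\<^sub>2)\<close>, where every degenerate table has two
  homomorphisms onto \<open>F\<^sub>2\<close> and hence a cover by three subrings. Conversely, each of the four rings has
  an explicit cover by four subrings, which pulls back to \<open>R\<close>.\<close>

text \<open>The common intersection D is a subring but need not be an ideal, so R / D is only an
  abelian group on which D acts from either side. Finiteness comes from D preserving the images of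
  all four subrings. In the first configuration these are the four lines of a plane over F_3, and a
  linear map preserving every line is a scalar; in the second, D acts on the groups R / A1 and R /
  A2 of order 2, and the two actions coincide. Each side thus gives a homomorphism from D to a prime
  field, with kernels \<open>left_kernel\<close> and \<open>right_kernel\<close>. Their intersection
  turns out to be a two-sided ideal inside D, hence zero after the reduction. In the second
  configuration one kernel contains the other, so D = {0, 1}. In the first, the two actions may
  differ; then R is spanned by four elements, two of them in a corner e R (1 - e) of square zero,
  and one of these two is divided out to reach \<open>T2_F3\<close>. Most right-handed statements
  are left-handed ones applied to the opposite ring.\<close>

section \<open>Quotients in coordinates\<close>

text \<open>Coordinates replace the quotient ring: the target is a type of tuples with its own
  addition, and its product \<open>m\<close> and unit \<open>u\<close> are passed as data. The ring
  laws for \<open>m\<close> come from R through the surjection, and identities between tuples can be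
  settled by simplification.\<close>

definition surjects_onto ::
    "('a, 'm) ring_scheme \<Rightarrow> ('v::ab_group_add \<Rightarrow> 'v \<Rightarrow> 'v) \<Rightarrow> 'v \<Rightarrow> bool" where
  "surjects_onto R m u \<longleftrightarrow>
     (\<exists>c. (\<forall>x\<in>carrier R. \<forall>y\<in>carrier R. c (x \<oplus>\<^bsub>R\<^esub> y) = c x + c y \<and> c (x \<otimes>\<^bsub>R\<^esub> y) = m (c x) (c y)) \<and>
          c \<one>\<^bsub>R\<^esub> = u \<and> c ` carrier R = UNIV)"

text \<open>\<open>g\<close> names the elements of Q by coordinates. From a quotient,
  \<open>c\<close> is the projection followed by the inverse of \<open>g\<close>. Conversely,
  \<open>g\<close> after \<open>c\<close> is a surjective homomorphism and the first isomorphism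
  theorem applies, Q being a ring as a homomorphic image of R.\<close>

lemma has_quotient_iso_iff_surjects_onto:
  fixes R :: "('a, 'm) ring_scheme" and Q :: "('b, 'n) ring_scheme"
    and g :: "'v::ab_group_add \<Rightarrow> 'b"
  assumes "ring R" and g: "inj g" "range g = carrier Q"
    and g_add: "\<And>x y. g (x + y) = g x \<oplus>\<^bsub>Q\<^esub> g y"
    and g_mult: "\<And>x y. g (m x y) = g x \<otimes>\<^bsub>Q\<^esub> g y"
    and g_one: "g u = \<one>\<^bsub>Q\<^esub>" and g_zero: "g 0 = \<zero>\<^bsub>Q\<^esub>"
  shows "has_quotient_iso R Q \<longleftrightarrow> surjects_onto R m u"
proof
  interpret R: ring R by fact
  have g_inv: "inv_into UNIV g (g x) = x" for x using g(1) by simp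
  assume "has_quotient_iso R Q"
  then obtain I \<phi> where I: "ideal I R" and \<phi>: "\<phi> \<in> ring_iso (R Quot I) Q"
    by (auto simp: has_quotient_iso_def is_ring_iso_def)
  interpret I: ideal I R by fact
  define h where "h = (\<lambda>x. \<phi> (I +>\<^bsub>R\<^esub> x))"
  have carr: "carrier (R Quot I) = (\<lambda>x. I +>\<^bsub>R\<^esub> x) ` carrier R"
    by (auto simp: FactRing_def A_RCOSETS_def')
  have h: "h \<in> Ring.ring_hom R Q"
    using ring_hom_trans[OF I.rcos_ring_hom, of \<phi> Q] \<phi> by (simp add: ring_iso_def h_def comp_def)
  have surj: "h ` carrier R = carrier Q"
    using \<phi> carr by (auto simp: ring_iso_def bij_betw_def h_def image_image)
  have ex: "\<exists>v. h x = g v" if "x \<in> carrier R" for x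
    using ring_hom_closed[OF h that] g(2) by auto
  define c where "c = inv_into UNIV g \<circ> h"
  have hc: "h x = g (c x)" if "x \<in> carrier R" for x
    using ex[OF that] g_inv by (auto simp: c_def)
  have "c (x \<oplus>\<^bsub>R\<^esub> y) = c x + c y \<and> c (x \<otimes>\<^bsub>R\<^esub> y) = m (c x) (c y)"
    if "x \<in> carrier R" "y \<in> carrier R" for x y
    using that ring_hom_add[OF h that] ring_hom_mult[OF h that] hc g(1)
    by (metis g_add g_inv g_mult R.add.m_closed R.m_closed)
  moreover have "c \<one>\<^bsub>R\<^esub> = u" using ring_hom_one[OF h] by (metis c_def comp_apply g_inv g_one)
  moreover have "c ` carrier R = UNIV"
  proof -
    have "c ` carrier R = inv_into UNIV g ` range g" by (simp only: c_def image_comp[symmetric] surj g(2))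
    then show ?thesis by (simp only: image_image g_inv image_ident)
  qed
  ultimately show "surjects_onto R m u" unfolding surjects_onto_def by blast
next
  interpret R: ring R by fact
  assume "surjects_onto R m u"
  then obtain c where c: "\<And>x y. x \<in> carrier R \<Longrightarrow> y \<in> carrier R \<Longrightarrow>
      c (x \<oplus>\<^bsub>R\<^esub> y) = c x + c y \<and> c (x \<otimes>\<^bsub>R\<^esub> y) = m (c x) (c y)"
    and c1: "c \<one>\<^bsub>R\<^esub> = u" and surj: "c ` carrier R = UNIV"
    unfolding surjects_onto_def by blast
  define h where "h = g \<circ> c"
  have h: "h \<in> Ring.ring_hom R Q"
    by (rule ring_hom_memI) (use g c c1 in \<open>auto simp: h_def g_add g_mult g_one\<close>)
  have "c \<zero>\<^bsub>R\<^esub> = 0" using c[of "\<zero>\<^bsub>R\<^esub>" "\<zero>\<^bsub>R\<^esub>"] by simp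
  then have h0: "h \<zero>\<^bsub>R\<^esub> = \<zero>\<^bsub>Q\<^esub>" by (simp add: h_def g_zero)
  have hsurj: "h ` carrier R = carrier Q"
    by (simp only: h_def image_comp[symmetric] surj g(2))
  have "ring Q" using R.ring_hom_imp_img_ring[OF h] by (simp add: h0 hsurj)
  then interpret h: ring_hom_ring R Q h by (intro ring_hom_ringI2 h R.ring_axioms)
  show "has_quotient_iso R Q"
    unfolding has_quotient_iso_def using h.FactRing_iso[OF hsurj] h.kernel_is_ideal by blast
qed

lemma F3_cases:
  fixes x :: 3
  obtains "x = 0" | "x = 1" | "x = 2"
proof (cases x)
  case (of_int z)
  then have "z = 0 \<or> z = 1 \<or> z = 2" by auto
  then show ?thesis using that of_int by auto
qed

text \<open>(a, b, d) is the matrix with rows (a, b) and (0, d).\<close>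

definition mult_T2 :: "3 \<times> 3 \<times> 3 \<Rightarrow> 3 \<times> 3 \<times> 3 \<Rightarrow> 3 \<times> 3 \<times> 3" where
  "mult_T2 = (\<lambda>(a, b, d) (a', b', d'). (a * a', a * b' + b * d', d * d'))"

text \<open>(a, b, c) stands for a + b x + c y.\<close>

definition mult_F3xy :: "3 \<times> 3 \<times> 3 \<Rightarrow> 3 \<times> 3 \<times> 3 \<Rightarrow> 3 \<times> 3 \<times> 3" where
  "mult_F3xy = (\<lambda>(a, b, c) (a', b', c'). (a * a', a * b' + b * a', a * c' + c * a'))"

definition mult_M2 :: "bit \<times> bit \<times> bit \<times> bit \<Rightarrow> bit \<times> bit \<times> bit \<times> bit \<Rightarrow> bit \<times> bit \<times> bit \<times> bit" where
  "mult_M2 = (\<lambda>(a, b, c, d) (a', b', c', d').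
     (a * a' + b * c', a * b' + b * d', c * a' + d * c', c * b' + d * d'))"

text \<open>(x, y) stands for x + y t with t^2 = t + 1.\<close>

definition mult_F4 :: "bit \<times> bit \<Rightarrow> bit \<times> bit \<Rightarrow> bit \<times> bit" where
  "mult_F4 = (\<lambda>(x, y) (x', y'). (x * x' + y * y', x * y' + y * x' + y * y'))"

definition mult_F4_F4 ::
    "(bit \<times> bit) \<times> (bit \<times> bit) \<Rightarrow> (bit \<times> bit) \<times> (bit \<times> bit) \<Rightarrow> (bit \<times> bit) \<times> (bit \<times> bit)" where
  "mult_F4_F4 = (\<lambda>(p, q) (p', q'). (mult_F4 p p', mult_F4 q q'))"

lemma sum_upto_2: "sum f {0..<2::nat} = f 0 + f 1"
  by (simp add: numeral_2_eq_2)

lemma has_quotient_iso_M2: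
  assumes "ring R"
  shows "has_quotient_iso R M2_F2 \<longleftrightarrow> surjects_onto R mult_M2 (1, 0, 0, 1)"
proof -
  define g :: "bit \<times> bit \<times> bit \<times> bit \<Rightarrow> bit mat" where
    "g = (\<lambda>(a, b, c, d). mat 2 2 (\<lambda>(i, j). if i = 0 then (if j = 0 then a else b) else (if j = 0 then c else d)))"
  have "inj g"
    by (rule inj_on_inverseI[where g = "\<lambda>A. (A $$ (0, 0), A $$ (0, 1), A $$ (1, 0), A $$ (1, 1))"])
      (auto simp: g_def)
  moreover have "range g = carrier M2_F2"
  proof
    show "range g \<subseteq> carrier M2_F2" by (auto simp: g_def M2_F2_def ring_mat_simps)
    have "A = g (A $$ (0, 0), A $$ (0, 1), A $$ (1, 0), A $$ (1, 1))" if "A \<in> carrier_mat 2 2" for A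
      using that by (intro eq_matI) (auto simp: g_def less_2_cases_iff)
    then show "carrier M2_F2 \<subseteq> range g" by (auto simp: M2_F2_def ring_mat_simps)
  qed
  ultimately show ?thesis
  proof (rule has_quotient_iso_iff_surjects_onto[OF assms])
    fix x y :: "bit \<times> bit \<times> bit \<times> bit"
    obtain a b c d where x: "x = (a, b, c, d)" by (metis surj_pair)
    obtain a' b' c' d' where y: "y = (a', b', c', d')" by (metis surj_pair)
    show "g (x + y) = g x \<oplus>\<^bsub>M2_F2\<^esub> g y"
      by (rule eq_matI) (simp_all add: x y g_def M2_F2_def ring_mat_simps)
    show "g (mult_M2 x y) = g x \<otimes>\<^bsub>M2_F2\<^esub> g y"
      by (rule eq_matI)
        (simp_all add: x y g_def M2_F2_def ring_mat_simps mult_M2_def scalar_prod_def sum_upto_2)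
  next
    show "g (1, 0, 0, 1) = \<one>\<^bsub>M2_F2\<^esub>" "g 0 = \<zero>\<^bsub>M2_F2\<^esub>"
      by (rule eq_matI; auto simp: g_def M2_F2_def ring_mat_simps zero_prod_def less_2_cases_iff)+
  qed
qed

lemma has_quotient_iso_T2:
  assumes "ring R"
  shows "has_quotient_iso R T2_F3 \<longleftrightarrow> surjects_onto R mult_T2 (1, 0, 1)"
proof -
  define g :: "3 \<times> 3 \<times> 3 \<Rightarrow> 3 mat" where
    "g = (\<lambda>(a, b, d). mat 2 2 (\<lambda>(i, j). if i = 0 then (if j = 0 then a else b) else (if j = 0 then 0 else d)))"
  have "inj g"
    by (rule inj_on_inverseI[where g = "\<lambda>A. (A $$ (0, 0), A $$ (0, 1), A $$ (1, 1))"])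
      (auto simp: g_def)
  moreover have "range g = carrier T2_F3"
  proof
    show "range g \<subseteq> carrier T2_F3" by (auto simp: g_def T2_F3_def ring_mat_simps upper_triangular_def)
    have "A = g (A $$ (0, 0), A $$ (0, 1), A $$ (1, 1))"
      if "A \<in> carrier_mat 2 2" "upper_triangular A" for A
      using that by (intro eq_matI) (auto simp: g_def less_2_cases_iff upper_triangular_def)
    then show "carrier T2_F3 \<subseteq> range g" by (auto simp: T2_F3_def ring_mat_simps)
  qed
  ultimately show ?thesis
  proof (rule has_quotient_iso_iff_surjects_onto[OF assms])
    fix x y :: "3 \<times> 3 \<times> 3"
    obtain a b d where x: "x = (a, b, d)" by (metis surj_pair)
    obtain a' b' d' where y: "y = (a', b', d')" by (metis surj_pair)
    show "g (x + y) = g x \<oplus>\<^bsub>T2_F3\<^esub> g y"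
      by (rule eq_matI) (simp_all add: x y g_def T2_F3_def ring_mat_simps)
    show "g (mult_T2 x y) = g x \<otimes>\<^bsub>T2_F3\<^esub> g y"
      by (rule eq_matI)
        (simp_all add: x y g_def T2_F3_def ring_mat_simps mult_T2_def scalar_prod_def sum_upto_2)
  next
    show "g (1, 0, 1) = \<one>\<^bsub>T2_F3\<^esub>" "g 0 = \<zero>\<^bsub>T2_F3\<^esub>"
      by (rule eq_matI; auto simp: g_def T2_F3_def ring_mat_simps zero_prod_def less_2_cases_iff)+
  qed
qed

text \<open>Coset arithmetic shared by the two quotients of polynomial rings.\<close>

lemma genideal_coset:
  fixes S :: "'c::comm_ring_1 set"
  defines "P \<equiv> (ring_of_type_algebra :: 'c ring)"
  defines "I \<equiv> Idl\<^bsub>P\<^esub> S"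
  shows "ideal I P"
    and "S \<subseteq> I"
    and "I +>\<^bsub>P\<^esub> p = I +>\<^bsub>P\<^esub> q \<longleftrightarrow> p - q \<in> I"
    and "carrier (P Quot I) = range (\<lambda>p. I +>\<^bsub>P\<^esub> p)"
    and "(I +>\<^bsub>P\<^esub> p) \<otimes>\<^bsub>P Quot I\<^esub> (I +>\<^bsub>P\<^esub> q) = I +>\<^bsub>P\<^esub> (p * q)"
    and "(I +>\<^bsub>P\<^esub> p) \<oplus>\<^bsub>P Quot I\<^esub> (I +>\<^bsub>P\<^esub> q) = I +>\<^bsub>P\<^esub> (p + q)"
    and "\<one>\<^bsub>P Quot I\<^esub> = I +>\<^bsub>P\<^esub> 1" and "\<zero>\<^bsub>P Quot I\<^esub> = I +>\<^bsub>P\<^esub> 0"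
proof -
  interpret P: cring P unfolding P_def by (rule cring_from_type_algebra)
  have P_simps: "carrier P = UNIV" "x \<otimes>\<^bsub>P\<^esub> y = x * y" "x \<oplus>\<^bsub>P\<^esub> y = x + y"
    "\<one>\<^bsub>P\<^esub> = 1" "\<zero>\<^bsub>P\<^esub> = 0" for x y
    by (auto simp: P_def ring_of_type_algebra_def)
  show I: "ideal I P" unfolding I_def by (rule P.genideal_ideal) (simp add: P_simps)
  show "S \<subseteq> I" unfolding I_def by (rule P.genideal_self) (simp add: P_simps)
  interpret I: ideal I P by (rule I)
  have "p \<ominus>\<^bsub>P\<^esub> q = p - q"
  proof -
    have "(p \<ominus>\<^bsub>P\<^esub> q) + q = p" using P.minus_eq[of p q]
      by (metis P.a_assoc P.l_neg P.r_zero P_simps(1,3) UNIV_I P.a_inv_closed)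
    then show ?thesis by (metis add_diff_cancel_right')
  qed
  then show "I +>\<^bsub>P\<^esub> p = I +>\<^bsub>P\<^esub> q \<longleftrightarrow> p - q \<in> I"
    by (metis I P.quotient_eq_iff_same_a_r_cos P_simps(1) UNIV_I)
  show "carrier (P Quot I) = range (\<lambda>p. I +>\<^bsub>P\<^esub> p)"
    by (auto simp: FactRing_def A_RCOSETS_def' P_simps)
  show "(I +>\<^bsub>P\<^esub> p) \<otimes>\<^bsub>P Quot I\<^esub> (I +>\<^bsub>P\<^esub> q) = I +>\<^bsub>P\<^esub> (p * q)"
    by (simp add: FactRing_def I.rcoset_mult_add P_simps)
  show "(I +>\<^bsub>P\<^esub> p) \<oplus>\<^bsub>P Quot I\<^esub> (I +>\<^bsub>P\<^esub> q) = I +>\<^bsub>P\<^esub> (p + q)"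
    by (simp add: FactRing_def I.a_rcos_sum P_simps)
  show "\<one>\<^bsub>P Quot I\<^esub> = I +>\<^bsub>P\<^esub> 1" by (simp add: FactRing_def P_simps)
  show "\<zero>\<^bsub>P Quot I\<^esub> = I +>\<^bsub>P\<^esub> 0"
    using I.a_rcos_const[of "0"] I.zero_closed by (simp add: FactRing_def P_simps)
qed

lemma has_quotient_iso_F3xy:
  assumes "ring R"
  shows "has_quotient_iso R F3xy_quot \<longleftrightarrow> surjects_onto R mult_F3xy (1, 0, 0)"
proof -
  define P where "P = (ring_of_type_algebra :: 3 poly poly ring)"
  define S :: "3 poly poly set" where "S = {[:[:0, 1:]:] ^ 2, [:[:0, 1:]:] * [:0, 1:], [:0, 1:] ^ 2}"
  define I where "I = Idl\<^bsub>P\<^esub> S"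
  note coset = genideal_coset[of S, folded P_def, folded I_def]
  have Q: "F3xy_quot = P Quot I"
    by (simp only: F3xy_quot_def Let_def P_def I_def S_def)
  interpret P: cring P unfolding P_def by (rule cring_from_type_algebra)
  have P_simps: "carrier P = UNIV" "x \<otimes>\<^bsub>P\<^esub> y = x * y" "x \<oplus>\<^bsub>P\<^esub> y = x + y" "\<zero>\<^bsub>P\<^esub> = 0" for x y
    by (auto simp: P_def ring_of_type_algebra_def)
  interpret I: ideal I P by (rule coset(1))
  \<comment> \<open>The inner variable is x and the outer one is y, so \<open>low\<close> reads off
    the coefficients of 1, x and y. The ideal is exactly its kernel.\<close>
  define low where "low = (\<lambda>p::3 poly poly. (coeff (coeff p 0) 0, coeff (coeff p 0) 1, coeff (coeff p 1) 0))"
  have low_ideal: "ideal {p. low p = 0} P"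
  proof (rule idealI[OF P.ring_axioms])
    have neg: "\<ominus>\<^bsub>P\<^esub> p = - p" for p
      by (metis P.l_neg P_simps(1,3,4) UNIV_I add_eq_0_iff2)
    show "subgroup {p. low p = 0} (add_monoid P)"
    proof
      fix p assume "p \<in> {p. low p = 0}"
      then show "inv\<^bsub>add_monoid P\<^esub> p \<in> {p. low p = 0}"
        unfolding a_inv_def[symmetric] neg by (simp add: low_def zero_prod_def)
    qed (auto simp: P_simps low_def zero_prod_def)
  qed (auto simp: P_simps low_def zero_prod_def coeff_mult)
  have low_S: "low p = 0" if "p \<in> S" for p
    using that by (auto simp: low_def S_def zero_prod_def power2_eq_square coeff_pCons split: nat.splits)
  have "I \<subseteq> {p. low p = 0}"
    unfolding I_def by (rule P.genideal_minimal[OF low_ideal]) (use low_S in auto)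
  moreover have "p \<in> I" if "low p = 0" for p
  proof -
    obtain p0 p1 q where p: "p = pCons p0 (pCons p1 q)" by (metis pCons_cases)
    obtain a b p0' where p0: "p0 = pCons a (pCons b p0')" by (metis pCons_cases)
    obtain d p1' where p1: "p1 = pCons d p1'" by (metis pCons_cases)
    have "a = 0" "b = 0" "d = 0" using that by (auto simp: low_def p p0 p1 zero_prod_def)
    \<comment> \<open>The summands collect the part of the y-free term divisible by x^2, the part of
      the y-linear term divisible by x, and everything divisible by y^2.\<close>
    then have p_eq: "p = [:[:0, 1:]:] ^ 2 * [:p0':] + [:[:0, 1:]:] * [:0, 1:] * [:p1':] + [:0, 1:] ^ 2 * q"
      by (simp add: p p0 p1 power2_eq_square)
    have mult: "s * r \<in> I" if "s \<in> S" for s r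
      using I.I_r_closed[of s r] coset(2) that by (auto simp: P_simps)
    have add: "x + y \<in> I" if "x \<in> I" "y \<in> I" for x y
      using I.a_closed[OF that] by (simp add: P_simps)
    show ?thesis by (subst p_eq) (intro add mult; simp only: S_def insert_iff simp_thms)
  qed
  ultimately have mem_I: "p \<in> I \<longleftrightarrow> low p = 0" for p by auto
  have low_diff: "low (p - q) = low p - low q" for p q by (simp add: low_def)
  define e :: "3 \<times> 3 \<times> 3 \<Rightarrow> 3 poly poly" where "e = (\<lambda>(a, b, c). [:[:a, b:], [:c:]:])"
  have low_e: "low (e v) = v" for v by (cases v) (simp add: e_def low_def)
  define g where "g = (\<lambda>v. I +>\<^bsub>P\<^esub> e v)"
  have "inj g"
    by (rule injI) (metis g_def coset(3) mem_I low_diff low_e eq_iff_diff_eq_0)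
  moreover have "range g = carrier F3xy_quot"
  proof -
    have "I +>\<^bsub>P\<^esub> p = g (low p)" for p
      unfolding g_def coset(3) mem_I low_diff low_e by simp
    then show ?thesis by (auto simp: Q coset(4) g_def)
  qed
  ultimately show ?thesis
  proof (rule has_quotient_iso_iff_surjects_onto[OF assms])
    fix x y
    show "g (x + y) = g x \<oplus>\<^bsub>F3xy_quot\<^esub> g y"
      by (cases x; cases y) (simp add: g_def Q coset(6), simp add: e_def)
    show "g (mult_F3xy x y) = g x \<otimes>\<^bsub>F3xy_quot\<^esub> g y"
      unfolding g_def Q coset(5) coset(3) mem_I low_diff low_e
      by (cases x; cases y) (simp add: e_def low_def mult_F3xy_def zero_prod_def algebra_simps)
  qed (simp_all add: g_def Q coset(7,8) e_def zero_prod_def one_pCons)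
qed

lemma has_quotient_iso_F4_F4:
  assumes "ring R"
  shows "has_quotient_iso R (RDirProd F4 F4) \<longleftrightarrow> surjects_onto R mult_F4_F4 ((1, 0), (1, 0))"
proof -
  define P where "P = (ring_of_type_algebra :: bit poly ring)"
  define m :: "bit poly" where "m = [:1, 1, 1:]"
  define I where "I = Idl\<^bsub>P\<^esub> {m}"
  note coset = genideal_coset[of "{m}", folded P_def, folded I_def]
  have Q: "F4 = P Quot I" by (simp add: F4_def P_def I_def m_def Let_def)
  interpret P: cring P unfolding P_def by (rule cring_from_type_algebra)
  have P_simps: "carrier P = UNIV" "x \<otimes>\<^bsub>P\<^esub> y = x * y" "x \<oplus>\<^bsub>P\<^esub> y = x + y" for x y
    by (auto simp: P_def ring_of_type_algebra_def)
  have mem_I: "p \<in> I \<longleftrightarrow> m dvd p" for p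
    using P.cgenideal_eq_genideal[of m]
    by (auto simp: I_def cgenideal_def P_simps dvd_def mult.commute)
  define e :: "bit \<times> bit \<Rightarrow> bit poly" where "e = (\<lambda>(a, b). [:a, b:])"
  define g where "g = (\<lambda>v. I +>\<^bsub>P\<^esub> e v)"
  have deg_e: "degree (e v) \<le> 1" for v by (cases v) (simp add: e_def)
  have "inj g"
  proof (rule injI)
    fix v w assume "g v = g w"
    then have "m dvd e v - e w" by (simp add: g_def coset(3) mem_I)
    moreover have "degree (e v - e w) \<le> 1" using deg_e by (intro degree_diff_le)
    ultimately have "e v - e w = 0" using dvd_imp_degree_le[of m "e v - e w"] by (auto simp: m_def)
    then have "coeff (e v) i = coeff (e w) i" for i by simp
    from this[of 0] this[of 1] show "v = w" by (cases v; cases w) (simp add: e_def)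
  qed
  moreover have "range g = carrier F4"
  proof -
    \<comment> \<open>Division by the quadratic \<open>m\<close> leaves a remainder of degree below
      2, whose coefficients are the coordinates.\<close>
    have "I +>\<^bsub>P\<^esub> p = g (coeff (p mod m) 0, coeff (p mod m) 1)" for p
    proof -
      have "degree (p mod m) < 2"
        using degree_mod_less[of m p] by (auto simp: m_def)
      then have "e (coeff (p mod m) 0, coeff (p mod m) 1) = p mod m"
        by (intro poly_eqI) (auto simp: e_def coeff_pCons coeff_eq_0 split: nat.splits)
      then show ?thesis by (simp add: g_def coset(3) mem_I minus_mod_eq_mult_div)
    qed
    then show ?thesis by (auto simp: Q coset(4) g_def)
  qed
  moreover have "g (x + y) = g x \<oplus>\<^bsub>F4\<^esub> g y" for x y
    by (cases x; cases y) (simp add: g_def Q coset(6), simp add: e_def)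
  moreover have "g (mult_F4 x y) = g x \<otimes>\<^bsub>F4\<^esub> g y" for x y
  proof -
    \<comment> \<open>The product of two linear representatives has t^2-coefficient
      \<open>snd x * snd y\<close>; removing that multiple of \<open>m\<close> reduces it.\<close>
    have "e x * e y - e (mult_F4 x y) = smult (snd x * snd y) m"
    proof -
      obtain a b c d where "x = (a, b)" "y = (c, d)" by fastforce
      then show ?thesis
        by (cases a; cases b; cases c; cases d) (simp_all add: e_def m_def mult_F4_def)
    qed
    then have "m dvd e x * e y - e (mult_F4 x y)" by (simp add: dvd_smult)
    then show ?thesis unfolding g_def Q coset(5) coset(3) mem_I
      by (metis dvd_minus_iff minus_diff_eq)
  qed
  moreover have "g (1, 0) = \<one>\<^bsub>F4\<^esub>" "g 0 = \<zero>\<^bsub>F4\<^esub>"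
    by (simp_all add: g_def Q coset(7,8) e_def zero_prod_def one_pCons)
  moreover have "\<zero>\<^bsub>RDirProd F4 F4\<^esub> = (\<zero>\<^bsub>F4\<^esub>, \<zero>\<^bsub>F4\<^esub>)" "\<one>\<^bsub>RDirProd F4 F4\<^esub> = (\<one>\<^bsub>F4\<^esub>, \<one>\<^bsub>F4\<^esub>)"
    "(p, q) \<oplus>\<^bsub>RDirProd F4 F4\<^esub> (p', q') = (p \<oplus>\<^bsub>F4\<^esub> p', q \<oplus>\<^bsub>F4\<^esub> q')"
    "(p, q) \<otimes>\<^bsub>RDirProd F4 F4\<^esub> (p', q') = (p \<otimes>\<^bsub>F4\<^esub> p', q \<otimes>\<^bsub>F4\<^esub> q')" for p q p' q'
    by (auto simp: RDirProd_def DirProd_def monoid.defs)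
  ultimately show ?thesis
    by (intro has_quotient_iso_iff_surjects_onto[OF assms, where g = "map_prod g g"])
      (auto simp: RDirProd_carrier mult_F4_F4_def zero_prod_def prod.inj_map map_prod_surj_on[of g UNIV _ g UNIV, simplified])
qed

section \<open>Covers of the four rings\<close>

context ring
begin

lemma nonunital_subringI:
  assumes "S \<subseteq> carrier R" "\<zero> \<in> S"
    and "\<And>x y. x \<in> S \<Longrightarrow> y \<in> S \<Longrightarrow> x \<ominus> y \<in> S"
    and "\<And>x y. x \<in> S \<Longrightarrow> y \<in> S \<Longrightarrow> x \<otimes> y \<in> S"
  shows "nonunital_subring S R"
proof -
  have neg: "\<ominus> x \<in> S" if "x \<in> S" for x
    using assms(3)[OF assms(2) that] that assms(1) by (simp add: minus_eq subsetD)
  have add: "x \<oplus> y \<in> S" if "x \<in> S" "y \<in> S" for x y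
    using assms(3)[OF that(1) neg[OF that(2)]] that assms(1) by (simp add: minus_eq subsetD)
  have "subgroup S (add_monoid R)"
    by (rule add.subgroupI) (use assms(1,2) neg add in \<open>auto simp: a_inv_def\<close>)
  then show ?thesis
    using assms(4) by (simp add: nonunital_subring_def additive_subgroup_def)
qed

lemma nonunital_subringD:
  assumes "nonunital_subring S R"
  shows "\<And>x. x \<in> S \<Longrightarrow> x \<in> carrier R" "\<zero> \<in> S"
    and "\<And>x y. x \<in> S \<Longrightarrow> y \<in> S \<Longrightarrow> x \<oplus> y \<in> S"
    and "\<And>x. x \<in> S \<Longrightarrow> \<ominus> x \<in> S"
    and "\<And>x y. x \<in> S \<Longrightarrow> y \<in> S \<Longrightarrow> x \<ominus> y \<in> S"
    and "\<And>x y. x \<in> S \<Longrightarrow> y \<in> S \<Longrightarrow> x \<otimes> y \<in> S"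
proof -
  interpret additive_subgroup S R using assms by (simp add: nonunital_subring_def)
  show "\<And>x. x \<in> S \<Longrightarrow> x \<in> carrier R" "\<zero> \<in> S"
    "\<And>x y. x \<in> S \<Longrightarrow> y \<in> S \<Longrightarrow> x \<oplus> y \<in> S" "\<And>x. x \<in> S \<Longrightarrow> \<ominus> x \<in> S"
    "\<And>x y. x \<in> S \<Longrightarrow> y \<in> S \<Longrightarrow> x \<ominus> y \<in> S"
    using a_subset by (auto simp: minus_eq)
  show "\<And>x y. x \<in> S \<Longrightarrow> y \<in> S \<Longrightarrow> x \<otimes> y \<in> S"
    using assms by (simp add: nonunital_subring_def)
qed

lemma nonunital_subring_add_iff:
  assumes S: "nonunital_subring S R" and x: "x \<in> S" and y: "y \<in> carrier R"
  shows "x \<oplus> y \<in> S \<longleftrightarrow> y \<in> S" "y \<oplus> x \<in> S \<longleftrightarrow> y \<in> S"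
proof -
  note D = nonunital_subringD[OF S]
  have 1: "y \<in> S" if "x \<oplus> y \<in> S"
  proof -
    have "\<ominus> x \<oplus> (x \<oplus> y) \<in> S" using D(3)[OF D(4)[OF x] that] .
    then show ?thesis using D(1)[OF x] y by (simp add: r_neg1)
  qed
  then show 2: "x \<oplus> y \<in> S \<longleftrightarrow> y \<in> S" using D(3)[OF x] by blast
  show "y \<oplus> x \<in> S \<longleftrightarrow> y \<in> S" using 2 a_comm[OF D(1)[OF x] y] by simp
qed

lemma nonunital_subring_neg_iff:
  assumes S: "nonunital_subring S R" and y: "y \<in> carrier R"
  shows "\<ominus> y \<in> S \<longleftrightarrow> y \<in> S"
  using nonunital_subringD(4)[OF S] y by (metis minus_minus)

end

text \<open>Repetitions are allowed, so any three proper subrings with union R contradict its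
  negation at once, without counting them.\<close>

definition three_cover :: "('a, 'm) ring_scheme \<Rightarrow> bool" where
  "three_cover R \<longleftrightarrow> (\<exists>A B C. nonunital_subring A R \<and> nonunital_subring B R \<and> nonunital_subring C R \<and>
     A \<noteq> carrier R \<and> B \<noteq> carrier R \<and> C \<noteq> carrier R \<and> carrier R = A \<union> B \<union> C)"

section \<open>Bounds for the covering number\<close>

lemma covering_number_le:
  assumes "finite \<C>" "proper_subring_cover R \<C>"
  shows "covering_number R \<le> enat (card \<C>)"
  unfolding covering_number_def by (rule INF_lower) (use assms in simp)

lemma covering_number_le_4:
  assumes "nonunital_subring A R" "nonunital_subring B R" "nonunital_subring C R" "nonunital_subring E R"
    and "A \<noteq> carrier R" "B \<noteq> carrier R" "C \<noteq> carrier R" "E \<noteq> carrier R"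
    and "carrier R = A \<union> B \<union> C \<union> E"
  shows "covering_number R \<le> 4"
proof -
  have "covering_number R \<le> enat (card {A, B, C, E})"
    by (rule covering_number_le) (use assms in \<open>auto simp: proper_subring_cover_def\<close>)
  also have "\<dots> \<le> enat 4" by (simp add: card_insert_if)
  finally show ?thesis by (simp add: numeral_eq_enat)
qed

lemma three_cover_imp_covering_number_le:
  assumes "three_cover R"
  shows "covering_number R \<le> 3"
proof -
  obtain A B C where ABC: "nonunital_subring A R" "nonunital_subring B R" "nonunital_subring C R"
     "A \<noteq> carrier R" "B \<noteq> carrier R" "C \<noteq> carrier R" "carrier R = A \<union> B \<union> C"
    using assms unfolding three_cover_def by blast
  have "covering_number R \<le> enat (card {A, B, C})"
    by (rule covering_number_le) (use ABC in \<open>auto simp: proper_subring_cover_def\<close>)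
  also have "\<dots> \<le> enat 3" by (simp add: card_insert_if)
  finally show ?thesis by (simp add: numeral_eq_enat)
qed

text \<open>Neither subring contains the other; for x only in S and y only in T, the sum x + y lies
  in neither.\<close>

lemma (in ring) proper_subrings_union_neq:
  assumes S: "nonunital_subring S R" and T: "nonunital_subring T R"
    and "S \<noteq> carrier R" "T \<noteq> carrier R"
  shows "S \<union> T \<noteq> carrier R"
proof
  assume U: "S \<union> T = carrier R"
  then obtain x y where x: "x \<in> S" "x \<notin> T" and y: "y \<in> T" "y \<notin> S"
    using assms by blast
  then have carr: "x \<in> carrier R" "y \<in> carrier R" using U by auto
  then have "x \<oplus> y \<in> S \<union> T" using U by auto
  then show False
    using nonunital_subring_add_iff(1)[OF S x(1) carr(2)] nonunital_subring_add_iff(2)[OF T y(1) carr(1)] x y by auto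
qed

text \<open>This turns an upper bound of 4, with the value 3 excluded, into equality.\<close>

lemma (in ring) covering_number_ge_3: "3 \<le> covering_number R"
  unfolding covering_number_def
proof (rule INF_greatest)
  fix \<C> assume "\<C> \<in> {\<C>. finite \<C> \<and> proper_subring_cover R \<C>}"
  then have C: "finite \<C>" "\<Union>\<C> = carrier R"
    "\<And>S. S \<in> \<C> \<Longrightarrow> nonunital_subring S R \<and> S \<noteq> carrier R"
    by (auto simp: proper_subring_cover_def)
  have "\<not> card \<C> \<le> 2"
  proof
    assume "card \<C> \<le> 2"
    then consider "card \<C> = 0" | "card \<C> = 1" | "card \<C> = 2" by linarith
    then show False
    proof cases
      case 1
      then have "carrier R = {}" using C by auto
      then show False using zero_closed by blast
    next
      case 2
      then obtain S where "\<C> = {S}" by (auto simp: card_1_singleton_iff)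
      then show False using C by auto
    next
      case 3
      then obtain S T where "\<C> = {S, T}" by (auto simp: card_2_iff)
      then show False using C(2) C(3)[of S] C(3)[of T] proper_subrings_union_neq[of S T] by auto
    qed
  qed
  then show "3 \<le> enat (card \<C>)" by (simp add: numeral_eq_enat)
qed

text \<open>The infimum of a nonempty set in the well-ordered type \<open>enat\<close> is attained,
  so some cover has exactly four members; a cover by three would lower the value to 3.\<close>

lemma covering_number_eq_4E:
  assumes "covering_number R = 4"
  obtains A B C E where
    "nonunital_subring A R" "nonunital_subring B R" "nonunital_subring C R" "nonunital_subring E R"
    "A \<noteq> carrier R" "B \<noteq> carrier R" "C \<noteq> carrier R" "E \<noteq> carrier R"
    "carrier R = A \<union> B \<union> C \<union> E" "\<not> three_cover R"
proof -
  define covers where "covers = {\<C>. finite \<C> \<and> proper_subring_cover R \<C>}"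
  have inf: "Inf ((\<lambda>\<C>. enat (card \<C>)) ` covers) = 4"
    using assms by (simp only: covering_number_def covers_def)
  \<comment> \<open>Without finite covers the infimum would be \<open>\<infinity>\<close>.\<close>
  have "covers \<noteq> {}"
  proof
    assume "covers = {}"
    then have "Inf ((\<lambda>\<C>. enat (card \<C>)) ` covers) = \<infinity>" by (simp add: Inf_enat_def)
    then show False using inf by simp
  qed
  then obtain \<C>0 where "\<C>0 \<in> covers" by blast
  then have "enat (card \<C>0) \<in> (\<lambda>\<C>. enat (card \<C>)) ` covers" by (rule imageI)
  then have "Inf ((\<lambda>\<C>. enat (card \<C>)) ` covers) \<in> (\<lambda>\<C>. enat (card \<C>)) ` covers" by (rule wellorder_InfI)
  then obtain \<C> where C: "\<C> \<in> covers" "4 = enat (card \<C>)" unfolding inf by (rule imageE)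
  then have "card \<C> = Suc 3" by (simp add: numeral_eq_enat)
  then obtain A \<C>' where C': "\<C> = insert A \<C>'" "card \<C>' = 3" unfolding card_Suc_eq by blast
  then obtain B C E where "\<C>' = {B, C, E}" unfolding card_3_iff by blast
  with C' have eq: "\<C> = {A, B, C, E}" by simp
  have "proper_subring_cover R {A, B, C, E}" using C(1) unfolding covers_def eq by simp
  then have cover: "nonunital_subring A R \<and> A \<noteq> carrier R" "nonunital_subring B R \<and> B \<noteq> carrier R"
    "nonunital_subring C R \<and> C \<noteq> carrier R" "nonunital_subring E R \<and> E \<noteq> carrier R"
    "carrier R = A \<union> B \<union> C \<union> E"
    by (simp_all add: proper_subring_cover_def Un_assoc)
  have "\<not> three_cover R"
  proof
    assume "three_cover R"
    then have "(4::enat) \<le> 3" using three_cover_imp_covering_number_le assms by metis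
    then show False by simp
  qed
  then show ?thesis
    by (rule that[OF conjunct1[OF cover(1)] conjunct1[OF cover(2)] conjunct1[OF cover(3)] conjunct1[OF cover(4)]
      conjunct2[OF cover(1)] conjunct2[OF cover(2)] conjunct2[OF cover(3)] conjunct2[OF cover(4)] cover(5)])
qed

lemma surjects_onto_vimage_subring:
  fixes c :: "'a \<Rightarrow> 'v::ab_group_add"
  assumes "ring R"
    and c: "\<And>x y. x \<in> carrier R \<Longrightarrow> y \<in> carrier R \<Longrightarrow>
      c (x \<oplus>\<^bsub>R\<^esub> y) = c x + c y \<and> c (x \<otimes>\<^bsub>R\<^esub> y) = m (c x) (c y)"
    and T: "0 \<in> T" "\<And>x y. x \<in> T \<Longrightarrow> y \<in> T \<Longrightarrow> x - y \<in> T" "\<And>x y. x \<in> T \<Longrightarrow> y \<in> T \<Longrightarrow> m x y \<in> T"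
  shows "nonunital_subring {x \<in> carrier R. c x \<in> T} R"
proof -
  interpret ring R by fact
  have c0: "c \<zero>\<^bsub>R\<^esub> = 0" using c[of "\<zero>\<^bsub>R\<^esub>" "\<zero>\<^bsub>R\<^esub>"] by simp
  have neg: "c (\<ominus>\<^bsub>R\<^esub> x) = - c x" if "x \<in> carrier R" for x
  proof -
    have "c x + c (\<ominus>\<^bsub>R\<^esub> x) = 0" using c[OF that a_inv_closed[OF that]] that c0 by (simp add: r_neg)
    then show ?thesis by (simp add: add_eq_0_iff)
  qed
  show ?thesis
    by (rule nonunital_subringI)
      (use T c c0 in \<open>auto simp: minus_eq neg\<close>)
qed

lemma surjects_onto_imp_covering_number_le_4:
  fixes R :: "('a, 'm) ring_scheme" and m :: "'v::ab_group_add \<Rightarrow> 'v \<Rightarrow> 'v"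
  assumes R: "ring R" and so: "surjects_onto R m u"
    and cover: "\<And>x. x \<in> T 0 \<or> x \<in> T 1 \<or> x \<in> T 2 \<or> x \<in> T (3::nat)"
    and proper: "\<And>i. i < 4 \<Longrightarrow> \<exists>x. x \<notin> T i"
    and zero: "\<And>i. i < 4 \<Longrightarrow> 0 \<in> T i"
    and diff: "\<And>i x y. i < 4 \<Longrightarrow> x \<in> T i \<Longrightarrow> y \<in> T i \<Longrightarrow> x - y \<in> T i"
    and mult: "\<And>i x y. i < 4 \<Longrightarrow> x \<in> T i \<Longrightarrow> y \<in> T i \<Longrightarrow> m x y \<in> T i"
  shows "covering_number R \<le> 4"
proof -
  obtain c where c: "\<And>x y. x \<in> carrier R \<Longrightarrow> y \<in> carrier R \<Longrightarrow>
      c (x \<oplus>\<^bsub>R\<^esub> y) = c x + c y \<and> c (x \<otimes>\<^bsub>R\<^esub> y) = m (c x) (c y)"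
    and surj: "c ` carrier R = UNIV"
    using so unfolding surjects_onto_def by blast
  define S where "S i = {x \<in> carrier R. c x \<in> T i}" for i
  have sub: "nonunital_subring (S i) R" if "i < 4" for i
    unfolding S_def
    by (rule surjects_onto_vimage_subring[where m = m])
      (use R c zero[OF that] diff[OF that] mult[OF that] in auto)
  have ne: "S i \<noteq> carrier R" if "i < 4" for i
  proof -
    obtain v where "v \<notin> T i" using proper \<open>i < 4\<close> by blast
    moreover obtain x where "x \<in> carrier R" "c x = v" using surj by (metis UNIV_I imageE)
    ultimately show ?thesis by (auto simp: S_def)
  qed
  have "carrier R = S 0 \<union> S 1 \<union> S 2 \<union> S 3"
  proof -
    have "x \<in> S 0 \<union> S 1 \<union> S 2 \<union> S 3" if "x \<in> carrier R" for x
    proof -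
      show ?thesis using cover[of "c x"] that by (auto simp: S_def)
    qed
    then show ?thesis by (auto simp: S_def)
  qed
  then show ?thesis by (intro covering_number_le_4[of "S 0" R "S 1" "S 2" "S 3"] sub ne) auto
qed

section \<open>Explicit covers by four subrings\<close>

lemma T2_covering_number_le_4:
  assumes "ring R" "surjects_onto R mult_T2 u"
  shows "covering_number R \<le> 4"
proof (rule surjects_onto_imp_covering_number_le_4[OF assms])
  \<comment> \<open>The diagonal matrices, their two conjugates by nontrivial unipotent matrices,
    and the matrices with equal diagonal entries. If a and d differ, then b / (a - d) is 0, 1 or -1,
    which selects one of the first three.\<close>
  define T :: "nat \<Rightarrow> (3 \<times> 3 \<times> 3) set" where
    "T i = (if i = 0 then {(a, b, d). b = 0} else if i = 1 then {(a, b, d). b = a - d}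
       else if i = 2 then {(a, b, d). b = d - a} else {(a, b, d). a = d})" for i
  show "x \<in> T 0 \<or> x \<in> T 1 \<or> x \<in> T 2 \<or> x \<in> T 3" for x
  proof -
    obtain a b d where x: "x = (a, b, d)" by (metis surj_pair)
    show ?thesis
      by (rule F3_cases[of a]; rule F3_cases[of b]; rule F3_cases[of d]) (simp_all add: T_def x)
  qed
  fix i :: nat assume "i < 4"
  then show "0 \<in> T i" by (auto simp: T_def zero_prod_def)
  show "\<exists>x. x \<notin> T i"
    \<comment> \<open>(1, 2, 0) satisfies b = d - a, so index 2 gets its own witness.\<close>
    by (rule exI[of _ "if i = 2 then (0, 1, 0) else (1, 2, 0)"]) (simp add: T_def)
  fix x y assume "x \<in> T i" "y \<in> T i"
  then show "x - y \<in> T i" "mult_T2 x y \<in> T i"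
    by (auto simp: T_def mult_T2_def algebra_simps split: if_splits)
qed

lemma F3xy_covering_number_le_4:
  assumes "ring R" "surjects_onto R mult_F3xy u"
  shows "covering_number R \<le> 4"
proof (rule surjects_onto_imp_covering_number_le_4[OF assms])
  \<comment> \<open>x and y span a plane of square zero, so each of its four lines together with the
    constants is a subring, and four lines cover a plane over F_3.\<close>
  define T :: "nat \<Rightarrow> (3 \<times> 3 \<times> 3) set" where
    "T i = (if i = 0 then {(a, b, c). b = 0} else if i = 1 then {(a, b, c). c = 0}
       else if i = 2 then {(a, b, c). b = c} else {(a, b, c). b = - c})" for i
  show "x \<in> T 0 \<or> x \<in> T 1 \<or> x \<in> T 2 \<or> x \<in> T 3" for x
  proof -
    obtain a b d where x: "x = (a, b, d)" by (metis surj_pair)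
    show ?thesis
      by (rule F3_cases[of b]; rule F3_cases[of d]) (simp_all add: T_def x)
  qed
  fix i :: nat assume "i < 4"
  then show "0 \<in> T i" by (auto simp: T_def zero_prod_def)
  show "\<exists>x. x \<notin> T i"
    by (rule exI[of _ "if i = 2 then (0, 1, 2) else (0, 1, 1)"]) (simp add: T_def)
  fix x y assume xy: "x \<in> T i" "y \<in> T i"
  obtain a b c a' b' c' where eq: "x = (a, b, c)" "y = (a', b', c')" by (metis surj_pair)
  show "x - y \<in> T i" "mult_F3xy x y \<in> T i"
    using xy unfolding eq by (cases "i = 0"; cases "i = 1"; cases "i = 2"; simp add: T_def mult_F3xy_def)+
qed

lemma all_bit: "(\<forall>x::bit. P x) \<longleftrightarrow> P 0 \<and> P 1"
  by (metis bit.exhaust)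

lemma M2_covering_number_le_4:
  assumes "ring R" "surjects_onto R mult_M2 u"
  shows "covering_number R \<le> 4"
proof (rule surjects_onto_imp_covering_number_le_4[OF assms])
  \<comment> \<open>The stabilisers of the three lines of F_2^2, spanned by (1, 0), (0, 1) and (1,
    1), and a copy of F_4: a matrix without an eigenvector satisfies A^2 + A + 1 = 0 and is one of
    the two non-scalar elements of that field.\<close>
  define T :: "nat \<Rightarrow> (bit \<times> bit \<times> bit \<times> bit) set" where
    "T i = (if i = 0 then {(a, b, c, d). c = 0} else if i = 1 then {(a, b, c, d). b = 0}
       else if i = 2 then {(a, b, c, d). a + b = c + d} else {(a, b, c, d). b = c \<and> a = b + d})" for i
  show "x \<in> T 0 \<or> x \<in> T 1 \<or> x \<in> T 2 \<or> x \<in> T 3" for x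
  proof -
    obtain a b c d where x: "x = (a, b, c, d)" by (metis surj_pair)
    show ?thesis
      by (cases a; cases b; cases c; cases d) (simp_all add: T_def x)
  qed
  fix i :: nat assume "i < 4"
  then show "0 \<in> T i" by (auto simp: T_def zero_prod_def)
  show "\<exists>x. x \<notin> T i"
    by (rule exI[of _ "if i = 2 then (1, 0, 0, 0) else (0, 1, 1, 0)"]) (simp add: T_def)
  have "\<forall>a b c d a' b' c' d'. (a, b, c, d) \<in> T i \<longrightarrow> (a', b', c', d') \<in> T i \<longrightarrow>
      (a, b, c, d) - (a', b', c', d') \<in> T i \<and> mult_M2 (a, b, c, d) (a', b', c', d') \<in> T i"
    using \<open>i < 4\<close>
    by (cases "i = 0"; cases "i = 1"; cases "i = 2"; simp add: T_def mult_M2_def all_bit)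
  then show "x - y \<in> T i" "mult_M2 x y \<in> T i" if "x \<in> T i" "y \<in> T i" for x y
    using that by (cases x; cases y; blast)+
qed

lemma F4_F4_covering_number_le_4:
  assumes "ring R" "surjects_onto R mult_F4_F4 u"
  shows "covering_number R \<le> 4"
proof (rule surjects_onto_imp_covering_number_le_4[OF assms])
  \<comment> \<open>F_2 x F_4, F_4 x F_2, the diagonal, and the graph of Frobenius, which sends c +
    d t to (c + d) + d t. Two elements of F_4 outside F_2 are equal or conjugate.\<close>
  define T :: "nat \<Rightarrow> ((bit \<times> bit) \<times> (bit \<times> bit)) set" where
    "T i = (if i = 0 then {((a, b), (c, d)). b = 0} else if i = 1 then {((a, b), (c, d)). d = 0}
       else if i = 2 then {((a, b), (c, d)). a = c \<and> b = d} else {((a, b), (c, d)). b = d \<and> a = c + d})" for i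
  show "x \<in> T 0 \<or> x \<in> T 1 \<or> x \<in> T 2 \<or> x \<in> T 3" for x
  proof -
    obtain a b c d where x: "x = ((a, b), (c, d))" by (metis surj_pair)
    show ?thesis
      by (cases a; cases b; cases c; cases d) (simp_all add: T_def x)
  qed
  fix i :: nat assume "i < 4"
  then show "0 \<in> T i" by (auto simp: T_def zero_prod_def)
  show "\<exists>x. x \<notin> T i"
    by (rule exI[of _ "if i = 0 \<or> i = 1 \<or> i = 2 then ((0, 1), (1, 1)) else ((0, 0), (0, 1))"]) (simp add: T_def)
  have "\<forall>a b c d a' b' c' d'. ((a, b), c, d) \<in> T i \<longrightarrow> ((a', b'), c', d') \<in> T i \<longrightarrow>
      ((a, b), c, d) - ((a', b'), c', d') \<in> T i \<and> mult_F4_F4 ((a, b), c, d) ((a', b'), c', d') \<in> T i"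
    using \<open>i < 4\<close>
    by (cases "i = 0"; cases "i = 1"; cases "i = 2"; simp add: T_def mult_F4_F4_def mult_F4_def all_bit)
  then show "x - y \<in> T i" "mult_F4_F4 x y \<in> T i" if "x \<in> T i" "y \<in> T i" for x y
    using that by (cases x; cases y; cases "fst x"; cases "snd x"; cases "fst y"; cases "snd y"; simp)+
qed

section \<open>Intersection patterns of four subrings\<close>

lemma (in ring) nonunital_subring_diff_iff:
  assumes S: "nonunital_subring S R" and y: "y \<in> carrier R"
  shows "x \<in> S \<Longrightarrow> x \<ominus> y \<in> S \<longleftrightarrow> y \<in> S" "x \<in> S \<Longrightarrow> y \<ominus> x \<in> S \<longleftrightarrow> y \<in> S"
  using nonunital_subring_add_iff[OF S, of x "\<ominus> y"] nonunital_subring_add_iff[OF S, of "\<ominus> x" y]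
    nonunital_subring_neg_iff[OF S y] nonunital_subringD(4)[OF S] y
  by (simp_all add: minus_eq)

locale four_cover = ring R for R (structure) +
  fixes A1 A2 A3 A4
  assumes sub1: "nonunital_subring A1 R" and sub2: "nonunital_subring A2 R"
    and sub3: "nonunital_subring A3 R" and sub4: "nonunital_subring A4 R"
    and proper1: "A1 \<noteq> carrier R" and proper2: "A2 \<noteq> carrier R"
    and proper3: "A3 \<noteq> carrier R" and proper4: "A4 \<noteq> carrier R"
    and cover: "carrier R = A1 \<union> A2 \<union> A3 \<union> A4"
    and no_three_cover: "\<not> three_cover R"
begin

lemmas sub_rules =
  nonunital_subringD[OF sub1] nonunital_subringD[OF sub2] nonunital_subringD[OF sub3] nonunital_subringD[OF sub4]

lemmas sub_iffs [simp] =
  nonunital_subring_add_iff[OF sub1] nonunital_subring_diff_iff[OF sub1] nonunital_subring_neg_iff[OF sub1]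
  nonunital_subring_add_iff[OF sub2] nonunital_subring_diff_iff[OF sub2] nonunital_subring_neg_iff[OF sub2]
  nonunital_subring_add_iff[OF sub3] nonunital_subring_diff_iff[OF sub3] nonunital_subring_neg_iff[OF sub3]
  nonunital_subring_add_iff[OF sub4] nonunital_subring_diff_iff[OF sub4] nonunital_subring_neg_iff[OF sub4]

lemma in_carrier: "x \<in> A1 \<Longrightarrow> x \<in> carrier R" "x \<in> A2 \<Longrightarrow> x \<in> carrier R"
  "x \<in> A3 \<Longrightarrow> x \<in> carrier R" "x \<in> A4 \<Longrightarrow> x \<in> carrier R"
  using cover by auto

lemma in_cover: "x \<in> carrier R \<Longrightarrow> x \<notin> A1 \<Longrightarrow> x \<notin> A2 \<Longrightarrow> x \<notin> A3 \<Longrightarrow> x \<in> A4"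
  using cover by auto

text \<open>Adjacent transpositions generate all relabellings, so each later fact is proved for one
  labelling and transported.\<close>

lemma perm12: "four_cover R A2 A1 A3 A4"
  by unfold_locales (use sub1 sub2 sub3 sub4 proper1 proper2 proper3 proper4 cover no_three_cover in auto)

lemma perm23: "four_cover R A1 A3 A2 A4"
  by unfold_locales (use sub1 sub2 sub3 sub4 proper1 proper2 proper3 proper4 cover no_three_cover in auto)

lemma perm34: "four_cover R A1 A2 A4 A3"
  by unfold_locales (use sub1 sub2 sub3 sub4 proper1 proper2 proper3 proper4 cover no_three_cover in auto)

lemma irredundant4:
  obtains y where "y \<in> A4" "y \<notin> A1" "y \<notin> A2" "y \<notin> A3"
proof (rule ccontr)
  assume "\<not> thesis"
  then have "A4 \<subseteq> A1 \<union> A2 \<union> A3" using that by blast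
  then have "carrier R = A1 \<union> A2 \<union> A3" using cover by auto
  then have "three_cover R"
    unfolding three_cover_def using sub1 sub2 sub3 proper1 proper2 proper3 by blast
  then show False using no_three_cover by simp
qed

text \<open>Adding x to an element y that lies only in A4 keeps it out of A1, A2 and A3, so x + y
  stays in A4.\<close>

lemma meet4: "x \<in> A1 \<Longrightarrow> x \<in> A2 \<Longrightarrow> x \<in> A3 \<Longrightarrow> x \<in> A4"
proof -
  assume x: "x \<in> A1" "x \<in> A2" "x \<in> A3"
  obtain y where y: "y \<in> A4" "y \<notin> A1" "y \<notin> A2" "y \<notin> A3" by (rule irredundant4)
  have c: "x \<in> carrier R" "y \<in> carrier R" using x y in_carrier by blast+
  have "x \<oplus> y \<in> A4" by (rule in_cover) (use x y c in simp_all)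
  then show "x \<in> A4" using y c by simp
qed

end

lemma (in four_cover) meet3: "x \<in> A1 \<Longrightarrow> x \<in> A2 \<Longrightarrow> x \<in> A4 \<Longrightarrow> x \<in> A3"
  by (rule four_cover.meet4[OF perm34])

lemma (in four_cover) meet2: "x \<in> A1 \<Longrightarrow> x \<in> A3 \<Longrightarrow> x \<in> A4 \<Longrightarrow> x \<in> A2"
  by (rule four_cover.meet3[OF perm23])

lemma (in four_cover) meet1: "x \<in> A2 \<Longrightarrow> x \<in> A3 \<Longrightarrow> x \<in> A4 \<Longrightarrow> x \<in> A1"
  by (rule four_cover.meet2[OF perm12])

section \<open>Two subrings sharing an element outside the other two\<close>

locale four_cover_pair = four_cover +
  fixes b
  assumes b: "b \<in> A1" "b \<in> A2" "b \<notin> A3"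
begin

lemma b_carrier [simp]: "b \<in> carrier R"
  using b in_carrier by blast

lemma b4: "b \<notin> A4"
  using b meet3 by blast

lemma perm12_pair: "four_cover_pair R A2 A1 A3 A4 b"
  by (intro four_cover_pair.intro perm12 four_cover_pair_axioms.intro) (use b in auto)

lemma perm34_pair: "four_cover_pair R A1 A2 A4 A3 b"
  by (intro four_cover_pair.intro perm34 four_cover_pair_axioms.intro) (use b b4 in auto)

text \<open>If y were in both A3 and A4, then y + b would lie in none of the four subrings.\<close>

lemma outside:
  assumes y: "y \<in> carrier R" "y \<notin> A1" "y \<notin> A2"
  shows "y \<in> A4 \<longleftrightarrow> y \<notin> A3"
proof
  show "y \<in> A4" if "y \<notin> A3" using in_cover y that by blast
  show "y \<notin> A3" if "y \<in> A4"
  proof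
    assume "y \<in> A3"
    then have "y \<oplus> b \<notin> A1" "y \<oplus> b \<notin> A2" "y \<oplus> b \<notin> A3" "y \<oplus> b \<notin> A4"
      using that b b4 y by simp_all
    then show False using in_cover[of "y \<oplus> b"] y by simp
  qed
qed

text \<open>Outside A1 and A2, adding b switches between A3 and A4.\<close>

lemma outside_add_b:
  assumes y: "y \<in> carrier R" "y \<notin> A1" "y \<notin> A2"
  shows "y \<oplus> b \<in> A3 \<longleftrightarrow> y \<notin> A3"
proof -
  have c: "y \<oplus> b \<in> carrier R" "y \<oplus> b \<notin> A1" "y \<oplus> b \<notin> A2" using y b by simp_all
  show ?thesis
  proof (cases "y \<in> A3")
    case True
    then show ?thesis using b by simp
  next
    case False
    then have "y \<in> A4" using outside[OF y] by simp
    then have "y \<oplus> b \<notin> A4" using b4 by simp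
    then show ?thesis using outside[OF c] False by simp
  qed
qed

text \<open>Suppose y + a is outside A2. Then y and y + a lie outside A1 and A2 and in the same one
  of A3 and A4, so a lies there too. Adding b moves both to the other subring, so a lies in that one
  as well, and A1, A3, A4 together force a into A2.\<close>

lemma outside_add_aux:
  assumes y: "y \<in> carrier R" "y \<notin> A1" "y \<notin> A2" and a: "a \<in> A1" "a \<notin> A2"
    and same: "y \<oplus> a \<in> A3 \<longleftrightarrow> y \<in> A3"
  shows "y \<oplus> a \<in> A2"
proof (rule ccontr)
  assume n: "y \<oplus> a \<notin> A2"
  have ac: "a \<in> carrier R" using a in_carrier by blast
  have z: "y \<oplus> a \<in> carrier R" "y \<oplus> a \<notin> A1" "y \<oplus> a \<notin> A2" using y a ac n by simp_all
  have yb: "y \<oplus> b \<in> carrier R" "y \<oplus> b \<notin> A1" "y \<oplus> b \<notin> A2" using y b by simp_all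
  have zb: "y \<oplus> a \<oplus> b \<in> carrier R" "y \<oplus> a \<oplus> b \<notin> A1" "y \<oplus> a \<oplus> b \<notin> A2"
    using z b by simp_all
  have e: "y \<oplus> a \<oplus> b = (y \<oplus> b) \<oplus> a" using y(1) ac by (simp add: a_ac)
  have "a \<in> A3 \<and> a \<in> A4"
  proof (cases "y \<in> A3")
    case True
    then have "a \<in> A3" using same ac by simp
    have "y \<oplus> b \<in> A4" "(y \<oplus> b) \<oplus> a \<in> A4"
      using outside[OF yb] outside[OF zb] outside_add_b[OF y] outside_add_b[OF z] True same e by simp_all
    then have "a \<in> A4" using ac by simp
    then show ?thesis using \<open>a \<in> A3\<close> by simp
  next
    case False
    then have "y \<in> A4" "y \<oplus> a \<in> A4" using same outside[OF y] outside[OF z] by simp_all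
    then have "a \<in> A4" using ac by simp
    have "y \<oplus> b \<in> A3" "(y \<oplus> b) \<oplus> a \<in> A3"
      using outside_add_b[OF y] outside_add_b[OF z] False same e by simp_all
    then have "a \<in> A3" using ac by simp
    then show ?thesis using \<open>a \<in> A4\<close> by simp
  qed
  then show False using a meet2 by blast
qed

text \<open>If y and y + a are on different sides of A3, then y and y + (a + b) are on the same
  side, and a + b is as good as a.\<close>

lemma outside_add1:
  assumes y: "y \<in> carrier R" "y \<notin> A1" "y \<notin> A2" and a: "a \<in> A1" "a \<notin> A2"
  shows "y \<oplus> a \<in> A2"
proof (rule ccontr)
  assume n: "y \<oplus> a \<notin> A2"
  have ac: "a \<in> carrier R" using a in_carrier by blast
  have z: "y \<oplus> a \<in> carrier R" "y \<oplus> a \<notin> A1" "y \<oplus> a \<notin> A2" using y a ac n by simp_all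
  have "y \<oplus> a \<in> A3 \<longleftrightarrow> y \<notin> A3" using outside_add_aux[OF y a] n by blast
  then have "y \<oplus> (a \<oplus> b) \<in> A3 \<longleftrightarrow> y \<in> A3"
    using outside_add_b[OF z] y(1) ac by (simp add: a_assoc)
  then have "y \<oplus> (a \<oplus> b) \<in> A2"
    by (intro outside_add_aux y) (use a b ac in simp_all)
  then have "y \<oplus> a \<oplus> b \<in> A2" using y(1) ac by (simp add: a_assoc)
  then show False using n b z(1) by simp
qed

lemma outside_add2:
  assumes "y \<in> carrier R" "y \<notin> A1" "y \<notin> A2" "a \<in> A2" "a \<notin> A1"
  shows "y \<oplus> a \<in> A1"
  by (rule four_cover_pair.outside_add1[OF perm12_pair]) (use assms in auto)

lemma ex_outside: obtains a c where "a \<in> A1" "a \<notin> A2" "c \<in> carrier R" "c \<notin> A1" "c \<notin> A2"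
proof -
  obtain c where "c \<in> A4" "c \<notin> A1" "c \<notin> A2" by (rule irredundant4)
  moreover obtain a where "a \<in> A1" "a \<notin> A2"
    using four_cover.irredundant4[OF four_cover.perm34[OF four_cover.perm23[OF perm12]]]
    by blast
  ultimately show ?thesis using that in_carrier by blast
qed

text \<open>The key case \<open>CA\<close> has u outside both A1 and A2. If w is in A2, use
  \<open>outside_add2\<close>; otherwise shift w by an element a of A1, which brings it into A2
  without changing membership in A1.\<close>

lemma index2_1_aux:
  assumes x: "x \<in> carrier R" "x \<notin> A1" and y: "y \<in> carrier R" "y \<notin> A1"
  shows "x \<oplus> y \<in> A1"
proof -
  obtain a c where a: "a \<in> A1" "a \<notin> A2" and c: "c \<in> carrier R" "c \<notin> A1" "c \<notin> A2" by (rule ex_outside)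
  have ac: "a \<in> carrier R" using a in_carrier by blast
  have CA: "u \<oplus> w \<in> A1" if "u \<in> carrier R" "u \<notin> A1" "u \<notin> A2" "w \<in> carrier R" "w \<notin> A1" for u w
  proof (cases "w \<in> A2")
    case True
    then show ?thesis using outside_add2 that by blast
  next
    case False
    have "w \<oplus> a \<in> A2" by (rule outside_add1) (use that False a in auto)
    moreover have "w \<oplus> a \<notin> A1" using that a by simp
    ultimately have "u \<oplus> (w \<oplus> a) \<in> A1" using outside_add2 that by blast
    then have "(u \<oplus> w) \<oplus> a \<in> A1" using that ac by (simp add: a_assoc)
    then show ?thesis using a that by simp
  qed
  show ?thesis
  proof (cases "x \<in> A2")
    case False
    then show ?thesis using CA x y by blast
  next
    case True
    \<comment> \<open>Both c and its negative lie outside A1 and A2, so x + y splits into two sums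
      covered by \<open>CA\<close>.\<close>
    have 1: "c \<oplus> x \<in> A1" by (rule CA) (use c x in auto)
    have 2: "\<ominus> c \<oplus> y \<in> A1" by (rule CA) (use c y in auto)
    have "(c \<oplus> x) \<oplus> (\<ominus> c \<oplus> y) \<in> A1" using 1 2 sub_rules by blast
    moreover have "(c \<oplus> x) \<oplus> (\<ominus> c \<oplus> y) = x \<oplus> y"
      using c(1) x(1) y(1) by (metis a_assoc a_comm a_inv_closed add.m_closed r_neg2)
    ultimately show ?thesis by simp
  qed
qed

lemma index2_1:
  assumes "x \<in> carrier R" "y \<in> carrier R"
  shows "x \<oplus> y \<in> A1 \<longleftrightarrow> (x \<in> A1 \<longleftrightarrow> y \<in> A1)"
  using index2_1_aux assms by (cases "x \<in> A1"; cases "y \<in> A1") simp_all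

lemma index2_2:
  assumes "x \<in> carrier R" "y \<in> carrier R"
  shows "x \<oplus> y \<in> A2 \<longleftrightarrow> (x \<in> A2 \<longleftrightarrow> y \<in> A2)"
  by (rule four_cover_pair.index2_1[OF perm12_pair assms])

text \<open>Two elements x, y of A1 and A2 outside A3 can both play the part of b. Adding one after
  the other to an outside element c switches sides twice, so c and c + (x + y) are on the same
  side.\<close>

lemma index2_meet:
  assumes x: "x \<in> A1" "x \<in> A2" and y: "y \<in> A1" "y \<in> A2"
  shows "x \<oplus> y \<in> A3 \<longleftrightarrow> (x \<in> A3 \<longleftrightarrow> y \<in> A3)"
proof (cases "x \<in> A3")
  case True
  then show ?thesis using x y in_carrier by simp
next
  case False
  note xn = this
  show ?thesis
  proof (cases "y \<in> A3")
    case True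
    then show ?thesis using x y in_carrier by simp
  next
    case False
    obtain c where c: "c \<in> carrier R" "c \<notin> A1" "c \<notin> A2" by (rule ex_outside)
    have xc: "x \<in> carrier R" and yc: "y \<in> carrier R" using x y in_carrier by blast+
    have px: "four_cover_pair R A1 A2 A3 A4 x"
      by (intro four_cover_pair.intro four_cover_axioms four_cover_pair_axioms.intro) (fact x xn)+
    have py: "four_cover_pair R A1 A2 A3 A4 y"
      by (intro four_cover_pair.intro four_cover_axioms four_cover_pair_axioms.intro) (fact y False)+
    have cx: "c \<oplus> x \<in> carrier R" "c \<oplus> x \<notin> A1" "c \<oplus> x \<notin> A2" using c x xc by simp_all
    have eq: "c \<oplus> x \<oplus> y \<in> A3 \<longleftrightarrow> c \<in> A3" 
      using four_cover_pair.outside_add_b[OF py cx] four_cover_pair.outside_add_b[OF px c] by blast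
    have as: "c \<oplus> x \<oplus> y = c \<oplus> (x \<oplus> y)" using c xc yc by (simp add: a_assoc)
    have "x \<oplus> y \<in> A3"
    proof (cases "c \<in> A3")
      case True
      then have "c \<oplus> (x \<oplus> y) \<in> A3" using eq as by simp
      then show ?thesis using nonunital_subring_add_iff(1)[OF sub3 True, of "x \<oplus> y"] xc yc by simp
    next
      case False
      have cxy: "c \<oplus> (x \<oplus> y) \<in> carrier R" "c \<oplus> (x \<oplus> y) \<notin> A1" "c \<oplus> (x \<oplus> y) \<notin> A2"
        using c x y xc yc by simp_all
      have "c \<oplus> (x \<oplus> y) \<notin> A3" using eq False unfolding as by simp
      then have "c \<in> A4" "c \<oplus> (x \<oplus> y) \<in> A4" using outside[OF c] outside[OF cxy] False by simp_all
      then have xy4: "x \<oplus> y \<in> A4" using xc yc nonunital_subring_add_iff(1)[OF sub4, of c "x \<oplus> y"] by simp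
      show ?thesis by (rule meet3) (use xy4 x y xc yc in simp_all)
    qed
    then show ?thesis using xn False by simp
  qed
qed

text \<open>The difference x - x' is in A1 and A2 but not in A3, so q = x - x' - b lies in all four.
  With v in A3 outside A1 and A2, the element v + x = (v + b) + (q + x') is then in A4, A3 and A2,
  hence in A1, which contradicts x in A1 and v not in A1.\<close>

lemma small_aux:
  assumes x: "x \<in> A3" "x \<in> A1" "x \<notin> A2" and x': "x' \<in> A4" "x' \<in> A1" "x' \<notin> A2"
  shows False
proof -
  obtain c where c: "c \<in> carrier R" "c \<notin> A1" "c \<notin> A2" by (rule ex_outside)
  obtain v where v: "v \<in> carrier R" "v \<notin> A1" "v \<notin> A2" "v \<in> A3"
  proof (cases "c \<in> A3")
    case True
    then show ?thesis using that c by blast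
  next
    case False
    then show ?thesis using that[of "c \<oplus> b"] c b outside_add_b[OF c] by simp
  qed
  have vb: "v \<oplus> b \<in> carrier R" "v \<oplus> b \<notin> A1" "v \<oplus> b \<notin> A2" "v \<oplus> b \<in> A4"
  proof -
    show 1: "v \<oplus> b \<in> carrier R" "v \<oplus> b \<notin> A1" "v \<oplus> b \<notin> A2" using v b by simp_all
    show "v \<oplus> b \<in> A4" using outside[OF 1] outside_add_b[OF v(1-3)] v by simp
  qed
  have xc: "x \<in> carrier R" "x' \<in> carrier R" using x x' in_carrier by blast+
  have d1: "x \<ominus> x' \<in> A1" using x x' sub_rules by blast
  have "x \<oplus> \<ominus> x' \<in> A2" using index2_2[of x "\<ominus> x'"] x x' xc by simp
  then have d2: "x \<ominus> x' \<in> A2" by (simp add: minus_eq)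
  show False
  proof (cases "x \<ominus> x' \<in> A3")
    case True
    then have "x' \<in> A3" using x xc by simp
    then show False using x' meet2 by blast
  next
    case False
    have "(x \<ominus> x') \<oplus> \<ominus> b \<in> A3"
      using index2_meet[of "x \<ominus> x'" "\<ominus> b"] d1 d2 b False by simp
    then have d4: "(x \<ominus> x') \<oplus> \<ominus> b \<in> A4"
      by (intro meet4) (use d1 d2 b xc in simp_all)
    define q where "q = (x \<ominus> x') \<oplus> \<ominus> b"
    have q: "q \<in> carrier R" "q \<in> A4" using d4 xc by (simp_all add: q_def)
    have "q \<oplus> b \<oplus> x' = x"
      using xc b_carrier by (simp add: q_def a_assoc l_neg minus_eq)
    then have "v \<oplus> x = v \<oplus> (q \<oplus> b \<oplus> x')" by simp
    also have "\<dots> = (v \<oplus> b) \<oplus> (q \<oplus> x')" using v(1) q(1) xc by (simp add: a_ac)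
    finally have e: "v \<oplus> x = (v \<oplus> b) \<oplus> (q \<oplus> x')" .
    have "v \<oplus> x \<in> A4" unfolding e using vb(4) q(2) x'(1) sub_rules(21) by blast
    moreover have "v \<oplus> x \<in> A3" using v x xc by simp
    moreover have "v \<oplus> x \<in> A2" using outside_add1 v x by blast
    ultimately have "v \<oplus> x \<in> A1" using meet1 by blast
    then show False using x v by simp
  qed
qed

lemma small: "(\<forall>x\<in>A3. x \<in> A1 \<longleftrightarrow> x \<in> A2) \<or> (\<forall>x\<in>A4. x \<in> A1 \<longleftrightarrow> x \<in> A2)"
proof (rule ccontr)
  assume "\<not> ?thesis"
  then obtain x x' where x: "x \<in> A3" "(x \<in> A1) \<noteq> (x \<in> A2)" and x': "x' \<in> A4" "(x' \<in> A1) \<noteq> (x' \<in> A2)"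
    by blast
  obtain c where c: "c \<in> carrier R" "c \<notin> A1" "c \<notin> A2" by (rule ex_outside)
  \<comment> \<open>Both A1 and A2 have index 2, so adding an element outside both turns an element
    only in A2 into one only in A1.\<close>
  have flip: "\<exists>z\<in>S. z \<in> A1 \<and> z \<notin> A2"
    if S: "nonunital_subring S R" "x \<in> S" "v \<in> S" "v \<notin> A1" "v \<notin> A2" "(x \<in> A1) \<noteq> (x \<in> A2)" for x v S
  proof (cases "x \<in> A1")
    case True
    then show ?thesis using S by blast
  next
    case False
    have "v \<oplus> x \<in> S" "x \<in> carrier R" "v \<in> carrier R" using nonunital_subringD[OF S(1)] S by blast+
    then have "v \<oplus> x \<in> S" "v \<oplus> x \<in> A1" "v \<oplus> x \<notin> A2" using index2_1 index2_2 S False by simp_all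
    then show ?thesis by blast
  qed
  have cb: "c \<oplus> b \<in> carrier R" "c \<oplus> b \<notin> A1" "c \<oplus> b \<notin> A2" using c b by simp_all
  obtain v v' where "v \<in> A3" "v \<notin> A1" "v \<notin> A2" "v' \<in> A4" "v' \<notin> A1" "v' \<notin> A2"
  proof (cases "c \<in> A3")
    case True
    then show ?thesis using that[of c "c \<oplus> b"] outside[OF cb] outside_add_b[OF c] c cb by blast
  next
    case False
    then show ?thesis using that[of "c \<oplus> b" c] outside[OF c] outside_add_b[OF c] c cb by blast
  qed
  then obtain z z' where "z \<in> A3" "z \<in> A1" "z \<notin> A2" "z' \<in> A4" "z' \<in> A1" "z' \<notin> A2"
    using flip[OF sub3 x(1) _ _ _ x(2)] flip[OF sub4 x'(1) _ _ _ x'(2)] by blast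
  then show False by (rule small_aux)
qed

end

locale four_cover_II = four_cover_pair +
  assumes small3: "x \<in> A3 \<Longrightarrow> x \<in> A1 \<longleftrightarrow> x \<in> A2"

text \<open>One implication per pair is enough: with \<open>meet4\<close> and its relabellings every
  pairwise intersection becomes the common one.\<close>

locale four_cover_I = four_cover +
  assumes meets: "x \<in> A1 \<Longrightarrow> x \<in> A2 \<Longrightarrow> x \<in> A3" "x \<in> A1 \<Longrightarrow> x \<in> A3 \<Longrightarrow> x \<in> A2"
    "x \<in> A1 \<Longrightarrow> x \<in> A4 \<Longrightarrow> x \<in> A2" "x \<in> A2 \<Longrightarrow> x \<in> A3 \<Longrightarrow> x \<in> A1"
    "x \<in> A2 \<Longrightarrow> x \<in> A4 \<Longrightarrow> x \<in> A1" "x \<in> A3 \<Longrightarrow> x \<in> A4 \<Longrightarrow> x \<in> A1"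

lemma (in four_cover) pair_imp_II:
  assumes "b \<in> A1" "b \<in> A2" "b \<notin> A3"
  shows "\<exists>B3 B4. four_cover_II R A1 A2 B3 B4 b \<and> B3 \<inter> B4 = A3 \<inter> A4"
proof -
  interpret four_cover_pair R A1 A2 A3 A4 b by unfold_locales (use assms in auto)
  show ?thesis using small
  proof
    assume "\<forall>x\<in>A3. x \<in> A1 \<longleftrightarrow> x \<in> A2"
    then have "four_cover_II R A1 A2 A3 A4 b"
      by (intro four_cover_II.intro four_cover_pair_axioms four_cover_II_axioms.intro) blast
    then show ?thesis by blast
  next
    assume "\<forall>x\<in>A4. x \<in> A1 \<longleftrightarrow> x \<in> A2"
    then have "four_cover_II R A1 A2 A4 A3 b"
      by (intro four_cover_II.intro perm34_pair four_cover_II_axioms.intro) blast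
    then show ?thesis by blast
  qed
qed

text \<open>If no relabelling gives the second configuration, \<open>pair_imp_II\<close> pushes
  every pairwise intersection into a third subring. The equality of common intersections is carried
  along because unitality and the core condition depend on that set alone.\<close>

lemma (in four_cover) I_or_II:
  "four_cover_I R A1 A2 A3 A4 \<or>
   (\<exists>B1 B2 B3 B4 b. four_cover_II R B1 B2 B3 B4 b \<and> B1 \<inter> B2 \<inter> B3 \<inter> B4 = A1 \<inter> A2 \<inter> A3 \<inter> A4)"
  (is "?I \<or> ?II")
proof (rule disjCI)
  assume no: "\<not> ?II"
  have *: "x \<in> B3" if h: "four_cover R B1 B2 B3 B4" "B1 \<inter> B2 \<inter> B3 \<inter> B4 = A1 \<inter> A2 \<inter> A3 \<inter> A4"
    "x \<in> B1" "x \<in> B2" for B1 B2 B3 B4 x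
  proof (rule ccontr)
    assume "x \<notin> B3"
    then obtain C3 C4 where "four_cover_II R B1 B2 C3 C4 x" "C3 \<inter> C4 = B3 \<inter> B4"
      using four_cover.pair_imp_II[OF h(1,3,4)] by blast
    then show False using no h(2) by (metis Int_assoc)
  qed
  note q12 = *[OF four_cover_axioms]
  have "A1 \<inter> A3 \<inter> A2 \<inter> A4 = A1 \<inter> A2 \<inter> A3 \<inter> A4" by auto
  note q13 = *[OF perm23 this]
  have "A1 \<inter> A4 \<inter> A2 \<inter> A3 = A1 \<inter> A2 \<inter> A3 \<inter> A4" by auto
  note q14 = *[OF four_cover.perm23[OF perm34] this]
  have "A2 \<inter> A3 \<inter> A1 \<inter> A4 = A1 \<inter> A2 \<inter> A3 \<inter> A4" by auto
  note q23 = *[OF four_cover.perm23[OF perm12] this]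
  have "A2 \<inter> A4 \<inter> A1 \<inter> A3 = A1 \<inter> A2 \<inter> A3 \<inter> A4" by auto
  note q24 = *[OF four_cover.perm23[OF four_cover.perm34[OF perm12]] this]
  have "A3 \<inter> A4 \<inter> A1 \<inter> A2 = A1 \<inter> A2 \<inter> A3 \<inter> A4" by auto
  note q34 = *[OF four_cover.perm23[OF four_cover.perm34[OF four_cover.perm12[OF perm23]]] this]
  show ?I
  proof (intro four_cover_I.intro four_cover_axioms four_cover_I_axioms.intro)
    fix x
    show "x \<in> A1 \<Longrightarrow> x \<in> A2 \<Longrightarrow> x \<in> A3" by (rule q12[OF refl])
    show "x \<in> A1 \<Longrightarrow> x \<in> A3 \<Longrightarrow> x \<in> A2" by (rule q13)
    show "x \<in> A1 \<Longrightarrow> x \<in> A4 \<Longrightarrow> x \<in> A2" by (rule q14)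
    show "x \<in> A2 \<Longrightarrow> x \<in> A3 \<Longrightarrow> x \<in> A1" by (rule q23)
    show "x \<in> A2 \<Longrightarrow> x \<in> A4 \<Longrightarrow> x \<in> A1" by (rule q24)
    show "x \<in> A3 \<Longrightarrow> x \<in> A4 \<Longrightarrow> x \<in> A1" by (rule q34)
  qed
qed

section \<open>Unital covers\<close>

text \<open>Kernels of homomorphisms onto the field with two elements, described by membership alone
  so that no map has to be carried along.\<close>

definition bit_kernel :: "'a set \<Rightarrow> ('a, 'm) ring_scheme \<Rightarrow> bool" where
  "bit_kernel E R \<longleftrightarrow> E \<subset> carrier R \<and>
     (\<forall>x\<in>carrier R. \<forall>y\<in>carrier R. (x \<oplus>\<^bsub>R\<^esub> y \<in> E \<longleftrightarrow> (x \<in> E \<longleftrightarrow> y \<in> E)) \<and>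
        (x \<otimes>\<^bsub>R\<^esub> y \<in> E \<longleftrightarrow> x \<in> E \<or> y \<in> E))"

context ring
begin

lemma bit_kernelD:
  assumes "bit_kernel E R"
  shows "E \<subseteq> carrier R" "E \<noteq> carrier R" "\<zero> \<in> E"
    and "\<And>x y. x \<in> carrier R \<Longrightarrow> y \<in> carrier R \<Longrightarrow> x \<oplus> y \<in> E \<longleftrightarrow> (x \<in> E \<longleftrightarrow> y \<in> E)"
    and "\<And>x y. x \<in> carrier R \<Longrightarrow> y \<in> carrier R \<Longrightarrow> x \<otimes> y \<in> E \<longleftrightarrow> x \<in> E \<or> y \<in> E"
    and "\<And>x y. x \<in> carrier R \<Longrightarrow> y \<in> carrier R \<Longrightarrow> x \<ominus> y \<in> E \<longleftrightarrow> (x \<in> E \<longleftrightarrow> y \<in> E)"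
proof -
  show "E \<subseteq> carrier R" "E \<noteq> carrier R" using assms unfolding bit_kernel_def by blast+
  show add: "x \<oplus> y \<in> E \<longleftrightarrow> (x \<in> E \<longleftrightarrow> y \<in> E)" if "x \<in> carrier R" "y \<in> carrier R" for x y
    using assms that unfolding bit_kernel_def by blast
  show "x \<otimes> y \<in> E \<longleftrightarrow> x \<in> E \<or> y \<in> E" if "x \<in> carrier R" "y \<in> carrier R" for x y
    using assms that unfolding bit_kernel_def by blast
  show zero: "\<zero> \<in> E" using add[of \<zero> \<zero>] by simp
  show "x \<ominus> y \<in> E \<longleftrightarrow> (x \<in> E \<longleftrightarrow> y \<in> E)" if "x \<in> carrier R" "y \<in> carrier R" for x y
    using add[of x "\<ominus> y"] add[of y "\<ominus> y"] zero that by (simp add: minus_eq r_neg)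
qed

lemma bit_kernel_nonunital_subring: "bit_kernel E R \<Longrightarrow> nonunital_subring E R"
  by (rule nonunital_subringI) (use bit_kernelD in \<open>auto simp: subset_iff\<close>)

text \<open>Two distinct maps onto F_2 give their two kernels and the subring where they agree; an
  element outside both kernels has value 1 under both.\<close>

lemma two_bit_kernels_three_cover:
  assumes E: "bit_kernel E R" and F: "bit_kernel F R" and "E \<noteq> F"
  shows "three_cover R"
proof -
  define G where "G = {x \<in> carrier R. x \<in> E \<longleftrightarrow> x \<in> F}"
  note D = bit_kernelD[OF E] bit_kernelD[OF F]
  have "nonunital_subring G R"
    by (rule nonunital_subringI) (auto simp: G_def D)
  moreover have "G \<noteq> carrier R" using \<open>E \<noteq> F\<close> D(1) D(7) by (auto simp: G_def)
  moreover have "carrier R = E \<union> F \<union> G" using D(1) D(7) by (auto simp: G_def)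
  ultimately show ?thesis
    unfolding three_cover_def
    using bit_kernel_nonunital_subring[OF E] bit_kernel_nonunital_subring[OF F] D(2) D(8) by blast
qed

lemma int_mult_closed:
  assumes "nonunital_subring S R" "x \<in> S"
  shows "add_pow R (k::int) x \<in> S"
  using add.subgroup_int_pow_closed[of S x k] assms
  by (simp add: nonunital_subring_def additive_subgroup_def)

lemma add_pow_int_0 [simp]: "add_pow R (0::int) x = \<zero>"
  using add_pow_int_ge[of 0 R x] by simp

lemma int_one_diff: "add_pow R (m::int) \<one> \<ominus> add_pow R (n::int) \<one> = add_pow R (m - n) \<one>"
  by (simp add: minus_eq add.int_pow_diff)

lemma int_one_add: "add_pow R (m::int) \<one> \<oplus> add_pow R (n::int) \<one> = add_pow R (m + n) \<one>"
  by (simp add: add.int_pow_mult)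

lemma int_one_mult: "add_pow R (m::int) \<one> \<otimes> add_pow R (n::int) \<one> = add_pow R (m * n) \<one>"
  by (simp add: add_pow_ldistr_int add_pow_rdistr_int add.int_pow_pow mult.commute)

text \<open>This is S + Z 1; the cross terms of a product are integer multiples of elements of
  S.\<close>

lemma adjoin_one:
  assumes S: "nonunital_subring S R"
  shows "nonunital_subring {x \<in> carrier R. \<exists>n::int. x \<ominus> add_pow R n \<one> \<in> S} R" (is "nonunital_subring ?T R")
proof (rule nonunital_subringI)
  note D = nonunital_subringD[OF S]
  have T: "x \<in> ?T \<longleftrightarrow> (\<exists>s\<in>S. \<exists>n::int. x = s \<oplus> add_pow R n \<one>)" for x
  proof
    assume "x \<in> ?T"
    then obtain n :: int where "x \<in> carrier R" "x \<ominus> add_pow R n \<one> \<in> S" by blast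
    moreover then have "x = (x \<ominus> add_pow R n \<one>) \<oplus> add_pow R n \<one>" by (simp add: minus_eq a_assoc l_neg)
    ultimately show "\<exists>s\<in>S. \<exists>n::int. x = s \<oplus> add_pow R n \<one>" by blast
  next
    assume "\<exists>s\<in>S. \<exists>n::int. x = s \<oplus> add_pow R n \<one>"
    then obtain s and n :: int where s: "s \<in> S" "x = s \<oplus> add_pow R n \<one>" by blast
    then have "x \<ominus> add_pow R n \<one> = s" using D(1)[OF s(1)] by (simp add: minus_eq a_assoc r_neg)
    then have "x \<in> carrier R" "x \<ominus> add_pow R n \<one> \<in> S" using s D(1)[OF s(1)] by simp_all
    then show "x \<in> ?T" by blast
  qed
  show "?T \<subseteq> carrier R" by blast
  show "\<zero> \<in> ?T" unfolding T by (rule bexI[OF _ D(2)], rule exI[of _ "0::int"]) simp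
  fix x y assume "x \<in> ?T" "y \<in> ?T"
  then obtain s t and m n :: int where st: "s \<in> S" "x = s \<oplus> add_pow R m \<one>" "t \<in> S" "y = t \<oplus> add_pow R n \<one>"
    unfolding T by blast
  then have c: "s \<in> carrier R" "t \<in> carrier R" using D(1) by blast+
  have ic: "add_pow R k \<one> \<in> carrier R" for k :: int by simp
  have "x \<ominus> y = (s \<ominus> t) \<oplus> (add_pow R m \<one> \<ominus> add_pow R n \<one>)"
    unfolding st using c ic[of m] ic[of n] by (simp add: minus_eq minus_add a_ac)
  then have "x \<ominus> y = (s \<ominus> t) \<oplus> add_pow R (m - n) \<one>" by (simp only: int_one_diff)
  then show "x \<ominus> y \<in> ?T" unfolding T using D(5) st by blast
  define P Q where "P = add_pow R m \<one>" and "Q = add_pow R n \<one>"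
  have PQ: "P \<in> carrier R" "Q \<in> carrier R" by (simp_all add: P_def Q_def)
  have "s \<otimes> Q = add_pow R n s" "P \<otimes> t = add_pow R m t"
    using c by (simp_all add: P_def Q_def add_pow_ldistr_int add_pow_rdistr_int)
  moreover have "x \<otimes> y = (s \<otimes> t \<oplus> s \<otimes> Q \<oplus> P \<otimes> t) \<oplus> P \<otimes> Q"
    unfolding st P_def[symmetric] Q_def[symmetric] using c PQ by (simp add: l_distr r_distr a_ac)
  ultimately have "x \<otimes> y = (s \<otimes> t \<oplus> add_pow R n s \<oplus> add_pow R m t) \<oplus> add_pow R m \<one> \<otimes> add_pow R n \<one>"
    by (simp add: P_def Q_def)
  then have "x \<otimes> y = (s \<otimes> t \<oplus> add_pow R n s \<oplus> add_pow R m t) \<oplus> add_pow R (m * n) \<one>" by (simp only: int_one_mult)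
  moreover have "s \<otimes> t \<oplus> add_pow R n s \<oplus> add_pow R m t \<in> S"
    using st by (intro D(3) D(6) int_mult_closed[OF S])
  ultimately show "x \<otimes> y \<in> ?T" unfolding T by blast
qed

text \<open>The second alternative says that adjoining \<open>\<one>\<close> to \<open>S\<close> gives all of \<open>R\<close>.\<close>

definition unital_or_cyclic :: "'a set \<Rightarrow> bool" where
  "unital_or_cyclic S \<longleftrightarrow> \<one> \<in> S \<or> (\<forall>x\<in>carrier R. \<exists>n::int. x \<ominus> add_pow R n \<one> \<in> S)"

text \<open>If S + Z 1 is proper it replaces S and contains the identity; otherwise S itself is kept
  and falls under the cyclic alternative.\<close>

lemma proper_subring_extend:
  assumes S: "nonunital_subring S R" "S \<noteq> carrier R"
  shows "\<exists>T. S \<subseteq> T \<and> nonunital_subring T R \<and> T \<noteq> carrier R \<and> unital_or_cyclic T"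
proof (cases "{x \<in> carrier R. \<exists>n::int. x \<ominus> add_pow R n \<one> \<in> S} = carrier R")
  case True
  then have "unital_or_cyclic S" unfolding unital_or_cyclic_def by blast
  then show ?thesis using S by blast
next
  case False
  let ?T = "{x \<in> carrier R. \<exists>n::int. x \<ominus> add_pow R n \<one> \<in> S}"
  have "S \<subseteq> ?T"
  proof
    fix x assume x: "x \<in> S"
    then have "x \<in> carrier R" using nonunital_subringD(1)[OF S(1)] by blast
    moreover then have "x \<ominus> add_pow R (0::int) \<one> \<in> S" using x by (simp add: minus_eq)
    ultimately show "x \<in> ?T" by blast
  qed
  moreover have "\<one> \<in> ?T"
  proof -
    have "\<one> \<ominus> add_pow R (1::int) \<one> \<in> S" using nonunital_subringD(2)[OF S(1)] by (simp add: minus_eq r_neg)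
    then show ?thesis by blast
  qed
  ultimately show ?thesis
    using adjoin_one[OF S(1)] False unfolding unital_or_cyclic_def by blast
qed

text \<open>Since R = S + Z 1, multiplying an element of S by any x amounts to multiplying by an
  element of S and adding an integer multiple.\<close>

lemma cyclic_ideal:
  assumes S: "nonunital_subring S R" and cyc: "\<And>x. x \<in> carrier R \<Longrightarrow> \<exists>n::int. x \<ominus> add_pow R n \<one> \<in> S"
    and a: "a \<in> S" and x: "x \<in> carrier R"
  shows "x \<otimes> a \<in> S" "a \<otimes> x \<in> S"
proof -
  note D = nonunital_subringD[OF S]
  have ac: "a \<in> carrier R" using D(1) a by blast
  obtain n :: int where n: "x \<ominus> add_pow R n \<one> \<in> S" using cyc[OF x] by blast
  define s where "s = x \<ominus> add_pow R n \<one>"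
  have s: "s \<in> S" "s \<in> carrier R" using n D(1) by (auto simp: s_def)
  have xs: "x = s \<oplus> add_pow R n \<one>" using x by (simp add: s_def minus_eq a_assoc l_neg)
  have "x \<otimes> a = s \<otimes> a \<oplus> add_pow R n a" "a \<otimes> x = a \<otimes> s \<oplus> add_pow R n a"
    unfolding xs using s ac by (simp_all add: l_distr r_distr add_pow_ldistr_int add_pow_rdistr_int)
  then show "x \<otimes> a \<in> S" "a \<otimes> x \<in> S"
    using D(3)[OF D(6)[OF s(1) a] int_mult_closed[OF S a, of n]]
      D(3)[OF D(6)[OF a s(1)] int_mult_closed[OF S a, of n]] by simp_all
qed

text \<open>An odd multiple of \<open>\<one>\<close> cannot lie in \<open>S\<close>: its square is \<open>\<one>\<close> modulo multiples of 4.\<close>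

lemma cyclic_bit_kernel:
  assumes S: "nonunital_subring S R" and cyc: "\<And>x. x \<in> carrier R \<Longrightarrow> \<exists>n::int. x \<ominus> add_pow R n \<one> \<in> S"
    and one: "\<one> \<notin> S" and four: "\<And>x. x \<in> carrier R \<Longrightarrow> add_pow R (4::int) x \<in> S"
  shows "bit_kernel {x \<in> carrier R. \<exists>n::int. even n \<and> x \<ominus> add_pow R n \<one> \<in> S} R" (is "bit_kernel ?E R")
proof -
  note D = nonunital_subringD[OF S]
  define E where "E = ?E"
  have even: "even d" if "add_pow R d \<one> \<in> S" for d :: int
  proof (rule ccontr)
    assume "odd d"
    then obtain k where k: "d = 2 * k + 1" by (rule oddE)
    have "add_pow R d (add_pow R d \<one>) \<in> S" using int_mult_closed[OF S that] .
    then have "add_pow R (d * d) \<one> \<in> S" by (simp add: add.int_pow_pow)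
    moreover have "add_pow R (4 * (k * k + k)) \<one> \<in> S"
      using four[of "add_pow R (k * k + k) \<one>"] by (simp add: add.int_pow_pow mult.commute)
    ultimately have "add_pow R (d * d) \<one> \<ominus> add_pow R (4 * (k * k + k)) \<one> \<in> S" by (rule D(5))
    then have "add_pow R (d * d - 4 * (k * k + k)) \<one> \<in> S" by (simp only: int_one_diff)
    moreover have "d * d - 4 * (k * k + k) = 1" by (simp add: k algebra_simps)
    ultimately show False using one by simp
  qed
  \<comment> \<open>By \<open>even\<close>, the parity of n does not depend on the chosen
    representative n of x modulo S.\<close>
  have mem: "x \<in> E \<longleftrightarrow> even n" if "x \<in> carrier R" "x \<ominus> add_pow R n \<one> \<in> S" for x and n :: int
  proof
    assume "x \<in> E"
    then obtain m :: int where m: "even m" "x \<ominus> add_pow R m \<one> \<in> S" unfolding E_def by blast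
    have "(x \<ominus> add_pow R m \<one>) \<ominus> (x \<ominus> add_pow R n \<one>) \<in> S" using D(5) m that by blast
    moreover have "(x \<ominus> add_pow R m \<one>) \<ominus> (x \<ominus> add_pow R n \<one>) = add_pow R n \<one> \<ominus> add_pow R m \<one>"
    proof -
      have "p \<in> carrier R \<Longrightarrow> q \<in> carrier R \<Longrightarrow> (x \<ominus> p) \<ominus> (x \<ominus> q) = q \<ominus> p" for p q
        using that(1) by algebra
      then show ?thesis by simp
    qed
    ultimately have "even (n - m)" using even by (simp only: int_one_diff)
    then show "even n" using m by simp
  next
    assume "even n"
    then show "x \<in> E" using that unfolding E_def by blast
  qed
  have "\<one> \<notin> E" using mem[of \<one> 1] D(2) by (simp add: minus_eq r_neg)
  then have "E \<subset> carrier R" unfolding E_def by blast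
  moreover have "x \<oplus> y \<in> E \<longleftrightarrow> (x \<in> E \<longleftrightarrow> y \<in> E)" "x \<otimes> y \<in> E \<longleftrightarrow> x \<in> E \<or> y \<in> E"
    if xy: "x \<in> carrier R" "y \<in> carrier R" for x y
  proof -
    obtain m n :: int where mn: "x \<ominus> add_pow R m \<one> \<in> S" "y \<ominus> add_pow R n \<one> \<in> S" using cyc xy by blast
    define s t where "s = x \<ominus> add_pow R m \<one>" and "t = y \<ominus> add_pow R n \<one>"
    have st: "s \<in> S" "t \<in> S" "s \<in> carrier R" "t \<in> carrier R" using mn D(1) xy by (auto simp: s_def t_def)
    have eq: "x = s \<oplus> add_pow R m \<one>" "y = t \<oplus> add_pow R n \<one>"
      using xy by (simp_all add: s_def t_def minus_eq a_assoc l_neg)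
    have "x \<oplus> y = (s \<oplus> t) \<oplus> (add_pow R m \<one> \<oplus> add_pow R n \<one>)" unfolding eq using st by (simp add: a_ac)
    then have "x \<oplus> y \<ominus> add_pow R (m + n) \<one> = s \<oplus> t"
      unfolding int_one_add using st by (simp add: minus_eq a_assoc r_neg)
    then have "x \<oplus> y \<ominus> add_pow R (m + n) \<one> \<in> S" using D(3) st by simp
    then show "x \<oplus> y \<in> E \<longleftrightarrow> (x \<in> E \<longleftrightarrow> y \<in> E)"
      using mem[of "x \<oplus> y" "m + n"] mem[OF xy(1) mn(1)] mem[OF xy(2) mn(2)] xy by simp
    have w: "s \<otimes> y \<oplus> add_pow R m t \<in> S"
      using D(3)[OF cyclic_ideal(2)[OF S cyc st(1) xy(2)] int_mult_closed[OF S st(2), of m]] .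
    have "x \<otimes> y = (s \<oplus> add_pow R m \<one>) \<otimes> y" using eq by simp
    also have "\<dots> = s \<otimes> y \<oplus> add_pow R m y" using st xy by (simp add: l_distr add_pow_ldistr_int)
    also have "add_pow R m y = add_pow R m t \<oplus> add_pow R (m * n) \<one>"
      by (subst eq(2)) (use st in \<open>simp add: add.int_pow_distrib add.int_pow_pow mult.commute\<close>)
    finally have "x \<otimes> y = (s \<otimes> y \<oplus> add_pow R m t) \<oplus> add_pow R (m * n) \<one>" using st xy by (simp add: a_assoc)
    then have "x \<otimes> y \<ominus> add_pow R (m * n) \<one> = s \<otimes> y \<oplus> add_pow R m t"
      using D(1)[OF w] by (simp add: minus_eq a_assoc r_neg)
    then have "x \<otimes> y \<ominus> add_pow R (m * n) \<one> \<in> S" using w by simp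
    then show "x \<otimes> y \<in> E \<longleftrightarrow> x \<in> E \<or> y \<in> E"
      using mem[of "x \<otimes> y" "m * n"] mem[OF xy(1) mn(1)] mem[OF xy(2) mn(2)] xy by simp
  qed
  ultimately show ?thesis unfolding bit_kernel_def E_def[symmetric] by blast
qed

end

text \<open>Each of A1 and A2 lies in the kernel of a map onto F_2. Distinct kernels would give a
  cover by three; a common kernel would absorb A1 and A2, leaving a cover by it, A3 and A4.\<close>

lemma (in four_cover) not_two_cyclic:
  assumes one: "\<one> \<notin> A1" "\<one> \<notin> A2" and uc: "unital_or_cyclic A1" "unital_or_cyclic A2"
    and four: "\<And>x. x \<in> carrier R \<Longrightarrow> add_pow R (4::int) x \<in> A1" "\<And>x. x \<in> carrier R \<Longrightarrow> add_pow R (4::int) x \<in> A2"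
  shows False
proof -
  define E where "E S = {x \<in> carrier R. \<exists>n::int. even n \<and> x \<ominus> add_pow R n \<one> \<in> S}" for S
  have cyc: "\<exists>n::int. x \<ominus> add_pow R n \<one> \<in> A1" "\<exists>n::int. x \<ominus> add_pow R n \<one> \<in> A2" if "x \<in> carrier R" for x
    using one uc that unfolding unital_or_cyclic_def by blast+
  have E1: "bit_kernel (E A1) R"
    unfolding E_def by (rule cyclic_bit_kernel[OF sub1 cyc(1) one(1) four(1)])
  have E2: "bit_kernel (E A2) R"
    unfolding E_def by (rule cyclic_bit_kernel[OF sub2 cyc(2) one(2) four(2)])
  have sub: "S \<subseteq> E S" if "S \<subseteq> carrier R" for S
    using that by (auto simp: E_def minus_eq intro!: exI[of _ "0::int"])
  have c: "A1 \<subseteq> carrier R" "A2 \<subseteq> carrier R" using cover by auto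
  have s: "A1 \<subseteq> E A1" "A2 \<subseteq> E A2" using sub c by blast+
  have eq: "E A1 = E A2" using two_bit_kernels_three_cover[OF E1 E2] no_three_cover by blast
  have "carrier R = E A1 \<union> A3 \<union> A4" using s eq cover bit_kernelD(1)[OF E1] by blast
  then have "three_cover R"
    unfolding three_cover_def
    using bit_kernel_nonunital_subring[OF E1] bit_kernelD(2)[OF E1] sub3 sub4 proper3 proper4 by blast
  then show False using no_three_cover by blast
qed

context four_cover_II
begin

text \<open>Doubling lands in A1 and A2, which have index 2; doubling again lands in the common
  intersection, of index at most 2 in A1 and A2 together. This feeds the hypotheses on multiples of
  4 in \<open>not_two_cyclic\<close>.\<close>

lemma four_times: "x \<in> carrier R \<Longrightarrow> add_pow R (4::int) x \<in> A1 \<inter> A2 \<inter> A3 \<inter> A4"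
proof -
  assume x: "x \<in> carrier R"
  have 2: "x \<oplus> x \<in> A1" "x \<oplus> x \<in> A2" using index2_1[OF x x] index2_2[OF x x] by simp_all
  then have "(x \<oplus> x) \<oplus> (x \<oplus> x) \<in> A3" using index2_meet[OF 2 2] by simp
  moreover have "(x \<oplus> x) \<oplus> (x \<oplus> x) \<in> A1" "(x \<oplus> x) \<oplus> (x \<oplus> x) \<in> A2" using 2 in_carrier by simp_all
  moreover have "add_pow R (4::int) x = (x \<oplus> x) \<oplus> (x \<oplus> x)"
  proof -
    have "add_pow R (4::int) x = add_pow R (2 + 2 :: int) x" by simp
    also have "\<dots> = add_pow R (2::int) x \<oplus> add_pow R (2::int) x" using x by (simp only: add.int_pow_mult)
    also have "add_pow R (2::int) x = add_pow R (1 + 1 :: int) x" by simp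
    also have "\<dots> = x \<oplus> x" using x by (simp only: add.int_pow_mult add.int_pow_1)
    finally show ?thesis .
  qed
  ultimately show ?thesis using meet4 by simp
qed

end

section \<open>Equal pairwise intersections: the plane over F_3\<close>

context four_cover_I
begin

lemma perm12_I: "four_cover_I R A2 A1 A3 A4"
  by (intro four_cover_I.intro perm12 four_cover_I_axioms.intro) (use meets meet4 meet3 meet2 meet1 in blast)+

lemma perm23_I: "four_cover_I R A1 A3 A2 A4"
  by (intro four_cover_I.intro perm23 four_cover_I_axioms.intro) (use meets meet4 meet3 meet2 meet1 in blast)+

lemma perm34_I: "four_cover_I R A1 A2 A4 A3"
  by (intro four_cover_I.intro perm34 four_cover_I_axioms.intro) (use meets meet4 meet3 meet2 meet1 in blast)+

lemma sum_mem:
  assumes "s \<in> A1" "s \<notin> A2" "t \<in> A2" "t \<notin> A1"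
  shows "s \<oplus> t \<in> A4 \<longleftrightarrow> s \<oplus> t \<notin> A3"
proof -
  have c: "s \<in> carrier R" "t \<in> carrier R" using assms in_carrier by blast+
  have "s \<oplus> t \<notin> A1" "s \<oplus> t \<notin> A2" "s \<oplus> t \<in> carrier R" using assms c by simp_all
  then show ?thesis using meets(6) in_cover by blast
qed

text \<open>Otherwise 2 s and 2 t are in A3, so s, t and s + t behave like the involutions of a
  Klein four-group, one in each of A1, A2, A3. For y only in A4, the elements s + y, t + y and s + t
  + y avoid A4, and there is no consistent way to place them in A1, A2 and A3.\<close>

lemma not_sum_and_diff3:
  assumes s: "s \<in> A1" "s \<notin> A2" and t: "t \<in> A2" "t \<notin> A1"
    and sum: "s \<oplus> t \<in> A3" and diff: "s \<ominus> t \<in> A3"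
  shows False
proof -
  have c [simp]: "s \<in> carrier R" "t \<in> carrier R" using s t in_carrier by blast+
  have "(s \<oplus> t) \<oplus> (s \<ominus> t) \<in> A3" "(s \<oplus> t) \<ominus> (s \<ominus> t) \<in> A3"
    using sum diff sub_rules(15,17) by blast+
  moreover have "(s \<oplus> t) \<oplus> (s \<ominus> t) = s \<oplus> s" "(s \<oplus> t) \<ominus> (s \<ominus> t) = t \<oplus> t"
    using c by algebra+
  ultimately have ss: "s \<oplus> s \<in> A3" and tt: "t \<oplus> t \<in> A3" by simp_all
  obtain y where y: "y \<in> A4" "y \<notin> A1" "y \<notin> A2" "y \<notin> A3" by (rule irredundant4)
  have yc [simp]: "y \<in> carrier R" using y in_carrier by blast
  have n4: "s \<notin> A4" "t \<notin> A4" "s \<oplus> t \<notin> A4" using s t meets sum sum_mem[OF s t] by blast+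
  have sy: "s \<oplus> y \<notin> A1" "s \<oplus> y \<notin> A4" using s y n4 by simp_all
  have ty: "t \<oplus> y \<notin> A2" "t \<oplus> y \<notin> A4" using t y n4 by simp_all
  have sty: "(s \<oplus> t) \<oplus> y \<notin> A3" "(s \<oplus> t) \<oplus> y \<notin> A4" using sum y n4(3) by simp_all
  have e1: "(s \<oplus> t) \<oplus> y = s \<oplus> (t \<oplus> y)" "(s \<oplus> t) \<oplus> y = t \<oplus> (s \<oplus> y)"
    by (simp_all add: a_ac)
  have i1: "(s \<oplus> t) \<oplus> y \<in> A1 \<longleftrightarrow> t \<oplus> y \<in> A1" unfolding e1(1) using s by simp
  have i2: "(s \<oplus> t) \<oplus> y \<in> A2 \<longleftrightarrow> s \<oplus> y \<in> A2" unfolding e1(2) using t by simp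
  have sc: "s \<oplus> y \<in> carrier R" "t \<oplus> y \<in> carrier R" "(s \<oplus> t) \<oplus> y \<in> carrier R" by simp_all
  show False
  proof (cases "s \<oplus> y \<in> A3")
    case True
    have "(s \<oplus> t) \<ominus> (s \<oplus> y) \<in> A3" using sum True sub_rules(17) by blast
    moreover have "(s \<oplus> t) \<ominus> (s \<oplus> y) = t \<ominus> y" using c yc by algebra
    ultimately have d: "t \<ominus> y \<in> A3" by simp
    have "s \<oplus> y \<notin> A2" using True sy meets(4) by blast
    then have ty1: "t \<oplus> y \<in> A1" using i1 i2 sty in_cover[OF sc(3)] by blast
    have "(t \<oplus> t) \<ominus> (t \<ominus> y) \<in> A3" using tt d sub_rules(17) by blast
    moreover have "(t \<oplus> t) \<ominus> (t \<ominus> y) = t \<oplus> y" using c yc by algebra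
    ultimately have "t \<oplus> y \<in> A3" by simp
    then show False using ty1 ty meets(2) by blast
  next
    case False
    then have sy2: "s \<oplus> y \<in> A2" using sy in_cover[OF sc(1)] by blast
    have "t \<oplus> y \<notin> A1" using sy2 i1 i2 sty meets(1) by blast
    then have "t \<oplus> y \<in> A3" using ty in_cover[OF sc(2)] by blast
    then have "(s \<oplus> t) \<ominus> (t \<oplus> y) \<in> A3" using sum sub_rules(17) by blast
    moreover have "(s \<oplus> t) \<ominus> (t \<oplus> y) = s \<ominus> y" using c yc by algebra
    ultimately have "s \<ominus> y \<in> A3" by simp
    then have "(s \<oplus> s) \<ominus> (s \<ominus> y) \<in> A3" using ss sub_rules(17) by blast
    moreover have "(s \<oplus> s) \<ominus> (s \<ominus> y) = s \<oplus> y" using c yc by algebra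
    ultimately show False using False by simp
  qed
qed

end

context four_cover_I
begin

lemma ex_12: obtains s where "s \<in> A1" "s \<notin> A2"
  using four_cover.irredundant4[OF four_cover.perm34[OF four_cover.perm23[OF perm12]]] by blast

lemma sum_diff:
  assumes s: "s \<in> A1" "s \<notin> A2" and t: "t \<in> A2" "t \<notin> A1"
  shows "s \<oplus> t \<in> A3 \<and> s \<ominus> t \<in> A4 \<or> s \<oplus> t \<in> A4 \<and> s \<ominus> t \<in> A3"
proof -
  have c: "s \<in> carrier R" "t \<in> carrier R" using s t in_carrier by blast+
  have t': "\<ominus> t \<in> A2" "\<ominus> t \<notin> A1" using t c by simp_all
  have "s \<ominus> t \<in> A4 \<longleftrightarrow> s \<ominus> t \<notin> A3" using sum_mem[OF s t'] by (simp add: minus_eq)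
  then show ?thesis
    using sum_mem[OF s t] not_sum_and_diff3[OF s t] four_cover_I.not_sum_and_diff3[OF perm34_I s t] by blast
qed

text \<open>Whichever of s' + t and s' - t lies in A3 is compared with s + t, which cancels
  t.\<close>

lemma cosets_aux:
  assumes s: "s \<in> A1" "s \<notin> A2" and s': "s' \<in> A1" "s' \<notin> A2"
    and t: "t \<in> A2" "t \<notin> A1" and st: "s \<oplus> t \<in> A3"
  shows "s' \<ominus> s \<in> A2 \<or> s' \<oplus> s \<in> A2"
proof -
  have c: "s \<in> carrier R" "s' \<in> carrier R" "t \<in> carrier R" using s s' t in_carrier by blast+
  from sum_diff[OF s' t] show ?thesis
  proof
    assume "s' \<oplus> t \<in> A3 \<and> s' \<ominus> t \<in> A4"
    then have "(s' \<oplus> t) \<ominus> (s \<oplus> t) \<in> A3" using st sub_rules(17) by blast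
    moreover have "(s' \<oplus> t) \<ominus> (s \<oplus> t) = s' \<ominus> s" using c by algebra
    ultimately have "s' \<ominus> s \<in> A3" by simp
    moreover have "s' \<ominus> s \<in> A1" using s s' sub_rules(5) by blast
    ultimately show ?thesis using meets(2) by blast
  next
    assume "s' \<oplus> t \<in> A4 \<and> s' \<ominus> t \<in> A3"
    then have "(s \<oplus> t) \<oplus> (s' \<ominus> t) \<in> A3" using st sub_rules(15) by blast
    moreover have "(s \<oplus> t) \<oplus> (s' \<ominus> t) = s' \<oplus> s" using c by algebra
    ultimately have "s' \<oplus> s \<in> A3" by simp
    moreover have "s' \<oplus> s \<in> A1" using s s' sub_rules(3) by blast
    ultimately show ?thesis using meets(2) by blast
  qed
qed

lemma cosets:
  assumes s: "s \<in> A1" "s \<notin> A2" and s': "s' \<in> A1" "s' \<notin> A2"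
  shows "s' \<ominus> s \<in> A2 \<or> s' \<oplus> s \<in> A2"
proof -
  obtain t where t: "t \<in> A2" "t \<notin> A1" by (rule four_cover_I.ex_12[OF perm12_I])
  show ?thesis
    using cosets_aux[OF s s' t] four_cover_I.cosets_aux[OF perm34_I s s' t] sum_diff[OF s t] by blast
qed

text \<open>For x outside A2, \<open>cosets\<close> applied to 2 x leaves 2 x - x = x or 2 x + x = 3
  x in A2, and the first is excluded.\<close>

lemma triple1:
  assumes x: "x \<in> A1"
  shows "x \<oplus> x \<oplus> x \<in> A2"
proof (cases "x \<in> A2")
  case True
  then show ?thesis using sub_rules(9) by blast
next
  case False
  obtain t where t: "t \<in> A2" "t \<notin> A1" by (rule four_cover_I.ex_12[OF perm12_I])
  have c: "x \<in> carrier R" "t \<in> carrier R" using x t in_carrier by blast+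
  have xx1: "x \<oplus> x \<in> A1" using x sub_rules(3) by blast
  \<comment> \<open>If 2 x were in the intersection, x + t and x - t would lie in the same subring,
    against \<open>sum_diff\<close>.\<close>
  have "x \<oplus> x \<notin> A2"
  proof
    assume "x \<oplus> x \<in> A2"
    then have m: "x \<oplus> x \<in> A3" "x \<oplus> x \<in> A4" using xx1 meets(1) meet4 by blast+
    have e: "(x \<oplus> x) \<ominus> (x \<oplus> t) = x \<ominus> t" using c by algebra
    have "x \<ominus> t \<in> A3" if "x \<oplus> t \<in> A3" using sub_rules(17)[OF m(1) that] e by simp
    moreover have "x \<ominus> t \<in> A4" if "x \<oplus> t \<in> A4" using sub_rules(23)[OF m(2) that] e by simp
    ultimately show False
      using sum_diff[OF x False t] not_sum_and_diff3[OF x False t]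
        four_cover_I.not_sum_and_diff3[OF perm34_I x False t] by blast
  qed
  then have "(x \<oplus> x) \<ominus> x \<in> A2 \<or> (x \<oplus> x) \<oplus> x \<in> A2" using cosets[OF x False xx1] by blast
  moreover have "(x \<oplus> x) \<ominus> x = x" using c by algebra
  ultimately show ?thesis using False by simp
qed

lemma perm31_I: "four_cover_I R A3 A1 A2 A4"
  by (rule four_cover_I.perm12_I[OF perm23_I])

lemma perm41_I: "four_cover_I R A4 A1 A2 A3"
  by (rule four_cover_I.perm31_I[OF perm34_I])

lemma triple:
  assumes x: "x \<in> carrier R"
  shows "x \<oplus> x \<oplus> x \<in> A1 \<inter> A2 \<inter> A3 \<inter> A4"
proof -
  define y where "y = x \<oplus> x \<oplus> x"
  consider "x \<in> A1" | "x \<in> A2" | "x \<in> A3" | "x \<in> A4" using x cover by blast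
  then have "y \<in> A1 \<and> y \<in> A2 \<or> y \<in> A1 \<and> y \<in> A3 \<or> y \<in> A1 \<and> y \<in> A4"
  proof cases
    case 1
    then have "y \<in> A1" using sub_rules(3) unfolding y_def by blast
    then show ?thesis using triple1[OF 1] unfolding y_def by blast
  next
    case 2
    then have "y \<in> A2" using sub_rules(9) unfolding y_def by blast
    then show ?thesis using four_cover_I.triple1[OF perm12_I 2] unfolding y_def by blast
  next
    case 3
    then have "y \<in> A3" using sub_rules(15) unfolding y_def by blast
    then show ?thesis using four_cover_I.triple1[OF perm31_I 3] unfolding y_def by blast
  next
    case 4
    then have "y \<in> A4" using sub_rules(21) unfolding y_def by blast
    then show ?thesis using four_cover_I.triple1[OF perm41_I 4] unfolding y_def by blast
  qed
  then show ?thesis using meets meet4 unfolding y_def by blast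
qed

lemma generated_aux:
  assumes s: "s \<in> A1" "s \<notin> A2" and r: "r \<in> A1"
    and D: "\<And>x. x \<in> A1 \<Longrightarrow> x \<in> A2 \<Longrightarrow> x \<in> T"
    and T: "s \<in> T" "\<And>x y. x \<in> T \<Longrightarrow> y \<in> T \<Longrightarrow> x \<oplus> y \<in> T" "\<And>x y. x \<in> T \<Longrightarrow> y \<in> T \<Longrightarrow> x \<ominus> y \<in> T"
  shows "r \<in> T"
proof (cases "r \<in> A2")
  case True
  then show ?thesis using D r by blast
next
  case False
  have c: "s \<in> carrier R" "r \<in> carrier R" using s r in_carrier by blast+
  from cosets[OF s r False] show ?thesis
  proof
    assume "r \<ominus> s \<in> A2"
    then have "r \<ominus> s \<in> T" using D sub_rules(5)[OF r s(1)] by blast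
    then have "(r \<ominus> s) \<oplus> s \<in> T" using T by blast
    moreover have "(r \<ominus> s) \<oplus> s = r" using c by algebra
    ultimately show ?thesis by simp
  next
    assume "r \<oplus> s \<in> A2"
    then have "r \<oplus> s \<in> T" using D sub_rules(3)[OF r s(1)] by blast
    then have "(r \<oplus> s) \<ominus> s \<in> T" using T by blast
    moreover have "(r \<oplus> s) \<ominus> s = r" using c by algebra
    ultimately show ?thesis by simp
  qed
qed

text \<open>R is additively generated by s, t and the common intersection: of s + t and s - t, one
  generates A3 and the other A4 over the intersection. Stated as induction over a set T, so that T
  can be chosen to suit each use.\<close>

lemma generated:
  assumes s: "s \<in> A1" "s \<notin> A2" and t: "t \<in> A2" "t \<notin> A1" and r: "r \<in> carrier R"
    and D: "\<And>x. x \<in> A1 \<Longrightarrow> x \<in> A2 \<Longrightarrow> x \<in> T"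
    and T: "s \<in> T" "t \<in> T" "\<And>x y. x \<in> T \<Longrightarrow> y \<in> T \<Longrightarrow> x \<oplus> y \<in> T" "\<And>x y. x \<in> T \<Longrightarrow> y \<in> T \<Longrightarrow> x \<ominus> y \<in> T"
  shows "r \<in> T"
proof -
  have c: "s \<in> carrier R" "t \<in> carrier R" using s t in_carrier by blast+
  have st: "s \<oplus> t \<in> T" "s \<ominus> t \<in> T" using T by blast+
  have "\<ominus> t \<notin> A1" using t c by simp
  then have n: "s \<oplus> t \<notin> A1" "s \<ominus> t \<notin> A1" using s t c by simp_all
  have D3: "x \<in> T" if "x \<in> A3" "x \<in> A1" for x using that meets(2) D by blast
  have D4: "x \<in> T" if "x \<in> A4" "x \<in> A1" for x using that meets(3) D by blast
  have D2: "x \<in> T" if "x \<in> A2" "x \<in> A1" for x using that D by blast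
  obtain w where w: "w \<in> A3" "w \<notin> A1" "w \<in> T" using sum_diff[OF s t] n st by blast
  obtain z where z: "z \<in> A4" "z \<notin> A1" "z \<in> T" using sum_diff[OF s t] n st by blast
  consider "r \<in> A1" | "r \<in> A2" | "r \<in> A3" | "r \<in> A4" using r cover by blast
  then show ?thesis
  proof cases
    case 1
    show ?thesis by (rule generated_aux[OF s 1 D T(1) T(3) T(4)])
  next
    case 2
    show ?thesis by (rule four_cover_I.generated_aux[OF perm12_I t 2 D2 T(2) T(3) T(4)])
  next
    case 3
    show ?thesis by (rule four_cover_I.generated_aux[OF perm31_I w(1,2) 3 D3 w(3) T(3) T(4)])
  next
    case 4
    show ?thesis by (rule four_cover_I.generated_aux[OF perm41_I z(1,2) 4 D4 z(3) T(3) T(4)])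
  qed
qed

text \<open>Both A1 and A2 are ideals here. Write 1 = s + t + d with d in the intersection. Then 1 =
  (s + t + d)^2 differs from (s - t)^2 by \<open>w\<close>, which lies in both ideals and hence in
  A4. As s - t is in A4, so is 1, and 1 in A3 and A4 forces 1 into A1.\<close>

lemma one_mem_aux:
  assumes one: "\<one> \<notin> A1" "\<one> \<notin> A2" "\<one> \<in> A3"
    and id1: "\<And>a x. a \<in> A1 \<Longrightarrow> x \<in> carrier R \<Longrightarrow> x \<otimes> a \<in> A1 \<and> a \<otimes> x \<in> A1"
    and id2: "\<And>a x. a \<in> A2 \<Longrightarrow> x \<in> carrier R \<Longrightarrow> x \<otimes> a \<in> A2 \<and> a \<otimes> x \<in> A2"
  shows False
proof -
  obtain s0 where s0: "s0 \<in> A1" "s0 \<notin> A2" by (rule ex_12)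
  obtain t0 where t0: "t0 \<in> A2" "t0 \<notin> A1" by (rule four_cover_I.ex_12[OF perm12_I])
  have c0: "s0 \<in> carrier R" "t0 \<in> carrier R" using s0 t0 in_carrier by blast+
  obtain t1 where t1: "t1 \<in> A2" "t1 \<notin> A1" "s0 \<oplus> t1 \<in> A3"
  proof (cases "s0 \<oplus> t0 \<in> A3")
    case True
    then show ?thesis using that t0 by blast
  next
    case False
    then have "s0 \<oplus> \<ominus> t0 \<in> A3" using sum_diff[OF s0 t0] by (simp add: minus_eq)
    then show ?thesis using that[of "\<ominus> t0"] t0 c0 by simp
  qed
  have c1: "t1 \<in> carrier R" using t1 in_carrier by blast
  have "s0 \<oplus> t1 \<notin> A1" using s0 t1 c1 by simp
  then have "\<one> \<ominus> (s0 \<oplus> t1) \<in> A1 \<or> \<one> \<oplus> (s0 \<oplus> t1) \<in> A1"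
    by (intro four_cover_I.cosets[OF perm31_I]) (use t1 one in auto)
  \<comment> \<open>The identity is plus or minus s0 + t1 modulo the intersection; the sign is
    absorbed into s and t.\<close>
  then obtain s t where s: "s \<in> A1" "s \<notin> A2" and t: "t \<in> A2" "t \<notin> A1" and st: "s \<oplus> t \<in> A3"
    and d1: "\<one> \<ominus> (s \<oplus> t) \<in> A1"
  proof
    assume "\<one> \<ominus> (s0 \<oplus> t1) \<in> A1"
    then show ?thesis using that[of s0 t1] s0 t1 by blast
  next
    assume *: "\<one> \<oplus> (s0 \<oplus> t1) \<in> A1"
    have e: "\<ominus> s0 \<oplus> \<ominus> t1 = \<ominus> (s0 \<oplus> t1)" using c0 c1 by (simp add: minus_add)
    have "\<one> \<ominus> \<ominus> (s0 \<oplus> t1) = \<one> \<oplus> (s0 \<oplus> t1)" using c0 c1 by (simp add: minus_eq)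
    then show ?thesis using that[of "\<ominus> s0" "\<ominus> t1"] s0 t1 c0 c1 * unfolding e by simp
  qed
  have c: "s \<in> carrier R" "t \<in> carrier R" using s t in_carrier by blast+
  define d where "d = \<one> \<ominus> (s \<oplus> t)"
  have dc: "d \<in> carrier R" using c by (simp add: d_def)
  have d: "d \<in> A1" "d \<in> A2"
  proof -
    show "d \<in> A1" using d1 by (simp add: d_def)
    moreover have "d \<in> A3" unfolding d_def using one(3) st sub_rules(17) by blast
    ultimately show "d \<in> A2" using meets(2) by blast
  qed
  have u: "s \<oplus> t \<oplus> d = \<one>" using c unfolding d_def by algebra
  have "s \<oplus> t \<notin> A1" using s t c by simp
  then have "s \<oplus> t \<notin> A4" using st meets(6) by blast
  then have "s \<ominus> t \<in> A4" using sum_diff[OF s t] by blast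
  then have sq: "(s \<ominus> t) \<otimes> (s \<ominus> t) \<in> A4" using sub_rules(24) by blast
  define w where "w = (s \<otimes> t \<oplus> s \<otimes> t \<oplus> (t \<otimes> s \<oplus> t \<otimes> s)) \<oplus> (d \<otimes> (s \<oplus> t \<oplus> d) \<oplus> (s \<oplus> t) \<otimes> d)"
  have "(s \<oplus> t \<oplus> d) \<otimes> (s \<oplus> t \<oplus> d) = (s \<ominus> t) \<otimes> (s \<ominus> t) \<oplus> w"
    unfolding w_def using c dc by algebra
  then have e: "\<one> = (s \<ominus> t) \<otimes> (s \<ominus> t) \<oplus> w" unfolding u by simp
  have "s \<otimes> t \<in> A1" "t \<otimes> s \<in> A1" "d \<otimes> (s \<oplus> t \<oplus> d) \<in> A1" "(s \<oplus> t) \<otimes> d \<in> A1"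
    using id1 s d c dc by simp_all
  then have w1: "w \<in> A1" unfolding w_def by (intro sub_rules(3))
  have "s \<otimes> t \<in> A2" "t \<otimes> s \<in> A2" "d \<otimes> (s \<oplus> t \<oplus> d) \<in> A2" "(s \<oplus> t) \<otimes> d \<in> A2"
    using id2 t d c dc by simp_all
  then have w2: "w \<in> A2" unfolding w_def by (intro sub_rules(9))
  have "w \<in> A4" using w1 w2 meets(1) meet4 by blast
  then have "\<one> \<in> A4" by (subst e) (intro sub_rules(21) sq)
  then show False using one meets(6) by blast
qed

lemma not_two_missing:
  assumes one: "\<one> \<notin> A1" "\<one> \<notin> A2" and uc: "unital_or_cyclic A1" "unital_or_cyclic A2"
  shows False
proof -
  have cyc: "\<exists>n::int. x \<ominus> add_pow R n \<one> \<in> A1" "\<exists>n::int. x \<ominus> add_pow R n \<one> \<in> A2" if "x \<in> carrier R" for x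
    using one uc that unfolding unital_or_cyclic_def by blast+
  have id1: "x \<otimes> a \<in> A1 \<and> a \<otimes> x \<in> A1" if "a \<in> A1" "x \<in> carrier R" for a x
    using cyclic_ideal[OF sub1 cyc(1) that] by blast
  have id2: "x \<otimes> a \<in> A2 \<and> a \<otimes> x \<in> A2" if "a \<in> A2" "x \<in> carrier R" for a x
    using cyclic_ideal[OF sub2 cyc(2) that] by blast
  have "\<one> \<in> A3 \<or> \<one> \<in> A4" using one in_cover by blast
  then show False
  proof
    assume "\<one> \<in> A3"
    then show False by (rule one_mem_aux[OF one _ id1 id2])
  next
    assume "\<one> \<in> A4"
    then show False by (rule four_cover_I.one_mem_aux[OF perm34_I one _ id1 id2])
  qed
qed

end

text \<open>Membership in two subrings (first configuration) or three (second) implies membership in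
  all, so a missing identity is missing from at least two of them.\<close>

lemma (in four_cover) one_mem:
  assumes uc: "unital_or_cyclic A1" "unital_or_cyclic A2" "unital_or_cyclic A3" "unital_or_cyclic A4"
  shows "\<one> \<in> A1 \<inter> A2 \<inter> A3 \<inter> A4"
proof (rule ccontr)
  assume no: "\<not> ?thesis"
  from I_or_II show False
  proof
    assume "four_cover_I R A1 A2 A3 A4"
    then interpret I: four_cover_I R A1 A2 A3 A4 .
    have "\<one> \<notin> A1 \<and> \<one> \<notin> A2 \<or> \<one> \<notin> A1 \<and> \<one> \<notin> A3 \<or> \<one> \<notin> A3 \<and> \<one> \<notin> A2"
      using no I.meets meet4 by blast
    then show False
      using I.not_two_missing[OF _ _ uc(1,2)] four_cover_I.not_two_missing[OF I.perm23_I _ _ uc(1,3)]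
        four_cover_I.not_two_missing[OF four_cover_I.perm23_I[OF I.perm31_I] _ _ uc(3,2)] by blast
  next
    assume "\<exists>B1 B2 B3 B4 b. four_cover_II R B1 B2 B3 B4 b \<and> B1 \<inter> B2 \<inter> B3 \<inter> B4 = A1 \<inter> A2 \<inter> A3 \<inter> A4"
    then obtain B1 B2 B3 B4 b where B: "four_cover_II R B1 B2 B3 B4 b"
      and eq: "B1 \<inter> B2 \<inter> B3 \<inter> B4 = A1 \<inter> A2 \<inter> A3 \<inter> A4" by blast
    have four: "add_pow R (4::int) x \<in> A1" "add_pow R (4::int) x \<in> A2"
      "add_pow R (4::int) x \<in> A3" "add_pow R (4::int) x \<in> A4" if "x \<in> carrier R" for x
      using four_cover_II.four_times[OF B that] unfolding eq by blast+
    have "\<one> \<notin> A1 \<and> \<one> \<notin> A2 \<or> \<one> \<notin> A1 \<and> \<one> \<notin> A3 \<or> \<one> \<notin> A1 \<and> \<one> \<notin> A4 \<or>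
      \<one> \<notin> A2 \<and> \<one> \<notin> A3 \<or> \<one> \<notin> A2 \<and> \<one> \<notin> A4 \<or> \<one> \<notin> A3 \<and> \<one> \<notin> A4"
      using no meet4 meet3 meet2 meet1 by blast
    moreover note not_two_cyclic[OF _ _ uc(1,2) four(1,2)]
      four_cover.not_two_cyclic[OF perm23 _ _ uc(1,3) four(1,3)]
      four_cover.not_two_cyclic[OF four_cover.perm23[OF perm34] _ _ uc(1,4) four(1,4)]
      four_cover.not_two_cyclic[OF four_cover.perm23[OF perm12] _ _ uc(2,3) four(2,3)]
      four_cover.not_two_cyclic[OF four_cover.perm23[OF four_cover.perm34[OF perm12]] _ _ uc(2,4) four(2,4)]
      four_cover.not_two_cyclic[OF four_cover.perm23[OF four_cover.perm34[OF four_cover.perm12[OF perm23]]]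
        _ _ uc(3,4) four(3,4)]
    ultimately show False by blast
  qed
qed

locale four_cover_unital = four_cover +
  assumes one_in: "\<one> \<in> A1" "\<one> \<in> A2" "\<one> \<in> A3" "\<one> \<in> A4"

lemma (in four_cover) ex_unital: "\<exists>B1 B2 B3 B4. four_cover_unital R B1 B2 B3 B4"
proof -
  obtain B1 where B1: "A1 \<subseteq> B1" "nonunital_subring B1 R" "B1 \<noteq> carrier R" "unital_or_cyclic B1"
    using proper_subring_extend[OF sub1 proper1] by blast
  obtain B2 where B2: "A2 \<subseteq> B2" "nonunital_subring B2 R" "B2 \<noteq> carrier R" "unital_or_cyclic B2"
    using proper_subring_extend[OF sub2 proper2] by blast
  obtain B3 where B3: "A3 \<subseteq> B3" "nonunital_subring B3 R" "B3 \<noteq> carrier R" "unital_or_cyclic B3"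
    using proper_subring_extend[OF sub3 proper3] by blast
  obtain B4 where B4: "A4 \<subseteq> B4" "nonunital_subring B4 R" "B4 \<noteq> carrier R" "unital_or_cyclic B4"
    using proper_subring_extend[OF sub4 proper4] by blast
  have c: "carrier R = B1 \<union> B2 \<union> B3 \<union> B4"
    using cover B1(1) B2(1) B3(1) B4(1) nonunital_subringD(1)[OF B1(2)] nonunital_subringD(1)[OF B2(2)]
      nonunital_subringD(1)[OF B3(2)] nonunital_subringD(1)[OF B4(2)] by blast
  interpret B: four_cover R B1 B2 B3 B4
    by (intro four_cover.intro four_cover_axioms.intro ring_axioms B1(2,3) B2(2,3) B3(2,3) B4(2,3) c no_three_cover)
  have "four_cover_unital R B1 B2 B3 B4"
    using B.one_mem[OF B1(4) B2(4) B3(4) B4(4)]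
    by (intro four_cover_unital.intro B.four_cover_axioms four_cover_unital_axioms.intro) blast+
  then show ?thesis by blast
qed

section \<open>Reduction to a core\<close>

lemma (in ring) nonunital_subring_Int:
  assumes S: "nonunital_subring S R" and T: "nonunital_subring T R"
  shows "nonunital_subring (S \<inter> T) R"
  by (rule nonunital_subringI)
    (simp_all add: nonunital_subringD[OF S] nonunital_subringD[OF T] subset_iff)

section \<open>The opposite ring, and transport along homomorphisms\<close>

definition op_ring :: "('a, 'm) ring_scheme \<Rightarrow> ('a, 'm) ring_scheme" where
  "op_ring R = R\<lparr>mult := \<lambda>x y. y \<otimes>\<^bsub>R\<^esub> x\<rparr>"

lemma op_ring_simps [simp]:
  "carrier (op_ring R) = carrier R" "\<zero>\<^bsub>op_ring R\<^esub> = \<zero>\<^bsub>R\<^esub>" "\<one>\<^bsub>op_ring R\<^esub> = \<one>\<^bsub>R\<^esub>"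
  "x \<oplus>\<^bsub>op_ring R\<^esub> y = x \<oplus>\<^bsub>R\<^esub> y" "x \<otimes>\<^bsub>op_ring R\<^esub> y = y \<otimes>\<^bsub>R\<^esub> x" "add_monoid (op_ring R) = add_monoid R"
  "\<ominus>\<^bsub>op_ring R\<^esub> x = \<ominus>\<^bsub>R\<^esub> x" "x \<ominus>\<^bsub>op_ring R\<^esub> y = x \<ominus>\<^bsub>R\<^esub> y"
  by (simp_all add: op_ring_def a_inv_def a_minus_def)

lemma (in ring) ring_op_ring: "ring (op_ring R)"
  by (rule ringI)
    (auto intro!: abelian_groupI monoidI simp: a_ac m_assoc l_distr r_distr intro: r_neg)

lemma additive_subgroup_op_ring [simp]: "additive_subgroup S (op_ring R) \<longleftrightarrow> additive_subgroup S R"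
  by (simp add: additive_subgroup_def op_ring_def)

lemma nonunital_subring_op_ring [simp]: "nonunital_subring S (op_ring R) \<longleftrightarrow> nonunital_subring S R"
  by (auto simp: nonunital_subring_def)

lemma three_cover_op_ring [simp]: "three_cover (op_ring R) \<longleftrightarrow> three_cover R"
  by (simp add: three_cover_def)

lemma (in four_cover) four_cover_op: "four_cover (op_ring R) A1 A2 A3 A4"
  by (intro four_cover.intro four_cover_axioms.intro ring_op_ring)
    (simp_all add: sub1 sub2 sub3 sub4 proper1 proper2 proper3 proper4 cover[symmetric] no_three_cover)

lemma (in ring) ideal_op_ringD:
  assumes "ideal I (op_ring R)"
  shows "ideal I R"
proof -
  interpret I: ideal I "op_ring R" by fact
  have "additive_subgroup I R" using I.additive_subgroup_axioms by simp
  then show ?thesis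
    using I.I_l_closed I.I_r_closed
    by (intro idealI ring_axioms) (auto simp: additive_subgroup_def)
qed

lemma surjects_onto_comp:
  assumes R: "ring R" and h: "h \<in> Ring.ring_hom R R'" "h ` carrier R = carrier R'"
    and s: "surjects_onto R' m u"
  shows "surjects_onto R m u"
proof -
  obtain c where c: "\<And>x y. x \<in> carrier R' \<Longrightarrow> y \<in> carrier R' \<Longrightarrow>
      c (x \<oplus>\<^bsub>R'\<^esub> y) = c x + c y \<and> c (x \<otimes>\<^bsub>R'\<^esub> y) = m (c x) (c y)"
    and c1: "c \<one>\<^bsub>R'\<^esub> = u" and surj: "c ` carrier R' = UNIV"
    using s unfolding surjects_onto_def by blast
  show ?thesis unfolding surjects_onto_def
  proof (intro exI[of _ "c \<circ> h"] conjI ballI)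
    fix x y assume xy: "x \<in> carrier R" "y \<in> carrier R"
    show "(c \<circ> h) (x \<oplus>\<^bsub>R\<^esub> y) = (c \<circ> h) x + (c \<circ> h) y"
      "(c \<circ> h) (x \<otimes>\<^bsub>R\<^esub> y) = m ((c \<circ> h) x) ((c \<circ> h) y)"
      using c[OF ring_hom_closed[OF h(1) xy(1)] ring_hom_closed[OF h(1) xy(2)]]
        ring_hom_add[OF h(1) xy] ring_hom_mult[OF h(1) xy] by simp_all
  next
    show "(c \<circ> h) \<one>\<^bsub>R\<^esub> = u" using ring_hom_one[OF h(1)] c1 by simp
    show "(c \<circ> h) ` carrier R = UNIV" by (simp only: image_comp[symmetric] h(2) surj)
  qed
qed

lemma (in ring_hom_ring) nonunital_subring_image:
  assumes A: "nonunital_subring A R"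
  shows "nonunital_subring (h ` A) S"
proof (rule S.nonunital_subringI)
  note D = R.nonunital_subringD[OF A]
  show "h ` A \<subseteq> carrier S" using D(1) by auto
  show "\<zero>\<^bsub>S\<^esub> \<in> h ` A" using D(2) hom_zero by (metis imageI)
  fix x y assume "x \<in> h ` A" "y \<in> h ` A"
  then obtain a b where ab: "a \<in> A" "b \<in> A" "x = h a" "y = h b" by blast
  have c: "a \<in> carrier R" "b \<in> carrier R" using ab D(1) by blast+
  have "x \<ominus>\<^bsub>S\<^esub> y = h (a \<ominus> b)" using ab c by (simp add: a_minus_def)
  then show "x \<ominus>\<^bsub>S\<^esub> y \<in> h ` A" using D(5) ab by blast
  have "x \<otimes>\<^bsub>S\<^esub> y = h (a \<otimes> b)" using ab c by simp
  then show "x \<otimes>\<^bsub>S\<^esub> y \<in> h ` A" using D(6) ab by blast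
qed

lemma (in ring_hom_ring) nonunital_subring_vimage:
  assumes A: "nonunital_subring A S"
  shows "nonunital_subring {x \<in> carrier R. h x \<in> A} R"
proof (rule R.nonunital_subringI)
  note D = S.nonunital_subringD[OF A]
  show "\<zero> \<in> {x \<in> carrier R. h x \<in> A}" using D(2) by simp
  fix x y assume "x \<in> {x \<in> carrier R. h x \<in> A}" "y \<in> {x \<in> carrier R. h x \<in> A}"
  then show "x \<ominus> y \<in> {x \<in> carrier R. h x \<in> A}" "x \<otimes> y \<in> {x \<in> carrier R. h x \<in> A}"
    using D(5)[of "h x" "h y"] D(6)[of "h x" "h y"] by (simp_all add: a_minus_def)
qed blast

lemma (in ring_hom_ring) three_cover_vimage:
  assumes surj: "h ` carrier R = carrier S" and tc: "three_cover S"
  shows "three_cover R"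
proof -
  obtain A B C where ABC: "nonunital_subring A S" "nonunital_subring B S" "nonunital_subring C S"
     "A \<noteq> carrier S" "B \<noteq> carrier S" "C \<noteq> carrier S" "carrier S = A \<union> B \<union> C"
    using tc unfolding three_cover_def by blast
  define V where "V A = {x \<in> carrier R. h x \<in> A}" for A
  have V: "nonunital_subring (V A) R" if "nonunital_subring A S" for A
    unfolding V_def by (rule nonunital_subring_vimage[OF that])
  have ne: "V A \<noteq> carrier R" if "nonunital_subring A S" "A \<noteq> carrier S" for A
  proof
    assume "V A = carrier R"
    then have v: "h x \<in> A" if "x \<in> carrier R" for x using that unfolding V_def by blast
    have "y \<in> A" if "y \<in> carrier S" for y using that v unfolding surj[symmetric] by blast
    then have "carrier S = A" using S.nonunital_subringD(1)[OF that(1)] by blast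
    then show False using that(2) by simp
  qed
  have "h x \<in> A \<union> B \<union> C" if "x \<in> carrier R" for x using hom_closed[OF that] ABC(7) by simp
  then have un: "carrier R = V A \<union> V B \<union> V C" unfolding V_def by auto
  show ?thesis
    unfolding three_cover_def
    by (intro exI[of _ "V A"] exI[of _ "V B"] exI[of _ "V C"] conjI V ne ABC un)
qed

section \<open>The quotient by the largest ideal in the intersection\<close>

locale four_cover_core = four_cover_unital +
  assumes core: "ideal I R \<Longrightarrow> I \<subseteq> A1 \<inter> A2 \<inter> A3 \<inter> A4 \<Longrightarrow> I = {\<zero>}"

text \<open>\<open>J\<close> is the set of d with R d R inside \<open>D\<close>. It is an ideal, it
  lies in \<open>D\<close> because R has an identity, and any ideal of R / J inside all four images
  lifts into it.\<close>

lemma (in four_cover_unital) ex_core: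
  "\<exists>(R' :: 'a set ring) B1 B2 B3 B4 h. four_cover_core R' B1 B2 B3 B4 \<and>
     h \<in> Ring.ring_hom R R' \<and> h ` carrier R = carrier R'"
proof -
  define D where "D = A1 \<inter> A2 \<inter> A3 \<inter> A4"
  have D: "nonunital_subring D R"
    unfolding D_def by (intro nonunital_subring_Int sub1 sub2 sub3 sub4)
  note D' = nonunital_subringD[OF D]
  define J where "J = {d \<in> carrier R. \<forall>x\<in>carrier R. \<forall>y\<in>carrier R. x \<otimes> d \<otimes> y \<in> D}"
  have "nonunital_subring J R"
  proof (rule nonunital_subringI)
    show "J \<subseteq> carrier R" by (auto simp: J_def)
    show "\<zero> \<in> J" using D'(2) by (simp add: J_def)
    fix d e assume de: "d \<in> J" "e \<in> J"
    then have c: "d \<in> carrier R" "e \<in> carrier R" by (auto simp: J_def)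
    have "x \<otimes> (d \<ominus> e) \<otimes> y \<in> D" if "x \<in> carrier R" "y \<in> carrier R" for x y
    proof -
      have "x \<otimes> (d \<ominus> e) \<otimes> y = x \<otimes> d \<otimes> y \<ominus> x \<otimes> e \<otimes> y"
        using that c by (simp add: minus_eq l_distr r_distr l_minus r_minus)
      then show ?thesis using D'(5) de that by (simp add: J_def)
    qed
    then show "d \<ominus> e \<in> J" using c by (simp add: J_def)
    have "x \<otimes> (d \<otimes> e) \<otimes> y \<in> D" if "x \<in> carrier R" "y \<in> carrier R" for x y
    proof -
      have "x \<otimes> (d \<otimes> e) \<otimes> y = x \<otimes> d \<otimes> (e \<otimes> y)" using that c by (simp add: m_assoc)
      then show ?thesis using de that c by (simp add: J_def)
    qed
    then show "d \<otimes> e \<in> J" using c by (simp add: J_def)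
  qed
  then have "subgroup J (add_monoid R)" by (simp add: nonunital_subring_def additive_subgroup_def)
  then have J: "ideal J R"
  proof (rule idealI[OF ring_axioms])
    fix a x assume a: "a \<in> J" and x: "x \<in> carrier R"
    then have c: "a \<in> carrier R" by (simp add: J_def)
    have "z \<otimes> (x \<otimes> a) \<otimes> y \<in> D" if "z \<in> carrier R" "y \<in> carrier R" for z y
    proof -
      have "z \<otimes> (x \<otimes> a) \<otimes> y = (z \<otimes> x) \<otimes> a \<otimes> y" using that c x by (simp add: m_assoc)
      then show ?thesis using a that x by (simp add: J_def)
    qed
    then show "x \<otimes> a \<in> J" using c x by (simp add: J_def)
    have "z \<otimes> (a \<otimes> x) \<otimes> y \<in> D" if "z \<in> carrier R" "y \<in> carrier R" for z y
    proof -
      have "z \<otimes> (a \<otimes> x) \<otimes> y = z \<otimes> a \<otimes> (x \<otimes> y)" using that c x by (simp add: m_assoc)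
      then show ?thesis using a that x by (simp add: J_def)
    qed
    then show "a \<otimes> x \<in> J" using c x by (simp add: J_def)
  qed
  interpret J: ideal J R by (rule J)
  define h where "h = (+>) J"
  interpret h: ring_hom_ring R "R Quot J" h unfolding h_def by (rule J.rcos_ring_hom_ring)
  have surj: "h ` carrier R = carrier (R Quot J)"
    by (auto simp: h_def FactRing_def A_RCOSETS_def')
  have JD: "J \<subseteq> D"
  proof
    fix d assume d: "d \<in> J"
    then have "d \<in> carrier R" "\<one> \<otimes> d \<otimes> \<one> \<in> D" unfolding J_def by blast+
    then show "d \<in> D" by simp
  qed
  have heq: "x \<ominus> y \<in> J" if "h x = h y" "x \<in> carrier R" "y \<in> carrier R" for x y
    using quotient_eq_iff_same_a_r_cos[OF J that(2,3)] that(1) by (simp add: h_def)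
  \<comment> \<open>Each subring contains \<open>J\<close>, so it is the full preimage of its image;
    properness and membership in \<open>D\<close> therefore pass between R and R / J.\<close>
  have sat: "x \<in> A" if A: "nonunital_subring A R" "D \<subseteq> A" and x: "h x \<in> h ` A" "x \<in> carrier R" for A x
  proof -
    obtain a where a: "a \<in> A" "h x = h a" using x by blast
    have ac: "a \<in> carrier R" using nonunital_subringD(1)[OF A(1)] a by blast
    have "x \<ominus> a \<in> A" using heq[OF a(2) x(2) ac] JD A(2) by blast
    then have "(x \<ominus> a) \<oplus> a \<in> A" using nonunital_subringD(3)[OF A(1)] a by blast
    moreover have "(x \<ominus> a) \<oplus> a = x" using x ac by algebra
    ultimately show ?thesis by simp
  qed
  have ne: "h ` A \<noteq> carrier (R Quot J)" if A: "nonunital_subring A R" "D \<subseteq> A" "A \<noteq> carrier R" for A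
  proof
    assume *: "h ` A = carrier (R Quot J)"
    have "x \<in> A" if "x \<in> carrier R" for x
      by (rule sat[OF A(1,2) _ that]) (simp only: * h.hom_closed[OF that])
    then show False using A(3) nonunital_subringD(1)[OF A(1)] by blast
  qed
  have DA: "D \<subseteq> A1" "D \<subseteq> A2" "D \<subseteq> A3" "D \<subseteq> A4" by (auto simp: D_def)
  have fc: "four_cover (R Quot J) (h ` A1) (h ` A2) (h ` A3) (h ` A4)"
  proof (intro four_cover.intro four_cover_axioms.intro J.quotient_is_ring)
    show "carrier (R Quot J) = h ` A1 \<union> h ` A2 \<union> h ` A3 \<union> h ` A4"
      unfolding surj[symmetric] image_Un[symmetric] using cover by simp
    show "\<not> three_cover (R Quot J)" using h.three_cover_vimage[OF surj] no_three_cover by blast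
  qed (fact h.nonunital_subring_image[OF sub1] h.nonunital_subring_image[OF sub2]
      h.nonunital_subring_image[OF sub3] h.nonunital_subring_image[OF sub4]
      ne[OF sub1 DA(1) proper1] ne[OF sub2 DA(2) proper2] ne[OF sub3 DA(3) proper3] ne[OF sub4 DA(4) proper4])+
  have core: "I = {\<zero>\<^bsub>R Quot J\<^esub>}" if I: "ideal I (R Quot J)" "I \<subseteq> h ` A1 \<inter> h ` A2 \<inter> h ` A3 \<inter> h ` A4" for I
  proof -
    interpret I: ideal I "R Quot J" by (rule I(1))
    have "i = \<zero>\<^bsub>R Quot J\<^esub>" if i: "i \<in> I" for i
    proof -
      have "i \<in> carrier (R Quot J)" using i by (rule I.Icarr)
      then obtain d where d: "d \<in> carrier R" "i = h d" using surj by blast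
      have "x \<otimes> d \<otimes> y \<in> D" if xy: "x \<in> carrier R" "y \<in> carrier R" for x y
      proof -
        have "h x \<otimes>\<^bsub>R Quot J\<^esub> i \<otimes>\<^bsub>R Quot J\<^esub> h y \<in> I"
          by (rule I.I_r_closed[OF I.I_l_closed[OF i h.hom_closed[OF xy(1)]] h.hom_closed[OF xy(2)]])
        moreover have "h (x \<otimes> d \<otimes> y) = h x \<otimes>\<^bsub>R Quot J\<^esub> i \<otimes>\<^bsub>R Quot J\<^esub> h y"
          unfolding d(2) using d(1) xy by simp
        ultimately have "h (x \<otimes> d \<otimes> y) \<in> I" by simp
        then have hA: "h (x \<otimes> d \<otimes> y) \<in> h ` A1" "h (x \<otimes> d \<otimes> y) \<in> h ` A2"
          "h (x \<otimes> d \<otimes> y) \<in> h ` A3" "h (x \<otimes> d \<otimes> y) \<in> h ` A4" using I(2) by blast+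
        have c: "x \<otimes> d \<otimes> y \<in> carrier R" using d(1) xy by simp
        show ?thesis
          using sat[OF sub1 DA(1) hA(1) c] sat[OF sub2 DA(2) hA(2) c] sat[OF sub3 DA(3) hA(3) c] sat[OF sub4 DA(4) hA(4) c]
          unfolding D_def by blast
      qed
      then have "d \<in> J" using d(1) unfolding J_def by blast
      then have "J +> d = J" by (rule J.a_rcos_const)
      then have "h d = J" unfolding h_def .
      then show ?thesis unfolding d(2) by (simp add: FactRing_def)
    qed
    then show ?thesis using I.zero_closed by blast
  qed
  have one: "\<one>\<^bsub>R Quot J\<^esub> \<in> h ` A" if "\<one> \<in> A" for A
    using imageI[OF that, of h] h.hom_one by simp
  have "four_cover_core (R Quot J) (h ` A1) (h ` A2) (h ` A3) (h ` A4)"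
    by (intro four_cover_core.intro four_cover_unital.intro fc four_cover_unital_axioms.intro
        four_cover_core_axioms.intro core one one_in)
  then have "four_cover_core (R Quot J) (h ` A1) (h ` A2) (h ` A3) (h ` A4) \<and>
      h \<in> Ring.ring_hom R (R Quot J) \<and> h ` carrier R = carrier (R Quot J)"
    by (rule conjI[OF _ conjI[OF h.homh surj]])
  then show ?thesis
    by (rule exI[of _ h, THEN exI[of _ "h ` A4"], THEN exI[of _ "h ` A3"], THEN exI[of _ "h ` A2"],
        THEN exI[of _ "h ` A1"], THEN exI[of _ "R Quot J"]])
qed

section \<open>One-sided actions of the common intersection\<close>

context four_cover_core
begin

definition meet where "meet = A1 \<inter> A2 \<inter> A3 \<inter> A4"

lemma meet_subring: "nonunital_subring meet R"
  unfolding meet_def by (intro nonunital_subring_Int sub1 sub2 sub3 sub4)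

lemmas meet_rules = nonunital_subringD[OF meet_subring]

lemma meet_one [simp]: "\<one> \<in> meet"
  using one_in by (simp add: meet_def)

lemma core_op: "four_cover_core (op_ring R) A1 A2 A3 A4"
proof (intro four_cover_core.intro four_cover_unital.intro four_cover_op four_cover_unital_axioms.intro
    four_cover_core_axioms.intro)
  show "I = {\<zero>\<^bsub>op_ring R\<^esub>}" if "ideal I (op_ring R)" "I \<subseteq> A1 \<inter> A2 \<inter> A3 \<inter> A4" for I
    using core[OF ideal_op_ringD[OF that(1)] that(2)] by simp
qed (simp_all add: one_in)

text \<open>The elements of \<open>meet\<close> acting as zero by left multiplication on the
  additive group R / meet.\<close>

definition left_kernel where "left_kernel = {d \<in> meet. \<forall>r\<in>carrier R. d \<otimes> r \<in> meet}"

definition right_kernel where "right_kernel = {d \<in> meet. \<forall>r\<in>carrier R. r \<otimes> d \<in> meet}"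

text \<open>For \<open>r\<close> in a subring \<open>A\<close> and \<open>t\<close> outside, \<open>(r \<otimes> j) \<otimes> t\<close> would be congruent to \<open>\<plusminus> t\<close> modulo the meet
  if \<open>r \<otimes> j\<close> acted as \<open>\<plusminus> 1\<close>, while \<open>r \<otimes> (j \<otimes> t)\<close> lies in \<open>A\<close>.\<close>

lemma kernel_aux:
  assumes scal: "\<And>d. d \<in> meet \<Longrightarrow> d \<in> left_kernel \<or> d \<ominus> \<one> \<in> left_kernel \<or> d \<oplus> \<one> \<in> left_kernel"
    and j: "j \<in> left_kernel" "j \<in> right_kernel" and r: "r \<in> carrier R"
  shows "r \<otimes> j \<in> left_kernel"
proof -
  have jm: "j \<in> meet" "j \<in> carrier R" using j meet_rules(1) by (auto simp: left_kernel_def)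
  have rj: "r \<otimes> j \<in> meet" using j r by (simp add: right_kernel_def)
  have contra: False if A: "nonunital_subring A R" "A \<noteq> carrier R" "meet \<subseteq> A" "r \<in> A"
    and e: "r \<otimes> j \<ominus> \<one> \<in> left_kernel \<or> r \<otimes> j \<oplus> \<one> \<in> left_kernel" for A
  proof -
    note D = nonunital_subringD[OF A(1)]
    obtain t where t: "t \<in> carrier R" "t \<notin> A" using A(2) D(1) by blast
    have "j \<otimes> t \<in> A" using j t A(3) by (auto simp: left_kernel_def)
    then have rjt: "r \<otimes> (j \<otimes> t) \<in> A" using D(6) A(4) by blast
    have eqs: "(r \<otimes> j \<ominus> \<one>) \<otimes> t = r \<otimes> (j \<otimes> t) \<ominus> t" "(r \<otimes> j \<oplus> \<one>) \<otimes> t = r \<otimes> (j \<otimes> t) \<oplus> t"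
      using r jm t by (simp_all add: minus_eq l_distr l_minus m_assoc)
    have "(r \<otimes> j \<ominus> \<one>) \<otimes> t \<in> A \<or> (r \<otimes> j \<oplus> \<one>) \<otimes> t \<in> A"
      using e t A(3) by (auto simp: left_kernel_def)
    then show False
      unfolding eqs using nonunital_subring_diff_iff(1)[OF A(1) t(1) rjt] nonunital_subring_add_iff(1)[OF A(1) rjt t(1)] t(2)
      by blast
  qed
  have m: "meet \<subseteq> A1" "meet \<subseteq> A2" "meet \<subseteq> A3" "meet \<subseteq> A4" by (auto simp: meet_def)
  have "\<not> (r \<otimes> j \<ominus> \<one> \<in> left_kernel \<or> r \<otimes> j \<oplus> \<one> \<in> left_kernel)"
    using contra[OF sub1 proper1 m(1)] contra[OF sub2 proper2 m(2)] contra[OF sub3 proper3 m(3)]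
      contra[OF sub4 proper4 m(4)] cover r by blast
  then show ?thesis using scal[OF rj] by blast
qed

lemma op_kernels:
  "four_cover_core.left_kernel (op_ring R) A1 A2 A3 A4 = right_kernel"
  "four_cover_core.right_kernel (op_ring R) A1 A2 A3 A4 = left_kernel"
  using four_cover_core.left_kernel_def[OF core_op] four_cover_core.right_kernel_def[OF core_op]
  by (simp_all add: left_kernel_def right_kernel_def)

text \<open>\<open>left_kernel\<close> absorbs right factors and \<open>right_kernel\<close> absorbs
  left factors directly from associativity. On their intersection the other two absorptions come
  from \<open>kernel_aux\<close> and its mirror, so it is an ideal inside \<open>meet\<close> and
  \<open>core\<close> makes it zero.\<close>

lemma kernels_trivial:
  assumes left: "\<And>d. d \<in> meet \<Longrightarrow> d \<in> left_kernel \<or> d \<ominus> \<one> \<in> left_kernel \<or> d \<oplus> \<one> \<in> left_kernel"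
    and right: "\<And>d. d \<in> meet \<Longrightarrow> d \<in> right_kernel \<or> d \<ominus> \<one> \<in> right_kernel \<or> d \<oplus> \<one> \<in> right_kernel"
  shows "left_kernel \<inter> right_kernel = {\<zero>}"
proof (rule core)
  show "left_kernel \<inter> right_kernel \<subseteq> A1 \<inter> A2 \<inter> A3 \<inter> A4" by (auto simp: left_kernel_def meet_def)
  have l1: "r \<otimes> j \<in> left_kernel" if "j \<in> left_kernel" "j \<in> right_kernel" "r \<in> carrier R" for j r
    by (rule kernel_aux[OF left that])
  have r1: "j \<otimes> r \<in> right_kernel" if "j \<in> left_kernel" "j \<in> right_kernel" "r \<in> carrier R" for j r
    using four_cover_core.kernel_aux[OF core_op, unfolded op_kernels op_ring_simps, OF right that(2,1,3)] .
  have mc: "d \<in> carrier R" if "d \<in> meet" for d using meet_rules(1) that .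
  have l2: "j \<otimes> r \<in> left_kernel" if "j \<in> left_kernel" "r \<in> carrier R" for j r
    using that mc by (auto simp: left_kernel_def m_assoc)
  have r2: "r \<otimes> j \<in> right_kernel" if "j \<in> right_kernel" "r \<in> carrier R" for j r
    using that mc by (auto simp: right_kernel_def m_assoc[symmetric])
  have sub: "nonunital_subring (left_kernel \<inter> right_kernel) R"
  proof (rule nonunital_subringI)
    show "left_kernel \<inter> right_kernel \<subseteq> carrier R" using mc by (auto simp: left_kernel_def)
    show "\<zero> \<in> left_kernel \<inter> right_kernel"
      using meet_rules(2) by (simp add: left_kernel_def right_kernel_def)
    fix x y assume xy: "x \<in> left_kernel \<inter> right_kernel" "y \<in> left_kernel \<inter> right_kernel"
    then have c: "x \<in> carrier R" "y \<in> carrier R" using mc by (auto simp: left_kernel_def)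
    show "x \<ominus> y \<in> left_kernel \<inter> right_kernel"
      using xy c meet_rules(5)
      by (auto simp: left_kernel_def right_kernel_def minus_eq l_distr r_distr l_minus r_minus)
    show "x \<otimes> y \<in> left_kernel \<inter> right_kernel" using xy c l2 r2 by blast
  qed
  show "ideal (left_kernel \<inter> right_kernel) R"
    by (rule idealI[OF ring_axioms])
      (use sub l1 l2 r1 r2 in \<open>auto simp: nonunital_subring_def additive_subgroup_def\<close>)
qed

end

section \<open>The case of index three\<close>

text \<open>The image of \<open>g\<close> is a unital subring complementing the ideal W, so
  projecting R onto it along W is a homomorphism; \<open>c\<close> is this projection in
  coordinates.\<close>

lemma (in ring) surjects_ontoI:
  fixes g :: "'v::ab_group_add \<Rightarrow> 'a"
  assumes W: "ideal W R"
    and g: "\<And>p. g p \<in> carrier R" "\<And>p q. g (p + q) = g p \<oplus> g q" "\<And>p q. g (m p q) = g p \<otimes> g q" "g u = \<one>"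
    and span: "\<And>r. r \<in> carrier R \<Longrightarrow> \<exists>p. r \<ominus> g p \<in> W"
    and indep: "\<And>p. g p \<in> W \<Longrightarrow> p = 0"
  shows "surjects_onto R m u"
proof -
  interpret W: ideal W R by (rule W)
  have Wm: "x \<ominus> y \<in> W" if "x \<in> W" "y \<in> W" for x y
    using that by (simp add: minus_eq W.a_closed W.a_inv_closed)
  have g0: "g 0 = \<zero>" using g(2)[of 0 0] g(1)[of 0] by simp
  have gm: "g (p - q) = g p \<ominus> g q" for p q
  proof -
    have "g p = g (p - q) \<oplus> g q" using g(2)[of "p - q" q] by simp
    then show ?thesis using g(1)[of "p - q"] g(1)[of q] by (simp add: minus_eq a_assoc r_neg)
  qed
  have uniq: "p = q" if "r \<in> carrier R" "r \<ominus> g p \<in> W" "r \<ominus> g q \<in> W" for r p q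
  proof -
    have "(r \<ominus> g q) \<ominus> (r \<ominus> g p) \<in> W" using Wm that by blast
    moreover have "(r \<ominus> g q) \<ominus> (r \<ominus> g p) = g p \<ominus> g q" using that(1) g(1)[of p] g(1)[of q] by algebra
    ultimately have "g (p - q) \<in> W" by (simp add: gm)
    then show ?thesis using indep by fastforce
  qed
  define c where "c r = (SOME p. r \<ominus> g p \<in> W)" for r
  have c: "r \<ominus> g (c r) \<in> W" if "r \<in> carrier R" for r
    unfolding c_def using span[OF that] by (rule someI_ex)
  have ceq: "c r = p" if "r \<in> carrier R" "r \<ominus> g p \<in> W" for r p
    using uniq[OF that(1) c[OF that(1)] that(2)] .
  have cg: "c (g p) = p" for p
    using g(1)[of p] W.zero_closed by (intro ceq) (simp_all add: minus_eq r_neg)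
  show ?thesis unfolding surjects_onto_def
  proof (intro exI[of _ c] conjI ballI)
    fix x y assume xy: "x \<in> carrier R" "y \<in> carrier R"
    have gc: "g (c x) \<in> carrier R" "g (c y) \<in> carrier R" using g(1) by blast+
    have "(x \<ominus> g (c x)) \<oplus> (y \<ominus> g (c y)) \<in> W" using W.a_closed c xy by blast
    moreover have "(x \<ominus> g (c x)) \<oplus> (y \<ominus> g (c y)) = (x \<oplus> y) \<ominus> (g (c x) \<oplus> g (c y))" using xy gc by algebra
    ultimately have "(x \<oplus> y) \<ominus> g (c x + c y) \<in> W" using g(2) by simp
    then show "c (x \<oplus> y) = c x + c y" using xy by (intro ceq) simp_all
    have "(x \<ominus> g (c x)) \<otimes> y \<oplus> g (c x) \<otimes> (y \<ominus> g (c y)) \<in> W"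
      using c[OF xy(1)] c[OF xy(2)] xy gc by (intro W.a_closed W.I_r_closed W.I_l_closed)
    moreover have "(x \<ominus> g (c x)) \<otimes> y \<oplus> g (c x) \<otimes> (y \<ominus> g (c y)) = x \<otimes> y \<ominus> g (c x) \<otimes> g (c y)"
      using xy gc by algebra
    ultimately have "x \<otimes> y \<ominus> g (m (c x) (c y)) \<in> W" using g(3) by simp
    then show "c (x \<otimes> y) = m (c x) (c y)" using xy by (intro ceq) simp_all
  next
    show "c \<one> = u" using cg[of u] g(4) by simp
    show "c ` carrier R = UNIV" using cg g(1) by (metis UNIV_eq_I imageI)
  qed
qed

section \<open>Scalars from the field with three elements\<close>

context ring
begin

text \<open>The scalar 2 acts as -1. Defined by cases, so it makes sense in any ring; additivity in
  the scalar is what requires characteristic 3.\<close>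

definition sc :: "3 \<Rightarrow> 'a \<Rightarrow> 'a" where
  "sc k x = (if k = 0 then \<zero> else if k = 1 then x else \<ominus> x)"

lemma sc_simps [simp]: "sc 0 x = \<zero>" "sc 1 x = x" "sc 2 x = \<ominus> x" "sc 3 x = \<zero>" "sc 4 x = x"
  by (simp_all add: sc_def)

lemma sc_closed [simp]: "x \<in> carrier R \<Longrightarrow> sc k x \<in> carrier R"
  by (simp add: sc_def)

lemma sc_zero [simp]: "sc k \<zero> = \<zero>"
  by (simp add: sc_def)

lemma sc_add_right: "x \<in> carrier R \<Longrightarrow> y \<in> carrier R \<Longrightarrow> sc k (x \<oplus> y) = sc k x \<oplus> sc k y"
  by (simp add: sc_def minus_add)

lemma sc_sc: "x \<in> carrier R \<Longrightarrow> sc k (sc l x) = sc (k * l) x"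
  by (rule F3_cases[of k]; rule F3_cases[of l]) simp_all

lemma sc_mult_left: "x \<in> carrier R \<Longrightarrow> y \<in> carrier R \<Longrightarrow> sc k x \<otimes> y = sc k (x \<otimes> y)"
  by (simp add: sc_def l_minus)

lemma sc_mult_right: "x \<in> carrier R \<Longrightarrow> y \<in> carrier R \<Longrightarrow> x \<otimes> sc k y = sc k (x \<otimes> y)"
  by (simp add: sc_def r_minus)

lemma sc_neg: "x \<in> carrier R \<Longrightarrow> \<ominus> sc k x = sc (2 * k) x"
  by (rule F3_cases[of k]) simp_all

lemma sc_minus: "x \<in> carrier R \<Longrightarrow> sc k (\<ominus> x) = sc (2 * k) x"
  by (rule F3_cases[of k]) simp_all

lemma sc_mem_iff:
  assumes "nonunital_subring S R" "x \<in> carrier R" "k \<noteq> 0"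
  shows "sc k x \<in> S \<longleftrightarrow> x \<in> S"
  using assms by (simp add: sc_def nonunital_subring_neg_iff)

lemma sc_mem: "nonunital_subring S R \<Longrightarrow> x \<in> S \<Longrightarrow> sc k x \<in> S"
  using nonunital_subringD[of S] by (simp add: sc_def)

end

lemma F3_square: "(k::3) \<noteq> 0 \<Longrightarrow> k * k = 1"
  by (rule F3_cases[of k]) simp_all

locale ring_char_3 = ring R for R (structure) +
  assumes three: "x \<in> carrier R \<Longrightarrow> x \<oplus> x \<oplus> x = \<zero>"
begin

lemma double: "x \<in> carrier R \<Longrightarrow> x \<oplus> x = \<ominus> x"
  using three[of x] by (metis add.m_closed minus_equality)

lemma sc_add_left: "x \<in> carrier R \<Longrightarrow> sc (k + l) x = sc k x \<oplus> sc l x"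
  by (rule F3_cases[of k]; rule F3_cases[of l])
    (simp_all add: double r_neg l_neg)

text \<open>e, S and 1 - e play the matrix units E11, E12 and E22. The relation S S = 0 follows by
  inserting e between the factors.\<close>

lemma surjects_onto_T2:
  assumes W: "ideal W R"
    and e: "e \<in> carrier R" "e \<otimes> e = e" and S: "S \<in> carrier R" "e \<otimes> S = S" "S \<otimes> e = \<zero>"
    and span: "\<And>r. r \<in> carrier R \<Longrightarrow> \<exists>x y z. r \<ominus> (sc x e \<oplus> sc y S \<oplus> sc z (\<one> \<ominus> e)) \<in> W"
    and indep: "\<And>x y z. sc x e \<oplus> sc y S \<oplus> sc z (\<one> \<ominus> e) \<in> W \<Longrightarrow> x = 0 \<and> y = 0 \<and> z = 0"
  shows "surjects_onto R mult_T2 (1, 0, 1)"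
proof -
  define f where "f = \<one> \<ominus> e"
  have f: "f \<in> carrier R" "e \<otimes> f = \<zero>" "f \<otimes> e = \<zero>" "f \<otimes> f = f" "S \<otimes> f = S" "f \<otimes> S = \<zero>"
    using e S by (simp_all add: f_def minus_eq l_distr r_distr l_minus r_minus r_neg)
  have SS: "S \<otimes> S = \<zero>"
  proof -
    have "S \<otimes> S = S \<otimes> (e \<otimes> S)" using S by simp
    also have "\<dots> = (S \<otimes> e) \<otimes> S" using S(1) e(1) by (simp only: m_assoc)
    finally show ?thesis using S by simp
  qed
  define g where "g = (\<lambda>(x, y, z). sc x e \<oplus> sc y S \<oplus> sc z f)"
  show ?thesis
  proof (rule surjects_ontoI[OF W, where g = g])
    fix p q :: "3 \<times> 3 \<times> 3"
    obtain x y z where p: "p = (x, y, z)" by (metis surj_pair)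
    obtain x' y' z' where q: "q = (x', y', z')" by (metis surj_pair)
    show "g p \<in> carrier R" using e S f by (simp add: g_def p)
    show "g (p + q) = g p \<oplus> g q" using e S f by (simp add: g_def p q sc_add_left a_ac)
    show "g (mult_T2 p q) = g p \<otimes> g q"
      using e S f SS
      by (simp add: g_def p q mult_T2_def sc_add_left l_distr r_distr sc_mult_left sc_mult_right sc_sc sc_add_right mult_ac a_ac)
    show "p = 0" if "g p \<in> W" using indep that by (simp add: g_def p f_def zero_prod_def)
  next
    have "e \<oplus> (\<one> \<ominus> e) = \<one>" using e by algebra
    then show "g (1, 0, 1) = \<one>" using e by (simp add: g_def f_def)
  next
    fix r assume "r \<in> carrier R"
    then obtain x y z where "r \<ominus> (sc x e \<oplus> sc y S \<oplus> sc z (\<one> \<ominus> e)) \<in> W" using span by blast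
    then have "r \<ominus> g (x, y, z) \<in> W" by (simp add: g_def f_def)
    then show "\<exists>p. r \<ominus> g p \<in> W" by blast
  qed
qed

text \<open>u plays diag(1, -1) and n plays E12.\<close>

lemma surjects_onto_T2_involution:
  assumes u: "u \<in> carrier R" "u \<otimes> u = \<one>" "u \<noteq> \<one>" "u \<noteq> \<ominus> \<one>"
    and n: "n \<in> carrier R" "u \<otimes> n = n" "n \<otimes> u = \<ominus> n" "n \<noteq> \<zero>"
    and span: "\<And>r. r \<in> carrier R \<Longrightarrow> \<exists>x y z. r = sc x \<one> \<oplus> sc y u \<oplus> sc z n"
  shows "surjects_onto R mult_T2 (1, 0, 1)"
proof -
  \<comment> \<open>The projection (1 + u) / 2 onto the eigenvalue 1; in characteristic 3 the
    inverse of 2 is -1.\<close>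
  define e where "e = \<ominus> (\<one> \<oplus> u)"
  have ec: "e \<in> carrier R" using u by (simp add: e_def)
  have ee: "e \<otimes> e = e"
  proof -
    have "(\<one> \<oplus> u) \<otimes> (\<one> \<oplus> u) = (\<one> \<oplus> u) \<oplus> (\<one> \<oplus> u)" using u by (simp add: l_distr r_distr a_ac)
    also have "\<dots> = e" using u double[of "\<one> \<oplus> u"] by (simp add: e_def)
    finally show ?thesis using u by (simp add: e_def l_minus r_minus)
  qed
  have en: "e \<otimes> n = n"
    using u n double[of n] by (simp add: e_def l_minus l_distr)
  have ne: "n \<otimes> e = \<zero>"
    using u n by (simp add: e_def r_minus r_distr r_neg)
  have f: "\<one> \<ominus> e = u \<ominus> \<one>"
  proof -
    have "\<one> \<ominus> e = (\<one> \<oplus> \<one>) \<oplus> u" using u by (simp add: e_def minus_eq a_assoc)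
    then show ?thesis using u double[of \<one>] by (simp add: minus_eq a_comm)
  qed
  have e0: "e \<noteq> \<zero>"
  proof
    assume "e = \<zero>"
    then have "\<one> \<oplus> u = \<zero>" using u by (simp add: e_def)
    then show False using u by (metis minus_equality a_comm one_closed)
  qed
  have f0: "\<one> \<ominus> e \<noteq> \<zero>"
    unfolding f using u by (metis r_right_minus_eq one_closed)
  have fc: "\<one> \<ominus> e \<in> carrier R" using ec by simp
  have fe: "(\<one> \<ominus> e) \<otimes> e = \<zero>" "e \<otimes> (\<one> \<ominus> e) = \<zero>" "(\<one> \<ominus> e) \<otimes> (\<one> \<ominus> e) = \<one> \<ominus> e"
    "n \<otimes> (\<one> \<ominus> e) = n" "(\<one> \<ominus> e) \<otimes> n = \<zero>"
    using ec ee en ne n by (simp_all add: minus_eq l_distr r_distr l_minus r_minus r_neg)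
  have one: "\<one> = e \<oplus> (\<one> \<ominus> e)" using ec one_closed by algebra
  have ue: "u = e \<oplus> \<ominus> (\<one> \<ominus> e)"
  proof -
    have "e \<oplus> \<ominus> (\<one> \<ominus> e) = \<ominus> (u \<oplus> u)"
      unfolding f unfolding e_def using u(1) one_closed by algebra
    then show ?thesis using u double[of u] by simp
  qed
  show ?thesis
  proof (rule surjects_onto_T2[OF zeroideal ec ee n(1) en ne])
    fix r assume "r \<in> carrier R"
    then obtain x y z where r: "r = sc x \<one> \<oplus> sc y u \<oplus> sc z n" using span by blast
    have "r = sc (x + y) e \<oplus> sc z n \<oplus> sc (x + 2 * y) (\<one> \<ominus> e)"
    proof -
      have a: "sc x \<one> = sc x e \<oplus> sc x (\<one> \<ominus> e)" by (subst one) (rule sc_add_right[OF ec fc])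
      have b: "sc y u = sc y e \<oplus> sc (2 * y) (\<one> \<ominus> e)"
        by (subst ue) (use ec fc in \<open>simp add: sc_add_right sc_minus\<close>)
      show ?thesis unfolding r a b using ec fc n by (simp add: sc_add_left a_ac)
    qed
    moreover have "sc (x + y) e \<oplus> sc z n \<oplus> sc (x + 2 * y) (\<one> \<ominus> e) \<in> carrier R" using ec fc n by simp
    ultimately have "r \<ominus> (sc (x + y) e \<oplus> sc z n \<oplus> sc (x + 2 * y) (\<one> \<ominus> e)) \<in> {\<zero>}"
      by (simp add: minus_eq r_neg)
    then show "\<exists>x y z. r \<ominus> (sc x e \<oplus> sc y n \<oplus> sc z (\<one> \<ominus> e)) \<in> {\<zero>}" by blast
  next
    fix x y z assume "sc x e \<oplus> sc y n \<oplus> sc z (\<one> \<ominus> e) \<in> {\<zero>}"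
    then have eq: "sc x e \<oplus> sc y n \<oplus> sc z (\<one> \<ominus> e) = \<zero>" by simp
    have nz: "k = 0" if "sc k a = \<zero>" "a \<in> carrier R" "a \<noteq> \<zero>" for k a
      using that by (rule_tac F3_cases[of k]) (simp_all)
    \<comment> \<open>Multiplying by e, or by 1 - e, on both sides isolates one coefficient.\<close>
    have "e \<otimes> (sc x e \<oplus> sc y n \<oplus> sc z (\<one> \<ominus> e)) \<otimes> e = sc x e"
      using ec fc n ee en ne fe by (simp add: l_distr r_distr sc_mult_left sc_mult_right)
    then have "sc x e = \<zero>" unfolding eq using ec by simp
    then have x: "x = 0" using nz ec e0 by blast
    have "(\<one> \<ominus> e) \<otimes> (sc x e \<oplus> sc y n \<oplus> sc z (\<one> \<ominus> e)) \<otimes> (\<one> \<ominus> e) = sc z (\<one> \<ominus> e)"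
      using ec fc n ee en ne fe by (simp add: l_distr r_distr sc_mult_left sc_mult_right)
    then have "sc z (\<one> \<ominus> e) = \<zero>" unfolding eq using fc by simp
    then have z: "z = 0" using nz fc f0 by blast
    have "sc y n = \<zero>" using eq n by (simp add: x z)
    then show "x = 0 \<and> y = 0 \<and> z = 0" using nz n x z by blast
  qed
qed

end

lemma (in ring) add_diff_cancel:
  "x \<in> carrier R \<Longrightarrow> y \<in> carrier R \<Longrightarrow> (x \<oplus> y) \<ominus> y = x"
  by (simp add: minus_eq a_assoc r_neg)

section \<open>Multiplication tables in characteristic three\<close>

locale four_cover_core_I = four_cover_core + four_cover_I
begin

lemma I_op: "four_cover_I (op_ring R) A1 A2 A3 A4"
  by (intro four_cover_I.intro four_cover_op four_cover_I_axioms.intro) (fact meets)+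

lemma core_I_op: "four_cover_core_I (op_ring R) A1 A2 A3 A4"
  by (intro four_cover_core_I.intro core_op I_op)

lemma meetI: "x \<in> A1 \<Longrightarrow> x \<in> A2 \<Longrightarrow> x \<in> meet"
  unfolding meet_def using meets(1) meet4 by blast

lemma meetD: "x \<in> meet \<Longrightarrow> x \<in> A1" "x \<in> meet \<Longrightarrow> x \<in> A2" "x \<in> meet \<Longrightarrow> x \<in> A3" "x \<in> meet \<Longrightarrow> x \<in> A4"
  unfolding meet_def by blast+

lemma ex_basis:
  obtains s t where "s \<in> A1" "s \<notin> A2" "t \<in> A2" "t \<notin> A1" "s \<oplus> t \<in> A3"
proof -
  obtain s where s: "s \<in> A1" "s \<notin> A2" by (rule ex_12)
  obtain t where t: "t \<in> A2" "t \<notin> A1" by (rule four_cover_I.ex_12[OF perm12_I])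
  have c: "t \<in> carrier R" using t in_carrier by blast
  from sum_diff[OF s t] show ?thesis
  proof
    assume "s \<oplus> t \<in> A3 \<and> s \<ominus> t \<in> A4"
    then show ?thesis using that s t by blast
  next
    assume "s \<oplus> t \<in> A4 \<and> s \<ominus> t \<in> A3"
    then have "s \<oplus> \<ominus> t \<in> A3" by (simp add: minus_eq)
    then show ?thesis using that[of s "\<ominus> t"] s t c by simp
  qed
qed

text \<open>A linear map of the plane preserving the lines of s, t and s + t is a scalar, so it
  vanishes once it kills s. Concretely, d (s + t) in A3 gives d t in A2 and A3, and
  \<open>generated\<close> extends this to R.\<close>

lemma left_kernelI:
  assumes d: "d \<in> meet" and s: "s \<in> A1" "s \<notin> A2" and t: "t \<in> A2" "t \<notin> A1" and st: "s \<oplus> t \<in> A3"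
    and ds: "d \<otimes> s \<in> A2"
  shows "d \<in> left_kernel"
proof -
  have dc: "d \<in> carrier R" using meet_rules(1) d .
  have c: "s \<in> carrier R" "t \<in> carrier R" using s t in_carrier by blast+
  have "d \<otimes> s \<in> A1" using meetD(1)[OF d] s sub_rules(6) by blast
  then have dsm: "d \<otimes> s \<in> meet" using ds meetI by blast
  have "d \<otimes> (s \<oplus> t) \<in> A3" using meetD(3)[OF d] st sub_rules(18) by blast
  then have "d \<otimes> s \<oplus> d \<otimes> t \<in> A3" using dc c by (simp add: r_distr)
  then have "d \<otimes> t \<in> A3" using meetD(3)[OF dsm] dc c by simp
  moreover have "d \<otimes> t \<in> A2" using meetD(2)[OF d] t sub_rules(12) by blast
  ultimately have dtm: "d \<otimes> t \<in> meet" using meets(4) meetI by blast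
  define T where "T = {r \<in> carrier R. d \<otimes> r \<in> meet}"
  have "r \<in> T" if "r \<in> carrier R" for r
  proof (rule generated[OF s t that])
    show "x \<in> T" if "x \<in> A1" "x \<in> A2" for x
      using meet_rules(6)[OF d meetI[OF that]] in_carrier(1)[OF that(1)] by (simp add: T_def)
    show "s \<in> T" "t \<in> T" using dsm dtm c by (simp_all add: T_def)
    show "x \<oplus> y \<in> T" "x \<ominus> y \<in> T" if "x \<in> T" "y \<in> T" for x y
      using that dc meet_rules(3)[of "d \<otimes> x" "d \<otimes> y"] meet_rules(5)[of "d \<otimes> x" "d \<otimes> y"]
      by (simp_all add: T_def r_distr minus_eq r_minus)
  qed
  then show ?thesis using d by (simp add: left_kernel_def T_def)
qed

text \<open>By \<open>cosets\<close>, d s is 0, s or -s modulo the intersection; subtract the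
  corresponding scalar from d.\<close>

lemma left_scalar: "d \<in> meet \<Longrightarrow> d \<in> left_kernel \<or> d \<ominus> \<one> \<in> left_kernel \<or> d \<oplus> \<one> \<in> left_kernel"
proof -
  assume d: "d \<in> meet"
  obtain s t where s: "s \<in> A1" "s \<notin> A2" and t: "t \<in> A2" "t \<notin> A1" and st: "s \<oplus> t \<in> A3" by (rule ex_basis)
  have dc: "d \<in> carrier R" using meet_rules(1) d .
  have c: "s \<in> carrier R" using s in_carrier by blast
  have m: "d \<ominus> \<one> \<in> meet" "d \<oplus> \<one> \<in> meet" using meet_rules(3,5) d meet_one by blast+
  have ds: "d \<otimes> s \<in> A1" using meetD(1)[OF d] s sub_rules(6) by blast
  have "d \<otimes> s \<in> A2 \<or> (d \<otimes> s) \<ominus> s \<in> A2 \<or> (d \<otimes> s) \<oplus> s \<in> A2" using cosets[OF s ds] by blast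
  moreover have "(d \<otimes> s) \<ominus> s = (d \<ominus> \<one>) \<otimes> s" "(d \<otimes> s) \<oplus> s = (d \<oplus> \<one>) \<otimes> s"
    using dc c by (simp_all add: minus_eq l_distr l_minus)
  ultimately show ?thesis
    using left_kernelI[OF d s t st] left_kernelI[OF m(1) s t st] left_kernelI[OF m(2) s t st] by auto
qed

lemma right_scalar: "d \<in> meet \<Longrightarrow> d \<in> right_kernel \<or> d \<ominus> \<one> \<in> right_kernel \<or> d \<oplus> \<one> \<in> right_kernel"
  using four_cover_core_I.left_scalar[OF core_I_op, unfolded op_kernels op_ring_simps] .

lemma kernels_meet_trivial: "left_kernel \<inter> right_kernel = {\<zero>}"
  by (rule kernels_trivial[OF left_scalar right_scalar])

text \<open>By \<open>triple\<close>, the element 3 of R multiplies everything into the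
  intersection, so it lies in both kernels.\<close>

lemma char_3: "x \<in> carrier R \<Longrightarrow> x \<oplus> x \<oplus> x = \<zero>"
proof -
  assume x: "x \<in> carrier R"
  have tr: "r \<oplus> r \<oplus> r \<in> meet" if "r \<in> carrier R" for r using triple[OF that] by (simp add: meet_def)
  have e: "(\<one> \<oplus> \<one> \<oplus> \<one>) \<otimes> r = r \<oplus> r \<oplus> r" "r \<otimes> (\<one> \<oplus> \<one> \<oplus> \<one>) = r \<oplus> r \<oplus> r"
    if "r \<in> carrier R" for r using that by (simp_all add: l_distr r_distr)
  have "\<one> \<oplus> \<one> \<oplus> \<one> \<in> left_kernel \<inter> right_kernel"
    using tr e by (simp add: left_kernel_def right_kernel_def)
  then have "\<one> \<oplus> \<one> \<oplus> \<one> = \<zero>" using kernels_meet_trivial by blast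
  then show ?thesis using e(1)[OF x] x by simp
qed

sublocale c3: ring_char_3 R
  by unfold_locales (rule char_3)

lemma independent:
  assumes s: "s \<in> A1" "s \<notin> A2" and t: "t \<in> A2" "t \<notin> A1" and m: "sc y s \<oplus> sc w t \<in> meet"
  shows "y = 0" "w = 0"
proof -
  have c: "s \<in> carrier R" "t \<in> carrier R" using s t in_carrier by blast+
  have "sc y s \<in> A1" "sc w t \<in> A2" using sc_mem[OF sub1 s(1)] sc_mem[OF sub2 t(1)] by blast+
  then have "sc w t \<in> A1" "sc y s \<in> A2" using meetD(1,2)[OF m] c by simp_all
  then show "y = 0" "w = 0" using sc_mem_iff[OF sub1 c(2), of w] sc_mem_iff[OF sub2 c(1), of y] s t by blast+
qed

lemma spanned:
  assumes s: "s \<in> A1" "s \<notin> A2" and t: "t \<in> A2" "t \<notin> A1" and r: "r \<in> carrier R"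
  shows "\<exists>d\<in>meet. \<exists>y w. r = d \<oplus> sc y s \<oplus> sc w t"
proof -
  have c: "s \<in> carrier R" "t \<in> carrier R" using s t in_carrier by blast+
  define T where "T = {r. \<exists>d\<in>meet. \<exists>y w. r = d \<oplus> sc y s \<oplus> sc w t}"
  have TI: "d \<oplus> sc y s \<oplus> sc w t \<in> T" if "d \<in> meet" for d y w using that unfolding T_def by blast
  have add: "x \<oplus> y \<in> T" if xy: "x \<in> T" "y \<in> T" for x y
  proof -
    obtain d a b where x: "d \<in> meet" "x = d \<oplus> sc a s \<oplus> sc b t" using xy(1) unfolding T_def by blast
    obtain d' a' b' where y: "d' \<in> meet" "y = d' \<oplus> sc a' s \<oplus> sc b' t" using xy(2) unfolding T_def by blast
    have dc: "d \<in> carrier R" "d' \<in> carrier R" using x y meet_rules(1) by blast+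
    have "x \<oplus> y = (d \<oplus> d') \<oplus> sc (a + a') s \<oplus> sc (b + b') t"
      using c dc by (simp add: x(2) y(2) c3.sc_add_left a_ac)
    then show ?thesis using TI[OF meet_rules(3)[OF x(1) y(1)]] by simp
  qed
  have neg: "\<ominus> x \<in> T" if x': "x \<in> T" for x
  proof -
    obtain d a b where x: "d \<in> meet" "x = d \<oplus> sc a s \<oplus> sc b t" using x' unfolding T_def by blast
    have dc: "d \<in> carrier R" using x meet_rules(1) by blast
    have "\<ominus> x = \<ominus> d \<oplus> sc (2 * a) s \<oplus> sc (2 * b) t"
      using c dc by (simp add: x(2) minus_add sc_neg)
    then show ?thesis using TI[OF meet_rules(4)[OF x(1)]] by simp
  qed
  have "r \<in> T"
  proof (rule generated[OF s t r])
    show "x \<in> T" if "x \<in> A1" "x \<in> A2" for x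
      using TI[OF meetI[OF that], of 0 0] in_carrier(1)[OF that(1)] by simp
    show "s \<in> T" "t \<in> T" using TI[OF meet_rules(2), of 1 0] TI[OF meet_rules(2), of 0 1] c by simp_all
    show "x \<oplus> y \<in> T" "x \<ominus> y \<in> T" if "x \<in> T" "y \<in> T" for x y
      using add neg that by (simp_all add: minus_eq)
  qed
  then show ?thesis unfolding T_def by blast
qed

lemma one_neq_zero: "\<one> \<noteq> \<zero>"
proof
  assume "\<one> = \<zero>"
  then have "x = \<zero>" if "x \<in> carrier R" for x using l_one[OF that] l_null[OF that] by simp
  then show False using sub_rules(2) in_carrier(1) proper1 by blast
qed

lemma left_kernel_subring: "nonunital_subring left_kernel R"
proof (rule nonunital_subringI)
  show "left_kernel \<subseteq> carrier R" using meet_rules(1) by (auto simp: left_kernel_def)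
  show "\<zero> \<in> left_kernel" using meet_rules(2) by (simp add: left_kernel_def)
  fix x y assume x: "x \<in> left_kernel" and y: "y \<in> left_kernel"
  have m: "x \<in> meet" "y \<in> meet" using x y by (simp_all add: left_kernel_def)
  have c: "x \<in> carrier R" "y \<in> carrier R" using m meet_rules(1) by blast+
  have l: "x \<otimes> r \<in> meet" "y \<otimes> r \<in> meet" if "r \<in> carrier R" for r
    using x y that by (simp_all add: left_kernel_def)
  have "(x \<ominus> y) \<otimes> r \<in> meet" if "r \<in> carrier R" for r
    using meet_rules(5)[OF l[OF that]] c that by (simp add: minus_eq l_distr l_minus)
  then show "x \<ominus> y \<in> left_kernel" using meet_rules(5)[OF m] by (simp add: left_kernel_def)
  have "(x \<otimes> y) \<otimes> r \<in> meet" if "r \<in> carrier R" for r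
    using l(1)[of "y \<otimes> r"] c that by (simp add: m_assoc)
  then show "x \<otimes> y \<in> left_kernel" using meet_rules(6)[OF m] by (simp add: left_kernel_def)
qed

lemma right_kernel_subring: "nonunital_subring right_kernel R"
  using four_cover_core_I.left_kernel_subring[OF core_I_op, unfolded op_kernels] by simp

lemma left_scalar_sc: "d \<in> meet \<Longrightarrow> \<exists>x. d \<ominus> sc x \<one> \<in> left_kernel"
proof -
  assume d: "d \<in> meet"
  have dc: "d \<in> carrier R" using meet_rules(1) d .
  have "d \<ominus> sc 0 \<one> = d" "d \<ominus> sc 1 \<one> = d \<ominus> \<one>" "d \<ominus> sc 2 \<one> = d \<oplus> \<one>"
    using dc by (simp_all add: minus_eq)
  then show ?thesis using left_scalar[OF d] by metis
qed

lemma right_scalar_sc: "d \<in> meet \<Longrightarrow> \<exists>x. d \<ominus> sc x \<one> \<in> right_kernel"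
proof -
  assume d: "d \<in> meet"
  have dc: "d \<in> carrier R" using meet_rules(1) d .
  have "d \<ominus> sc 0 \<one> = d" "d \<ominus> sc 1 \<one> = d \<ominus> \<one>" "d \<ominus> sc 2 \<one> = d \<oplus> \<one>"
    using dc by (simp_all add: minus_eq)
  then show ?thesis using right_scalar[OF d] by metis
qed

text \<open>The intersection is spanned by the orthogonal idempotents e and f = 1 - e; the two
  remaining directions can be moved into the corner e R f, where all products vanish. Dividing out
  one direction of the corner leaves the triangular matrices.\<close>

lemma T2_case:
  assumes e: "e \<in> right_kernel" "\<one> \<ominus> e \<in> left_kernel"
  shows "surjects_onto R mult_T2 (1, 0, 1)"
proof -
  define f where "f = \<one> \<ominus> e"
  obtain s t where s: "s \<in> A1" "s \<notin> A2" and t: "t \<in> A2" "t \<notin> A1" by (rule ex_basis)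
  have c: "s \<in> carrier R" "t \<in> carrier R" using s t in_carrier by blast+
  have em: "e \<in> meet" using e by (simp add: right_kernel_def)
  have ec: "e \<in> carrier R" using meet_rules(1) em .
  have fm: "f \<in> meet" using e by (simp add: left_kernel_def f_def)
  have fc: "f \<in> carrier R" using meet_rules(1) fm .
  have fker: "f \<in> left_kernel" using e(2) by (simp add: f_def)
  have fL: "f \<otimes> r \<in> meet" if "r \<in> carrier R" for r using e(2) that by (simp add: left_kernel_def f_def)
  have eK: "r \<otimes> e \<in> meet" if "r \<in> carrier R" for r using e(1) that by (simp add: right_kernel_def)
  \<comment> \<open>f r and r e lie in the intersection for every r, so (e f) r and r (e f) do too.
    Hence e f is in both kernels, and e is idempotent.\<close>
  have ef0: "e \<otimes> f \<in> left_kernel \<inter> right_kernel"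
  proof -
    have "e \<otimes> f \<otimes> r \<in> meet" if "r \<in> carrier R" for r
      using meet_rules(6)[OF em fL[OF that]] that ec fc by (simp add: m_assoc)
    moreover have "r \<otimes> (e \<otimes> f) \<in> meet" if "r \<in> carrier R" for r
      using meet_rules(6)[OF eK[OF that] fm] that ec fc by (simp add: m_assoc)
    ultimately show ?thesis using meet_rules(6)[OF em fm] by (simp add: left_kernel_def right_kernel_def)
  qed
  then have ef: "e \<otimes> f = \<zero>" using kernels_meet_trivial by blast
  then have "e \<ominus> e \<otimes> e = \<zero>" using ec by (simp add: f_def minus_eq r_distr r_minus)
  then have ee: "e \<otimes> e = e" using ec by (metis m_closed r_right_minus_eq)
  have fe: "f \<otimes> e = \<zero>" "f \<otimes> f = f"
    using ec ee by (simp_all add: f_def minus_eq l_distr r_distr l_minus r_minus r_neg)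
  have one: "e \<oplus> f = \<one>" unfolding f_def using ec one_closed by algebra
  \<comment> \<open>By \<open>shift\<close> and \<open>shm\<close>, e s f and e t f differ from s
    and t only by elements of the intersection, so they can replace s and t.\<close>
  define S T where "S = e \<otimes> s \<otimes> f" and "T = e \<otimes> t \<otimes> f"
  have Sc: "S \<in> carrier R" "T \<in> carrier R" using ec fc c by (simp_all add: S_def T_def)
  have shift: "e \<otimes> r \<otimes> f = r \<ominus> (r \<otimes> e \<oplus> (f \<otimes> r) \<otimes> f)" if "r \<in> carrier R" for r
  proof -
    have "r = r \<otimes> e \<oplus> r \<otimes> f" using r_distr[OF ec fc that] one that by simp
    moreover have "r \<otimes> f = (e \<otimes> r) \<otimes> f \<oplus> (f \<otimes> r) \<otimes> f"
      using l_distr[OF ec fc that] one that ec fc by (simp add: l_distr[symmetric])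
    ultimately have r: "r = r \<otimes> e \<oplus> ((e \<otimes> r) \<otimes> f \<oplus> (f \<otimes> r) \<otimes> f)" by simp
    have "(A \<oplus> (B \<oplus> C)) \<ominus> (A \<oplus> C) = B" if "A \<in> carrier R" "B \<in> carrier R" "C \<in> carrier R" for A B C
      using that a_lcomm[of A B C] add_diff_cancel[of B "A \<oplus> C"] by simp
    from this[of "r \<otimes> e" "(e \<otimes> r) \<otimes> f" "(f \<otimes> r) \<otimes> f"] show ?thesis
      unfolding r[symmetric] using that ec fc by simp
  qed
  have shm: "r \<otimes> e \<oplus> (f \<otimes> r) \<otimes> f \<in> meet" if "r \<in> carrier R" for r
    using meet_rules(3)[OF eK[OF that] meet_rules(6)[OF fL[OF that] fm]] .
  have S12: "S \<in> A1" "S \<notin> A2"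
    unfolding S_def shift[OF c(1)]
    using s c meetD(1)[OF shm[OF c(1)]] meetD(2)[OF shm[OF c(1)]] by simp_all
  have T12: "T \<in> A2" "T \<notin> A1"
    unfolding T_def shift[OF c(2)]
    using t c meetD(1)[OF shm[OF c(2)]] meetD(2)[OF shm[OF c(2)]] by simp_all
  have corner: "e \<otimes> (e \<otimes> r \<otimes> f) = e \<otimes> r \<otimes> f" "(e \<otimes> r \<otimes> f) \<otimes> e = \<zero>" "f \<otimes> (e \<otimes> r \<otimes> f) = \<zero>"
    "(e \<otimes> r \<otimes> f) \<otimes> f = e \<otimes> r \<otimes> f" if "r \<in> carrier R" for r
    using that ec fc ee fe by (simp_all add: m_assoc[symmetric]) (simp_all add: m_assoc fe)
  note cS = corner[OF c(1), folded S_def] and cT = corner[OF c(2), folded T_def]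
  have STz: "S \<otimes> T = \<zero>" "T \<otimes> S = \<zero>" "T \<otimes> T = \<zero>"
  proof -
    have "x \<otimes> y = \<zero>" if "x \<in> carrier R" "y \<in> carrier R" "x \<otimes> e = \<zero>" "e \<otimes> y = y" for x y
    proof -
      have "x \<otimes> y = x \<otimes> (e \<otimes> y)" using that by simp
      also have "\<dots> = (x \<otimes> e) \<otimes> y" by (rule m_assoc[OF that(1) ec that(2), symmetric])
      also have "\<dots> = \<zero>" unfolding that(3) using that(2) by simp
      finally show ?thesis .
    qed
    then show "S \<otimes> T = \<zero>" "T \<otimes> S = \<zero>" "T \<otimes> T = \<zero>" using Sc cS cT by blast+
  qed
  have span: "\<exists>x y z w. r = sc x e \<oplus> sc y S \<oplus> sc z f \<oplus> sc w T" if r: "r \<in> carrier R" for r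
  proof -
    obtain d y w where d: "d \<in> meet" "r = d \<oplus> sc y S \<oplus> sc w T" using spanned[OF S12 T12 r] by blast
    have dc: "d \<in> carrier R" using meet_rules(1)[OF d(1)] .
    obtain x where x: "d \<ominus> sc x \<one> \<in> left_kernel" using left_scalar_sc[OF d(1)] by blast
    obtain z where z: "d \<ominus> sc z \<one> \<in> right_kernel" using right_scalar_sc[OF d(1)] by blast
    \<comment> \<open>On R / meet, e acts as 1 from the left and 0 from the right, and f the other
      way round. With x and z the left and right scalars of d, the element q lies in both
      kernels.\<close>
    define q where "q = d \<ominus> (sc x e \<oplus> sc z f)"
    have o: "sc k \<one> = sc k e \<oplus> sc k f" for k using sc_add_right[OF ec fc] one by simp
    have alg: "d \<ominus> (a \<oplus> c) = (d \<ominus> (a \<oplus> b)) \<oplus> (b \<ominus> c)" "d \<ominus> (a \<oplus> c) = (d \<ominus> (b \<oplus> c)) \<oplus> (b \<ominus> a)"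
      if "a \<in> carrier R" "b \<in> carrier R" "c \<in> carrier R" for a b c
      using that dc by algebra+
    have "q = (d \<ominus> sc x \<one>) \<oplus> (sc x f \<ominus> sc z f)" unfolding q_def o by (rule alg(1)) (use ec fc in simp_all)
    then have qL: "q \<in> left_kernel"
      using x nonunital_subringD(3,5)[OF left_kernel_subring] sc_mem[OF left_kernel_subring fker] by simp
    have "q = (d \<ominus> sc z \<one>) \<oplus> (sc z e \<ominus> sc x e)" unfolding q_def o by (rule alg(2)) (use ec fc in simp_all)
    then have "q \<in> right_kernel"
      using z nonunital_subringD(3,5)[OF right_kernel_subring] sc_mem[OF right_kernel_subring e(1)] by simp
    then have "q = \<zero>" using qL kernels_meet_trivial by blast
    then have "d = sc x e \<oplus> sc z f" unfolding q_def using dc ec fc by (simp add: r_right_minus_eq)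
    then have "r = sc x e \<oplus> sc y S \<oplus> sc z f \<oplus> sc w T" using d(2) ec fc Sc by (simp add: a_ac)
    then show ?thesis by blast
  qed
  \<comment> \<open>Left multiplication of T by a spanned r only sees its e-coefficient, right
    multiplication only its f-coefficient, so the line through T is a two-sided ideal.\<close>
  define W where "W = range (\<lambda>w. sc w T)"
  have Wi: "sc w T \<in> W" for w by (simp add: W_def)
  have We: "\<exists>w. v = sc w T" if "v \<in> W" for v using that by (auto simp: W_def)
  have Wsub: "nonunital_subring W R"
  proof (rule nonunital_subringI)
    show "W \<subseteq> carrier R" using Sc by (auto simp: W_def)
    show "\<zero> \<in> W" using Wi[of 0] by simp
    fix v v' assume "v \<in> W" "v' \<in> W"
    then obtain k l where v: "v = sc k T" "v' = sc l T" using We by blast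
    have "v \<ominus> v' = sc (k + 2 * l) T" using Sc by (simp add: v minus_eq sc_neg c3.sc_add_left)
    then show "v \<ominus> v' \<in> W" using Wi by simp
    have "v \<otimes> v' = \<zero>" using Sc STz by (simp add: v sc_mult_left sc_mult_right)
    then show "v \<otimes> v' \<in> W" using Wi[of 0] by simp
  qed
  have W: "ideal W R"
  proof (rule idealI[OF ring_axioms])
    show "subgroup W (add_monoid R)" using Wsub by (simp add: nonunital_subring_def additive_subgroup_def)
    fix v r assume v: "v \<in> W" and r: "r \<in> carrier R"
    obtain k where k: "v = sc k T" using We[OF v] by blast
    obtain x y z w where r': "r = sc x e \<oplus> sc y S \<oplus> sc z f \<oplus> sc w T" using span[OF r] by blast
    have "r \<otimes> v = sc (k * x) T"
      using ec fc Sc STz cT cS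
      by (simp add: k r' l_distr sc_mult_left sc_mult_right sc_sc mult_ac)
    then show "r \<otimes> v \<in> W" using Wi by simp
    have "v \<otimes> r = sc (k * z) T"
      using ec fc Sc STz cT cS
      by (simp add: k r' r_distr sc_mult_left sc_mult_right sc_sc mult_ac)
    then show "v \<otimes> r \<in> W" using Wi by simp
  qed
  have e0: "e \<noteq> \<zero>"
  proof
    assume "e = \<zero>"
    then have "f = \<one>" using one fc by simp
    then show False using fL[OF c(1)] c(1) s meetD(2) by simp
  qed
  have f0: "f \<noteq> \<zero>"
  proof
    assume "f = \<zero>"
    then have "e = \<one>" using one ec by simp
    then show False using eK[OF c(1)] c(1) s meetD(2) by simp
  qed
  have nz: "k = 0" if "sc k a = \<zero>" "a \<in> carrier R" "a \<noteq> \<zero>" for k a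
    using that by (rule_tac F3_cases[of k]) (simp_all)
  show ?thesis
  proof (rule c3.surjects_onto_T2[OF W ec ee Sc(1) cS(1,2)])
    fix r assume "r \<in> carrier R"
    then obtain x y z w where r': "r = sc x e \<oplus> sc y S \<oplus> sc z f \<oplus> sc w T" using span by blast
    have "(p \<oplus> v) \<ominus> p = v" if "p \<in> carrier R" "v \<in> carrier R" for p v using that by algebra
    from this[of "sc x e \<oplus> sc y S \<oplus> sc z f" "sc w T"]
    have "r \<ominus> (sc x e \<oplus> sc y S \<oplus> sc z f) = sc w T" using r' ec fc Sc by simp
    then have "r \<ominus> (sc x e \<oplus> sc y S \<oplus> sc z f) \<in> W" using Wi by simp
    then show "\<exists>x y z. r \<ominus> (sc x e \<oplus> sc y S \<oplus> sc z (\<one> \<ominus> e)) \<in> W" unfolding f_def by blast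
  next
    fix x y z assume "sc x e \<oplus> sc y S \<oplus> sc z (\<one> \<ominus> e) \<in> W"
    then obtain w where w: "sc x e \<oplus> sc y S \<oplus> sc z f = sc w T" using We unfolding f_def by blast
    have "P \<oplus> \<ominus> V = \<ominus> (Q \<oplus> N)" if "Q \<oplus> P \<oplus> N = V" "P \<in> carrier R" "Q \<in> carrier R" "N \<in> carrier R" for P Q N V
    proof -
      have "V = P \<oplus> (Q \<oplus> N)" unfolding that(1)[symmetric] using that(2-4) by (simp add: a_ac)
      then show ?thesis using that(2-4) by (simp add: minus_add r_neg1 r_neg2)
    qed
    \<comment> \<open>Collecting the e- and f-parts on one side puts a combination of S and T into
      the intersection, where \<open>independent\<close> applies.\<close>
    from this[OF w] have "sc y S \<oplus> sc (2 * w) T = \<ominus> (sc x e \<oplus> sc z f)"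
      using ec fc Sc by (simp add: sc_neg)
    moreover have "\<ominus> (sc x e \<oplus> sc z f) \<in> meet"
      by (intro meet_rules(3,4) sc_mem[OF meet_subring] em fm)
    ultimately have "sc y S \<oplus> sc (2 * w) T \<in> meet" by simp
    from independent[OF S12 T12 this] have y: "y = 0" and "2 * w = 0" .
    then have "w = 0" by (rule_tac F3_cases[of w]) simp_all
    then have xz: "sc x e \<oplus> sc z f = \<zero>" using w y ec fc by simp
    have "e \<otimes> (sc x e \<oplus> sc z f) = sc x e" "f \<otimes> (sc x e \<oplus> sc z f) = sc z f"
      using ec fc ee ef fe by (simp_all add: r_distr sc_mult_right)
    note h = this[unfolded xz]
    have "sc x e = \<zero>" by (rule trans[OF h(1)[symmetric] r_null[OF ec]])
    moreover have "sc z f = \<zero>" by (rule trans[OF h(2)[symmetric] r_null[OF fc]])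
    ultimately show "x = 0 \<and> y = 0 \<and> z = 0" using nz ec fc e0 f0 y by blast
  qed
qed

text \<open>The intersection consists of the scalars, so R has basis 1, s, t over F_3 and
  associativity pins down the few possible tables.\<close>

lemma scalar_case:
  assumes L: "left_kernel = {\<zero>}"
  shows "surjects_onto R mult_T2 (1, 0, 1) \<or> surjects_onto R mult_F3xy (1, 0, 0)"
proof -
  have msc: "\<exists>x. d = sc x \<one>" if d: "d \<in> meet" for d
  proof -
    obtain x where "d \<ominus> sc x \<one> = \<zero>" using left_scalar_sc[OF d] L by blast
    then show ?thesis using meet_rules(1)[OF d] by (auto simp: r_right_minus_eq)
  qed
  have scm: "sc x \<one> \<in> meet" for x by (rule sc_mem[OF meet_subring meet_one])
  obtain s0 t0 where s0: "s0 \<in> A1" "s0 \<notin> A2" and t0: "t0 \<in> A2" "t0 \<notin> A1" by (rule ex_basis)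
  have c0: "s0 \<in> carrier R" "t0 \<in> carrier R" using s0 t0 in_carrier by blast+
  \<comment> \<open>Completing the square: if s^2 = a + b s, the linear part of (s + b)^2 is b s + 2
    b s = 0.\<close>
  have square: "\<exists>k. (s \<oplus> sc k \<one>) \<otimes> (s \<oplus> sc k \<one>) \<in> meet"
    if s: "s \<in> carrier R" "s \<otimes> s = sc a \<one> \<oplus> sc b s" for s a b
  proof -
    have "(s \<oplus> sc b \<one>) \<otimes> (s \<oplus> sc b \<one>) = sc a \<one> \<oplus> sc (b * b) \<one> \<oplus> (sc b s \<oplus> sc b s \<oplus> sc b s)"
      using s by (simp add: l_distr r_distr sc_mult_left sc_mult_right sc_add_right sc_sc a_ac)
    also have "\<dots> = sc a \<one> \<oplus> sc (b * b) \<one>" using char_3[of "sc b s"] s by simp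
    also have "\<dots> \<in> meet" by (intro meet_rules(3) scm)
    finally show ?thesis by blast
  qed
  have A1_form: "\<exists>a b. r = sc a \<one> \<oplus> sc b s0" if r: "r \<in> A1" for r
  proof -
    obtain d y w where d: "d \<in> meet" "r = d \<oplus> sc y s0 \<oplus> sc w t0"
      using spanned[OF s0 t0 in_carrier(1)[OF r]] by blast
    have "d \<oplus> sc y s0 \<in> A1" using meetD(1)[OF d(1)] sc_mem[OF sub1 s0(1)] sub_rules(3) by blast
    then have "sc w t0 \<in> A1" using r d(2) c0 by simp
    then have "w = 0" using sc_mem_iff[OF sub1 c0(2)] t0 by blast
    moreover obtain a where "d = sc a \<one>" using msc[OF d(1)] by blast
    ultimately show ?thesis using d(2) c0 by auto
  qed
  have A2_form: "\<exists>a b. r = sc a \<one> \<oplus> sc b t0" if r: "r \<in> A2" for r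
  proof -
    obtain d y w where d: "d \<in> meet" "r = d \<oplus> sc y s0 \<oplus> sc w t0"
      using spanned[OF s0 t0 in_carrier(2)[OF r]] by blast
    have dc: "d \<in> carrier R" using meet_rules(1)[OF d(1)] .
    have m: "d \<oplus> sc w t0 \<in> A2" using meetD(2)[OF d(1)] sc_mem[OF sub2 t0(1)] sub_rules(9) by blast
    have "r = (d \<oplus> sc w t0) \<oplus> sc y s0" using d(2) dc c0 by (simp add: a_ac)
    then have "sc y s0 \<in> A2" using m r c0 by simp
    then have "y = 0" using sc_mem_iff[OF sub2 c0(1)] s0 by blast
    moreover obtain a where "d = sc a \<one>" using msc[OF d(1)] by blast
    ultimately show ?thesis using d(2) c0 by auto
  qed
  obtain a1 b1 where "s0 \<otimes> s0 = sc a1 \<one> \<oplus> sc b1 s0" using A1_form[OF sub_rules(6)[OF s0(1) s0(1)]] by blast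
  then obtain k where k: "(s0 \<oplus> sc k \<one>) \<otimes> (s0 \<oplus> sc k \<one>) \<in> meet" using square[OF c0(1)] by blast
  obtain a2 b2 where "t0 \<otimes> t0 = sc a2 \<one> \<oplus> sc b2 t0" using A2_form[OF sub_rules(12)[OF t0(1) t0(1)]] by blast
  then obtain l where l: "(t0 \<oplus> sc l \<one>) \<otimes> (t0 \<oplus> sc l \<one>) \<in> meet" using square[OF c0(2)] by blast
  define s t where "s = s0 \<oplus> sc k \<one>" and "t = t0 \<oplus> sc l \<one>"
  have s: "s \<in> A1" "s \<notin> A2" and t: "t \<in> A2" "t \<notin> A1"
    using s0 t0 c0 meetD(1,2)[OF scm[of k]] meetD(1,2)[OF scm[of l]] by (simp_all add: s_def t_def)
  have c: "s \<in> carrier R" "t \<in> carrier R" using s t in_carrier by blast+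
  have ssm: "s \<otimes> s \<in> meet" and ttm: "t \<otimes> t \<in> meet" using k l by (simp_all add: s_def t_def)
  \<comment> \<open>The squares of s + t and s - t are s^2 + t^2 + v and s^2 + t^2 - v. One of s +
    t, s - t is in A3 and the other in A4, so v lies in both and is a scalar.\<close>
  define v where "v = s \<otimes> t \<oplus> t \<otimes> s"
  have vc: "v \<in> carrier R" using c by (simp add: v_def)
  have pq: "s \<otimes> s \<oplus> t \<otimes> t \<in> meet" using meet_rules(3)[OF ssm ttm] .
  have sq1: "(s \<oplus> t) \<otimes> (s \<oplus> t) = (s \<otimes> s \<oplus> t \<otimes> t) \<oplus> v"
    using c by (simp add: v_def l_distr r_distr a_ac)
  have sq2: "(s \<ominus> t) \<otimes> (s \<ominus> t) = (s \<otimes> s \<oplus> t \<otimes> t) \<oplus> \<ominus> v"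
    using c by (simp add: v_def minus_eq l_distr r_distr l_minus r_minus minus_add a_ac)
  have iff3: "v \<in> A3" if "x \<otimes> x = (s \<otimes> s \<oplus> t \<otimes> t) \<oplus> v \<or> x \<otimes> x = (s \<otimes> s \<oplus> t \<otimes> t) \<oplus> \<ominus> v" "x \<in> A3" for x
    using sub_rules(18)[OF that(2) that(2)] that(1) meetD(3)[OF pq] vc by auto
  have iff4: "v \<in> A4" if "x \<otimes> x = (s \<otimes> s \<oplus> t \<otimes> t) \<oplus> v \<or> x \<otimes> x = (s \<otimes> s \<oplus> t \<otimes> t) \<oplus> \<ominus> v" "x \<in> A4" for x
    using sub_rules(24)[OF that(2) that(2)] that(1) meetD(4)[OF pq] vc by auto
  have "v \<in> A3" "v \<in> A4"
    using sum_diff[OF s t] iff3[of "s \<oplus> t"] iff3[of "s \<ominus> t"] iff4[of "s \<oplus> t"] iff4[of "s \<ominus> t"] sq1 sq2 by blast+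
  then have "v \<in> meet" using meets(6) meet2 meetI by blast
  then obtain \<gamma> where gam: "v = sc \<gamma> \<one>" using msc by blast
  obtain \<alpha> \<beta> where al: "s \<otimes> s = sc \<alpha> \<one>" and be: "t \<otimes> t = sc \<beta> \<one>" using msc ssm ttm by blast
  define g where "g x y z = sc x \<one> \<oplus> sc y s \<oplus> sc z t" for x y z
  have gc: "g x y z \<in> carrier R" for x y z using c by (simp add: g_def)
  have span: "\<exists>x y z. r = g x y z" if r: "r \<in> carrier R" for r
  proof -
    obtain d y w where d: "d \<in> meet" "r = d \<oplus> sc y s \<oplus> sc w t" using spanned[OF s t r] by blast
    obtain x where "d = sc x \<one>" using msc[OF d(1)] by blast
    then show ?thesis using d(2) unfolding g_def by blast
  qed
  have nz: "k = 0" if "sc k a = \<zero>" "a \<in> carrier R" "a \<noteq> \<zero>" for k a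
    using that by (rule_tac F3_cases[of k]) (simp_all)
  have g0: "x = 0 \<and> y = 0 \<and> z = 0" if "g x y z = \<zero>" for x y z
  proof -
    have "sc y s \<oplus> sc z t = \<ominus> sc x \<one>"
    proof -
      have "sc x \<one> \<oplus> (sc y s \<oplus> sc z t) = \<zero>" using that c by (simp add: g_def a_assoc)
      then show ?thesis using c by (metis minus_equality a_comm sc_closed one_closed add.m_closed)
    qed
    then have "sc y s \<oplus> sc z t \<in> meet" using meet_rules(4)[OF scm] by simp
    from independent[OF s t this] have yz: "y = 0" "z = 0" .
    then have "sc x \<one> = \<zero>" using that by (simp add: g_def)
    then show ?thesis using nz one_neq_zero yz by blast
  qed
  have g_add: "g x y z \<oplus> g x' y' z' = g (x + x') (y + y') (z + z')" for x y z x' y' z'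
    using c by (simp add: g_def c3.sc_add_left a_ac)
  have g_inj: "x = x' \<and> y = y' \<and> z = z'" if "g x y z = g x' y' z'" for x y z x' y' z'
  proof -
    have "g (x - x') (y - y') (z - z') \<oplus> g x' y' z' = \<zero> \<oplus> g x' y' z'"
      using that gc by (simp add: g_add)
    then have "g (x - x') (y - y') (z - z') = \<zero>" using gc by (metis add.r_cancel zero_closed)
    then show ?thesis using g0 by fastforce
  qed
  \<comment> \<open>All products are now determined by s t = x + y s + z t. Comparing s (s t), (s t)
    t and (s t) s with their reassociations yields \<open>\<alpha>\<close> = z^2,
    \<open>\<beta>\<close> = y^2, x = - z y and \<open>\<gamma>\<close> = z y.\<close>
  obtain x y z where st: "s \<otimes> t = g x y z" using span[of "s \<otimes> t"] c by blast
  have ts: "t \<otimes> s = g (\<gamma> + 2 * x) (2 * y) (2 * z)"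
  proof -
    have "t \<otimes> s = v \<oplus> \<ominus> (s \<otimes> t)"
      using add_diff_cancel[of "t \<otimes> s" "s \<otimes> t"] a_comm[of "t \<otimes> s" "s \<otimes> t"] c by (simp add: v_def minus_eq)
    then show ?thesis unfolding gam st using c
      by (simp add: g_def minus_add sc_neg c3.sc_add_left a_ac)
  qed
  have comb: "sc p \<one> \<oplus> sc q s \<oplus> sc r t \<oplus> sc k (g x' y' z') = g (p + k * x') (q + k * y') (r + k * z')"
    for p q r k x' y' z'
    using c by (simp add: g_def sc_add_right sc_sc c3.sc_add_left a_ac)
  have "s \<otimes> (s \<otimes> t) = (s \<otimes> s) \<otimes> t" using c by (simp add: m_assoc)
  moreover have "s \<otimes> g x y z = g (y * \<alpha> + z * x) (x + z * y) (0 + z * z)"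
    using comb[of "y * \<alpha>" x 0 z x y z] c
    by (simp add: g_def[of x y z] r_distr sc_mult_right al st sc_sc) (simp add: g_def a_ac)
  moreover have "(s \<otimes> s) \<otimes> t = g 0 0 \<alpha>" using c by (simp add: al sc_mult_left g_def)
  ultimately have i1: "g (y * \<alpha> + z * x) (x + z * y) (0 + z * z) = g 0 0 \<alpha>" using st by simp
  have "(s \<otimes> t) \<otimes> t = s \<otimes> (t \<otimes> t)" using c by (simp add: m_assoc)
  moreover have "g x y z \<otimes> t = g (z * \<beta> + y * x) (0 + y * y) (x + y * z)"
    using comb[of "z * \<beta>" 0 x y x y z] c
    by (simp add: g_def[of x y z] l_distr sc_mult_left be st sc_sc) (simp add: g_def a_ac)
  moreover have "s \<otimes> (t \<otimes> t) = g 0 \<beta> 0" using c by (simp add: be sc_mult_right g_def)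
  ultimately have i2: "g (z * \<beta> + y * x) (0 + y * y) (x + y * z) = g 0 \<beta> 0" using st by simp
  have "(s \<otimes> t) \<otimes> s = s \<otimes> (t \<otimes> s)" using c by (simp add: m_assoc)
  moreover have "g x y z \<otimes> s = g (y * \<alpha> + z * (\<gamma> + 2 * x)) (x + z * (2 * y)) (0 + z * (2 * z))"
    using comb[of "y * \<alpha>" x 0 z "\<gamma> + 2 * x" "2 * y" "2 * z"] c
    by (simp add: g_def[of x y z] l_distr sc_mult_left al ts sc_sc) (simp add: g_def a_ac)
  moreover have "s \<otimes> (t \<otimes> s) = g (2 * y * \<alpha> + 2 * z * x) (\<gamma> + 2 * x + 2 * z * y) (0 + 2 * z * z)"
    unfolding ts using comb[of "2 * y * \<alpha>" "\<gamma> + 2 * x" 0 "2 * z" x y z] c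
    by (simp add: g_def[of "\<gamma> + 2 * x" "2 * y" "2 * z"] r_distr sc_mult_right al st sc_sc) (simp add: g_def a_ac)
  ultimately have i3: "g (y * \<alpha> + z * (\<gamma> + 2 * x)) (x + z * (2 * y)) (0 + z * (2 * z)) =
      g (2 * y * \<alpha> + 2 * z * x) (\<gamma> + 2 * x + 2 * z * y) (0 + 2 * z * z)" unfolding st by simp
  have a: "\<alpha> = z * z" and xv: "x + z * y = 0" using g_inj[OF i1] by simp_all
  have b: "\<beta> = y * y" using g_inj[OF i2] by simp
  have cx: "x + z * (2 * y) = \<gamma> + 2 * x + 2 * z * y" using g_inj[OF i3] by blast
  have x: "x = 2 * (z * y)"
    by (rule F3_cases[of y]; rule F3_cases[of z]; rule F3_cases[of x]; use xv in simp)
  have \<gamma>: "\<gamma> = z * y"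
    by (rule F3_cases[of y]; rule F3_cases[of z]; rule F3_cases[of \<gamma>]; use cx x in simp)
  have ar: "k * y + 2 * (y * k) = 0" "2 * (y * k) + k * y = 0" "k * y + 2 * (k * y) = 0" "2 * (k * y) + k * y = 0"
    "y * k + (k * y + 2 * (2 * (k * y))) = 0" for k
    by (rule F3_cases[of y]; rule F3_cases[of k]; simp)+
  have nmeet: "sc k s \<notin> meet" "sc k t \<notin> meet" if "k \<noteq> 0" for k
    using sc_mem_iff[OF sub2 c(1) that] sc_mem_iff[OF sub1 c(2) that] s t meetD(1,2) by blast+
  have mone: "\<ominus> \<one> \<in> meet" using meet_rules(4)[OF meet_one] .
  consider "z \<noteq> 0" | "z = 0" "y \<noteq> 0" | "z = 0" "y = 0" by blast
  then show ?thesis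
  proof cases
    case 1
    note zz = F3_square[OF 1]
    \<comment> \<open>n is the non-scalar part of s t, and u = z s is an involution because s^2 =
      z^2 = 1.\<close>
    define u n where "u = sc z s" and "n = sc y s \<oplus> sc z t"
    have ss: "s \<otimes> s = \<one>" using al a zz by simp
    have un: "u \<in> carrier R" "n \<in> carrier R" using c by (simp_all add: u_def n_def)
    have "surjects_onto R mult_T2 (1, 0, 1)"
    proof (rule c3.surjects_onto_T2_involution[OF un(1) _ _ _ un(2)])
      show "u \<otimes> u = \<one>" using c by (simp add: u_def sc_mult_left sc_mult_right sc_sc ss zz)
      show "u \<noteq> \<one>" "u \<noteq> \<ominus> \<one>" using nmeet(1)[OF 1] meet_one mone unfolding u_def by metis+
      have "u \<otimes> n = sc (z * y) \<one> \<oplus> s \<otimes> t"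
        using c by (simp add: u_def n_def r_distr sc_mult_left sc_mult_right sc_sc ss zz mult.commute)
      also have "\<dots> = sc (z * y + x) \<one> \<oplus> (sc y s \<oplus> sc z t)"
        unfolding st using c by (simp add: g_def c3.sc_add_left a_ac)
      also have "\<dots> = n" using c by (simp add: x ar n_def)
      finally show "u \<otimes> n = n" .
      have "n \<otimes> u = sc (y * z) \<one> \<oplus> t \<otimes> s"
        using c by (simp add: u_def n_def l_distr sc_mult_left sc_mult_right sc_sc sc_add_right ss zz mult.commute)
      also have "\<dots> = sc (y * z + (\<gamma> + 2 * x)) \<one> \<oplus> (sc (2 * y) s \<oplus> sc (2 * z) t)"
        unfolding ts using c by (simp add: g_def c3.sc_add_left a_ac)
      also have "\<dots> = \<ominus> n" unfolding x \<gamma> ar using c by (simp add: n_def minus_add sc_neg)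
      finally show "n \<otimes> u = \<ominus> n" .
      show "n \<noteq> \<zero>"
      proof
        assume "n = \<zero>"
        then have "g 0 y z = \<zero>" using c by (simp add: g_def n_def)
        then show False using g0 1 by blast
      qed
      fix r assume "r \<in> carrier R"
      then obtain k l m where r: "r = g k l m" using span by blast
      have kz: "i * z * z = i" for i by (simp add: mult.assoc zz)
      \<comment> \<open>From s = z u and t = z n - z y s, since z^2 = 1.\<close>
      have "sc k \<one> \<oplus> sc ((l - m * z * y) * z) u \<oplus> sc (m * z) n =
          sc k \<one> \<oplus> sc ((l - m * z * y) * z * z + m * z * y) s \<oplus> sc (m * z * z) t"
        using c by (simp add: u_def n_def sc_add_right sc_sc c3.sc_add_left a_assoc)
      also have "\<dots> = r" unfolding kz r g_def by simp
      finally show "\<exists>x y z. r = sc x \<one> \<oplus> sc y u \<oplus> sc z n" by metis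
    qed
    then show ?thesis ..
  next
    case 2
    note yy = F3_square[OF 2(2)]
    \<comment> \<open>Here s t = y s and t s = - y s, so u = - y t satisfies u s = s and s u = - s;
      the nilpotent element is s itself.\<close>
    define u where "u = sc (2 * y) t"
    have y2: "2 * y \<noteq> 0" "2 * y * (2 * y) = 1" "2 * y * y = 2" "2 * y * (2 * y * k) = k" for k
      using 2(2) by (rule_tac F3_cases[of y]; rule_tac F3_cases[of k]; simp)+
    have tt: "t \<otimes> t = \<one>" using be b yy by simp
    have st': "s \<otimes> t = sc y s" "t \<otimes> s = sc (2 * y) s"
      unfolding st ts using c 2(1) by (simp_all add: g_def x \<gamma>)
    have uc: "u \<in> carrier R" using c by (simp add: u_def)
    have s0: "s \<noteq> \<zero>" using s(2) sub_rules(8) by metis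
    have "surjects_onto R mult_T2 (1, 0, 1)"
    proof (rule c3.surjects_onto_T2_involution[OF uc _ _ _ c(1) _ _ s0])
      show "u \<otimes> u = \<one>" using c y2 by (simp add: u_def sc_mult_left sc_mult_right sc_sc tt)
      show "u \<noteq> \<one>" "u \<noteq> \<ominus> \<one>" using nmeet(2)[OF y2(1)] meet_one mone unfolding u_def by metis+
      show "u \<otimes> s = s" using c by (simp add: u_def sc_mult_left sc_sc st' y2)
      show "s \<otimes> u = \<ominus> s" using c by (simp add: u_def sc_mult_right sc_sc st' y2)
      fix r assume "r \<in> carrier R"
      then obtain k l m where r: "r = g k l m" using span by blast
      have "sc k \<one> \<oplus> sc (2 * y * m) u \<oplus> sc l s = sc k \<one> \<oplus> sc (2 * y * (2 * y * m)) t \<oplus> sc l s"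
        using c by (simp add: u_def sc_sc mult_ac)
      also have "\<dots> = r" unfolding y2(4) r g_def using c by (simp add: a_ac)
      finally show "\<exists>x y z. r = sc x \<one> \<oplus> sc y u \<oplus> sc z s" by metis
    qed
    then show ?thesis ..
  next
    case 3
    have z: "s \<otimes> s = \<zero>" "t \<otimes> t = \<zero>" "s \<otimes> t = \<zero>" "t \<otimes> s = \<zero>"
      using al be st ts a b x \<gamma> 3 by (simp_all add: g_def)
    have "surjects_onto R mult_F3xy (1, 0, 0)"
    proof (rule surjects_ontoI[OF zeroideal, where g = "\<lambda>(x, y, z). g x y z"])
      fix p q :: "3 \<times> 3 \<times> 3"
      obtain i j k where p: "p = (i, j, k)" by (metis surj_pair)
      obtain i' j' k' where q: "q = (i', j', k')" by (metis surj_pair)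
      show "(case p of (x, y, z) \<Rightarrow> g x y z) \<in> carrier R" using gc by (simp add: p)
      show "(case p + q of (x, y, z) \<Rightarrow> g x y z) =
          (case p of (x, y, z) \<Rightarrow> g x y z) \<oplus> (case q of (x, y, z) \<Rightarrow> g x y z)"
        by (simp add: p q g_add)
      show "(case mult_F3xy p q of (x, y, z) \<Rightarrow> g x y z) =
          (case p of (x, y, z) \<Rightarrow> g x y z) \<otimes> (case q of (x, y, z) \<Rightarrow> g x y z)"
        using c z by (simp add: p q mult_F3xy_def g_def l_distr r_distr sc_mult_left sc_mult_right
            sc_add_right sc_sc c3.sc_add_left mult_ac a_ac)
      show "p = 0" if "(case p of (x, y, z) \<Rightarrow> g x y z) \<in> {\<zero>}"
        using that g0 by (simp add: p zero_prod_def)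
    next
      show "(case (1, 0, 0) of (x, y, z) \<Rightarrow> g x y z) = \<one>" by (simp add: g_def)
      fix r assume r: "r \<in> carrier R"
      then obtain i j k where "r = g i j k" using span by blast
      then have "r \<ominus> (case (i, j, k) of (x, y, z) \<Rightarrow> g x y z) \<in> {\<zero>}" using r by (simp add: minus_eq r_neg)
      then show "\<exists>p. r \<ominus> (case p of (x, y, z) \<Rightarrow> g x y z) \<in> {\<zero>}" by blast
    qed
    then show ?thesis ..
  qed
qed

text \<open>A nonzero f in \<open>left_kernel\<close> is outside \<open>right_kernel\<close>, so it
  acts from the right as 1 or -1; accordingly 1 - f or 1 + f serves as e in
  \<open>T2_case\<close>.\<close>

theorem surjects_onto_T2_or_F3xy:
  "surjects_onto R mult_T2 (1, 0, 1) \<or> surjects_onto R mult_F3xy (1, 0, 0)"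
proof (cases "left_kernel = {\<zero>}")
  case True
  then show ?thesis by (rule scalar_case)
next
  case False
  then obtain f where f: "f \<in> left_kernel" "f \<noteq> \<zero>"
    using nonunital_subringD(2)[OF left_kernel_subring] by blast
  have fm: "f \<in> meet" using f by (simp add: left_kernel_def)
  have fc: "f \<in> carrier R" using meet_rules(1)[OF fm] .
  have K: "\<ominus> x \<in> right_kernel" if "x \<in> right_kernel" for x
    using nonunital_subringD(4)[OF right_kernel_subring that] .
  have "f \<notin> right_kernel" using f kernels_meet_trivial by blast
  then have "f \<ominus> \<one> \<in> right_kernel \<or> f \<oplus> \<one> \<in> right_kernel" using right_scalar[OF fm] by blast
  then show ?thesis
  proof
    assume "f \<ominus> \<one> \<in> right_kernel"
    then have "\<ominus> (f \<ominus> \<one>) \<in> right_kernel" by (rule K)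
    moreover have "\<one> \<ominus> \<ominus> (f \<ominus> \<one>) = f" using fc one_closed by algebra
    ultimately show ?thesis using T2_case f by metis
  next
    assume "f \<oplus> \<one> \<in> right_kernel"
    moreover have "\<one> \<ominus> (f \<oplus> \<one>) = \<ominus> f" using fc one_closed by algebra
    moreover have "\<ominus> f \<in> left_kernel" using nonunital_subringD(4)[OF left_kernel_subring f(1)] .
    ultimately show ?thesis using T2_case by metis
  qed
qed

end

section \<open>The case of index two\<close>

text \<open>For S of index 2 and x in S, left multiplication by x acts on the two-element group R /
  S as 0 or 1; \<open>lact\<close> says that it acts as 1.\<close>

definition lact :: "'a set \<Rightarrow> ('a, 'm) ring_scheme \<Rightarrow> 'a \<Rightarrow> bool" where
  "lact S R x \<longleftrightarrow> (\<exists>r\<in>carrier R. x \<otimes>\<^bsub>R\<^esub> r \<notin> S)"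

definition ract :: "'a set \<Rightarrow> ('a, 'm) ring_scheme \<Rightarrow> 'a \<Rightarrow> bool" where
  "ract S R x \<longleftrightarrow> (\<exists>r\<in>carrier R. r \<otimes>\<^bsub>R\<^esub> x \<notin> S)"

lemma lact_op [simp]: "lact S (op_ring R) x \<longleftrightarrow> ract S R x"
  and ract_op [simp]: "ract S (op_ring R) x \<longleftrightarrow> lact S R x"
  by (simp_all add: lact_def ract_def)

locale index2_subring = ring R for R (structure) +
  fixes S
  assumes sub: "nonunital_subring S R" and one: "\<one> \<in> S" and proper: "S \<noteq> carrier R"
    and index2: "x \<in> carrier R \<Longrightarrow> y \<in> carrier R \<Longrightarrow> x \<oplus> y \<in> S \<longleftrightarrow> (x \<in> S \<longleftrightarrow> y \<in> S)"
begin

lemmas S_rules = nonunital_subringD[OF sub]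

lemma op: "index2_subring (op_ring R) S"
  by (intro index2_subring.intro index2_subring_axioms.intro ring_op_ring)
    (simp_all add: sub one proper index2)

lemma lact_mult_mem:
  assumes x: "x \<in> S" and r: "r \<in> carrier R"
  shows "x \<otimes> r \<in> S \<longleftrightarrow> r \<in> S \<or> \<not> lact S R x"
proof (cases "r \<in> S \<or> \<not> lact S R x")
  case True
  then show ?thesis using S_rules(6)[OF x] r unfolding lact_def by blast
next
  case False
  then obtain r' where r': "r' \<in> carrier R" "x \<otimes> r' \<notin> S" unfolding lact_def by blast
  have xc: "x \<in> carrier R" using S_rules(1)[OF x] .
  have "r' \<notin> S" using r' S_rules(6)[OF x] by blast
  then have "r \<oplus> r' \<in> S" using index2[OF r r'(1)] False by blast
  then have "x \<otimes> (r \<oplus> r') \<in> S" by (rule S_rules(6)[OF x])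
  then have "x \<otimes> r \<oplus> x \<otimes> r' \<in> S" using r r' xc by (simp add: r_distr)
  then have "x \<otimes> r \<notin> S" using index2[of "x \<otimes> r" "x \<otimes> r'"] r r' xc by simp
  then show ?thesis using False by blast
qed

lemma ex_outside: obtains r where "r \<in> carrier R" "r \<notin> S"
  using proper S_rules(1) by blast

lemma lact_iff: "x \<in> S \<Longrightarrow> r \<in> carrier R \<Longrightarrow> r \<notin> S \<Longrightarrow> lact S R x \<longleftrightarrow> x \<otimes> r \<notin> S"
  using lact_mult_mem by blast

text \<open>Addition becomes exclusive or; together with \<open>lact_mult\<close> and
  \<open>lact_one\<close>, \<open>lact\<close> is a homomorphism from S to F_2.\<close>

lemma lact_add:
  assumes "x \<in> S" "y \<in> S"
  shows "lact S R (x \<oplus> y) \<longleftrightarrow> (lact S R x \<longleftrightarrow> \<not> lact S R y)"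
proof -
  obtain r where r: "r \<in> carrier R" "r \<notin> S" by (rule ex_outside)
  have c: "x \<in> carrier R" "y \<in> carrier R" using assms S_rules(1) by blast+
  have "(x \<oplus> y) \<otimes> r \<in> S \<longleftrightarrow> (x \<otimes> r \<in> S \<longleftrightarrow> y \<otimes> r \<in> S)"
    using index2[of "x \<otimes> r" "y \<otimes> r"] c r by (simp add: l_distr)
  then show ?thesis
    using lact_iff[OF S_rules(3)[OF assms] r] lact_iff[OF assms(1) r] lact_iff[OF assms(2) r] by blast
qed

lemma lact_mult:
  assumes "x \<in> S" "y \<in> S"
  shows "lact S R (x \<otimes> y) \<longleftrightarrow> lact S R x \<and> lact S R y"
proof -
  obtain r where r: "r \<in> carrier R" "r \<notin> S" by (rule ex_outside)
  have c: "x \<in> carrier R" "y \<in> carrier R" using assms S_rules(1) by blast+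
  have "(x \<otimes> y) \<otimes> r \<in> S \<longleftrightarrow> y \<otimes> r \<in> S \<or> \<not> lact S R x"
    using lact_mult_mem[OF assms(1), of "y \<otimes> r"] c r by (simp add: m_assoc)
  then show ?thesis
    using lact_iff[OF S_rules(6)[OF assms] r] lact_iff[OF assms(2) r] by blast
qed

lemma lact_one: "lact S R \<one>"
  using lact_iff[OF one] ex_outside l_one by metis

lemma lact_diff_one: "x \<in> S \<Longrightarrow> lact S R (x \<ominus> \<one>) \<longleftrightarrow> \<not> lact S R x"
proof -
  assume x: "x \<in> S"
  have xc: "x \<in> carrier R" using S_rules(1)[OF x] .
  have "(x \<ominus> \<one>) \<oplus> \<one> = x" using xc one_closed by algebra
  then show ?thesis using lact_add[OF S_rules(5)[OF x one] one] lact_one by simp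
qed

lemma lact_one_diff: "x \<in> S \<Longrightarrow> lact S R (\<one> \<ominus> x) \<longleftrightarrow> \<not> lact S R x"
proof -
  assume x: "x \<in> S"
  have xc: "x \<in> carrier R" using S_rules(1)[OF x] .
  have "(\<one> \<ominus> x) \<oplus> x = \<one>" using xc one_closed by algebra
  then show ?thesis using lact_add[OF S_rules(5)[OF one x] x] lact_one by simp
qed

lemmas ract_mult_mem = index2_subring.lact_mult_mem[OF op, simplified]
lemmas ract_one = index2_subring.lact_one[OF op, simplified]
lemmas ract_one_diff = index2_subring.lact_one_diff[OF op, simplified]
lemmas ract_diff_one = index2_subring.lact_diff_one[OF op, simplified]

end

locale four_cover_core_II = four_cover_core + four_cover_II
begin

lemma index2_A1: "index2_subring R A1"
  by (intro index2_subring.intro index2_subring_axioms.intro ring_axioms sub1 one_in(1) proper1 index2_1)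

lemma index2_A2: "index2_subring R A2"
  by (intro index2_subring.intro index2_subring_axioms.intro ring_axioms sub2 one_in(2) proper2 index2_2)

lemma core_II_op: "four_cover_core_II (op_ring R) A1 A2 A3 A4 b"
  by (intro four_cover_core_II.intro core_op four_cover_II.intro four_cover_pair.intro four_cover_op
      four_cover_pair_axioms.intro four_cover_II_axioms.intro) (fact b small3)+

lemma core_II_swap: "four_cover_core_II R A2 A1 A3 A4 b"
proof (intro four_cover_core_II.intro four_cover_core.intro four_cover_unital.intro perm12
    four_cover_unital_axioms.intro four_cover_core_axioms.intro four_cover_II.intro perm12_pair four_cover_II_axioms.intro)
  show "x \<in> A2 \<longleftrightarrow> x \<in> A1" if "x \<in> A3" for x using small3[OF that] by blast
  show "I = {\<zero>}" if "ideal I R" "I \<subseteq> A2 \<inter> A1 \<inter> A3 \<inter> A4" for I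
    by (rule core[OF that(1)]) (use that(2) in blast)
qed (fact one_in)+

lemma meetI: "x \<in> A1 \<Longrightarrow> x \<in> A2 \<Longrightarrow> x \<in> A3 \<Longrightarrow> x \<in> meet"
  unfolding meet_def using meet4 by blast

lemma meetD: "x \<in> meet \<Longrightarrow> x \<in> A1" "x \<in> meet \<Longrightarrow> x \<in> A2" "x \<in> meet \<Longrightarrow> x \<in> A3" "x \<in> meet \<Longrightarrow> x \<in> A4"
  unfolding meet_def by blast+

lemma ex_v: obtains v where "v \<in> A3" "v \<notin> A1" "v \<notin> A2"
proof -
  obtain a c where c: "c \<in> carrier R" "c \<notin> A1" "c \<notin> A2" by (rule ex_outside)
  show ?thesis
  proof (cases "c \<in> A3")
    case True
    then show ?thesis using that c by blast
  next
    case False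
    then have "c \<oplus> b \<in> A3" using outside_add_b[OF c] by blast
    moreover have "c \<oplus> b \<notin> A1" "c \<oplus> b \<notin> A2" using c b by simp_all
    ultimately show ?thesis using that by blast
  qed
qed

lemmas lact1 = index2_subring.lact_mult_mem[OF index2_A1]
lemmas lact2 = index2_subring.lact_mult_mem[OF index2_A2]
lemmas ract1 = index2_subring.ract_mult_mem[OF index2_A1]
lemmas ract2 = index2_subring.ract_mult_mem[OF index2_A2]

text \<open>Test on v in A3 outside A1 and A2: d v stays in A3, where membership in A1 and in A2 is
  equivalent.\<close>

lemma lact_meet: "d \<in> meet \<Longrightarrow> lact A1 R d \<longleftrightarrow> lact A2 R d"
proof -
  assume d: "d \<in> meet"
  obtain v where v: "v \<in> A3" "v \<notin> A1" "v \<notin> A2" by (rule ex_v)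
  have vc: "v \<in> carrier R" using in_carrier v by blast
  have "d \<otimes> v \<in> A3" using sub_rules(18)[OF meetD(3)[OF d] v(1)] .
  then have "d \<otimes> v \<in> A1 \<longleftrightarrow> d \<otimes> v \<in> A2" by (rule small3)
  then show ?thesis using lact1[OF meetD(1)[OF d] vc] lact2[OF meetD(2)[OF d] vc] v by blast
qed

text \<open>If the actions on R / A1 and R / A2 agreed on both sides, the elements lying in both or
  neither of A1, A2 would form a proper subring S, and A1, A2, S would cover R.\<close>

lemma ex_split:
  "\<exists>x. x \<in> A1 \<and> x \<in> A2 \<and> ((lact A1 R x \<longleftrightarrow> \<not> lact A2 R x) \<or> (ract A1 R x \<longleftrightarrow> \<not> ract A2 R x))"
proof (rule ccontr)
  assume "\<not> ?thesis"
  then have same: "lact A1 R x \<longleftrightarrow> lact A2 R x" "ract A1 R x \<longleftrightarrow> ract A2 R x" if "x \<in> A1" "x \<in> A2" for x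
    using that by blast+
  define S where "S = {x \<in> carrier R. x \<in> A1 \<longleftrightarrow> x \<in> A2}"
  obtain v where v: "v \<in> A3" "v \<notin> A1" "v \<notin> A2" by (rule ex_v)
  have vc: "v \<in> carrier R" using in_carrier v by blast
  have Sadd: "x \<oplus> y \<in> S" if "x \<in> S" "y \<in> S" for x y
    using that index2_1 index2_2 by (simp add: S_def)
  have Sneg: "\<ominus> x \<in> S" if "x \<in> S" for x using that by (simp add: S_def)
  have Bl: "x \<otimes> y \<in> S" if "x \<in> A1" "x \<in> A2" "y \<in> S" for x y
  proof -
    have yc: "y \<in> carrier R" "y \<in> A1 \<longleftrightarrow> y \<in> A2" using that(3) by (simp_all add: S_def)
    show ?thesis using lact1[OF that(1) yc(1)] lact2[OF that(2) yc(1)] same(1)[OF that(1,2)] yc in_carrier(1)[OF that(1)]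
      by (simp add: S_def)
  qed
  have Br: "y \<otimes> x \<in> S" if "x \<in> A1" "x \<in> A2" "y \<in> S" for x y
  proof -
    have yc: "y \<in> carrier R" "y \<in> A1 \<longleftrightarrow> y \<in> A2" using that(3) by (simp_all add: S_def)
    show ?thesis using ract1[OF that(1) yc(1)] ract2[OF that(2) yc(1)] same(2)[OF that(1,2)] yc in_carrier(1)[OF that(1)]
      by (simp add: S_def)
  qed
  have vS: "v \<in> S" using v vc by (simp add: S_def)
  have vv: "v \<otimes> v \<in> S"
    using small3[OF sub_rules(18)[OF v(1) v(1)]] vc by (simp add: S_def)
  have dec: "x \<oplus> \<ominus> v \<in> A1 \<and> x \<oplus> \<ominus> v \<in> A2" if "x \<in> S" "x \<notin> A1" for x
    using that index2_1[of x "\<ominus> v"] index2_2[of x "\<ominus> v"] vc v by (simp add: S_def)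
  \<comment> \<open>An element of S outside A1 is v plus an element of A1 and A2, so products reduce
    to \<open>Bl\<close>, \<open>Br\<close> and v v, which is in A3 and hence in S.\<close>
  have "nonunital_subring S R"
  proof (rule nonunital_subringI)
    show "S \<subseteq> carrier R" by (auto simp: S_def)
    show "\<zero> \<in> S" using sub_rules(2,8) by (simp add: S_def)
    fix x y assume xy: "x \<in> S" "y \<in> S"
    show "x \<ominus> y \<in> S" using Sadd[OF xy(1) Sneg[OF xy(2)]] by (simp add: minus_eq)
    have c: "x \<in> carrier R" "y \<in> carrier R" using xy by (simp_all add: S_def)
    show "x \<otimes> y \<in> S"
    proof (cases "x \<in> A1")
      case True
      then show ?thesis using Bl xy by (simp add: S_def)
    next
      case False
      note x = dec[OF xy(1) False]
      have vy: "v \<otimes> y \<in> S"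
      proof (cases "y \<in> A1")
        case True
        then show ?thesis using Br[OF _ _ vS] xy by (simp add: S_def)
      next
        case False
        note y = dec[OF xy(2) False]
        have "v \<otimes> y = v \<otimes> (y \<oplus> \<ominus> v) \<oplus> v \<otimes> v" using c vc by (simp add: r_distr r_minus a_assoc l_neg)
        then show ?thesis using Sadd[OF Br[OF conjunct1[OF y] conjunct2[OF y] vS] vv] by simp
      qed
      have "x \<otimes> y = (x \<oplus> \<ominus> v) \<otimes> y \<oplus> v \<otimes> y" using c vc by (simp add: l_distr l_minus a_assoc l_neg)
      then show ?thesis using Sadd[OF Bl[OF conjunct1[OF x] conjunct2[OF x] xy(2)] vy] by simp
    qed
  qed
  moreover have "S \<noteq> carrier R"
  proof -
    obtain a c where "a \<in> A1" "a \<notin> A2" by (rule ex_outside)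
    then have "a \<in> carrier R" "a \<notin> S" using in_carrier by (auto simp: S_def)
    then show ?thesis by blast
  qed
  moreover have "carrier R = A1 \<union> A2 \<union> S" using in_carrier by (auto simp: S_def)
  ultimately have "three_cover R" unfolding three_cover_def using sub1 sub2 proper1 proper2 by blast
  then show False using no_three_cover by blast
qed

end

section \<open>An element acting differently on the two quotients of order two\<close>

locale four_cover_split = four_cover_core_II +
  fixes c
  assumes c: "c \<in> A1" "c \<in> A2" "lact A1 R c" "\<not> lact A2 R c"
begin

lemma c_carrier [simp]: "c \<in> carrier R"
  using in_carrier(1)[OF c(1)] .

lemma c3: "c \<notin> A3"
  using lact_meet[OF meetI[OF c(1,2)]] c by blast

lemma pair_c: "four_cover_pair R A1 A2 A3 A4 c"
  by (intro four_cover_pair.intro four_cover_axioms four_cover_pair_axioms.intro) (fact c(1,2) c3)+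

text \<open>The two left actions agree on the intersection by \<open>lact_meet\<close>. Conversely,
  x outside A3 becomes an element of the intersection after adding c, and c has differing
  actions.\<close>

lemma meet_iff:
  assumes "x \<in> A1" "x \<in> A2"
  shows "x \<in> meet \<longleftrightarrow> (lact A1 R x \<longleftrightarrow> lact A2 R x)"
proof
  assume *: "lact A1 R x \<longleftrightarrow> lact A2 R x"
  show "x \<in> meet"
  proof (rule ccontr)
    assume "x \<notin> meet"
    then have "x \<notin> A3" using meetI assms by blast
    then have "x \<oplus> c \<in> A3" using four_cover_pair.index2_meet[OF pair_c assms c(1,2)] c3 by blast
    then have "x \<oplus> c \<in> meet" using meetI sub_rules(3)[OF assms(1) c(1)] sub_rules(9)[OF assms(2) c(2)] by blast
    then show False
      using lact_meet[of "x \<oplus> c"] index2_subring.lact_add[OF index2_A1 assms(1) c(1)]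
        index2_subring.lact_add[OF index2_A2 assms(2) c(2)] * c by blast
  qed
qed (rule lact_meet)

text \<open>x r lies in A1 and A2, and so does x r r' for every r'. Thus x r again acts as 0 on both
  quotients, and \<open>meet_iff\<close> puts it in the intersection.\<close>

lemma left_kernelI:
  assumes x: "x \<in> A1" "x \<in> A2" "\<not> lact A1 R x" "\<not> lact A2 R x"
  shows "x \<in> left_kernel"
proof -
  have xc: "x \<in> carrier R" using in_carrier(1)[OF x(1)] .
  have "x \<otimes> r \<in> meet" if r: "r \<in> carrier R" for r
  proof -
    have 1: "x \<otimes> r \<in> A1" "x \<otimes> r \<in> A2" using lact1[OF x(1) r] lact2[OF x(2) r] x by blast+
    have "(x \<otimes> r) \<otimes> r' \<in> A1" "(x \<otimes> r) \<otimes> r' \<in> A2" if "r' \<in> carrier R" for r'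
      using lact1[OF x(1), of "r \<otimes> r'"] lact2[OF x(2), of "r \<otimes> r'"] x xc r that by (simp_all add: m_assoc)
    then have "\<not> lact A1 R (x \<otimes> r)" "\<not> lact A2 R (x \<otimes> r)" unfolding lact_def by blast+
    then show ?thesis using meet_iff[OF 1] by blast
  qed
  moreover have "x \<in> meet" using meet_iff[OF x(1,2)] x by blast
  ultimately show ?thesis by (simp add: left_kernel_def)
qed

lemma left_scalar: "d \<in> meet \<Longrightarrow> d \<in> left_kernel \<or> d \<ominus> \<one> \<in> left_kernel"
proof -
  assume d: "d \<in> meet"
  have m: "d \<ominus> \<one> \<in> meet" using meet_rules(5)[OF d meet_one] .
  show ?thesis
  proof (cases "lact A1 R d")
    case False
    then show ?thesis using left_kernelI[OF meetD(1,2)[OF d]] lact_meet[OF d] by blast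
  next
    case True
    then have "\<not> lact A1 R (d \<ominus> \<one>)" using index2_subring.lact_diff_one[OF index2_A1 meetD(1)[OF d]] by blast
    then show ?thesis using left_kernelI[OF meetD(1,2)[OF m]] lact_meet[OF m] by blast
  qed
qed

lemma swap: "four_cover_split R A2 A1 A3 A4 b (\<one> \<ominus> c)"
  by (intro four_cover_split.intro core_II_swap four_cover_split_axioms.intro)
    (use c sub_rules(5)[OF one_in(1) c(1)] sub_rules(11)[OF one_in(2) c(2)]
      index2_subring.lact_one_diff[OF index2_A1 c(1)] index2_subring.lact_one_diff[OF index2_A2 c(2)] in blast)+

end

lemma (in four_cover_core_II) ex_split_left:
  assumes x: "x \<in> A1" "x \<in> A2" "lact A1 R x \<longleftrightarrow> \<not> lact A2 R x"
  shows "\<exists>c. four_cover_split R A1 A2 A3 A4 b c"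
proof (cases "lact A1 R x")
  case True
  then have "four_cover_split R A1 A2 A3 A4 b x"
    by (intro four_cover_split.intro four_cover_core_II_axioms four_cover_split_axioms.intro) (use x in blast)+
  then show ?thesis by blast
next
  case False
  have "four_cover_split R A1 A2 A3 A4 b (\<one> \<ominus> x)"
    by (intro four_cover_split.intro four_cover_core_II_axioms four_cover_split_axioms.intro)
      (use x False sub_rules(5)[OF one_in(1) x(1)] sub_rules(11)[OF one_in(2) x(2)]
      index2_subring.lact_one_diff[OF index2_A1 x(1)] index2_subring.lact_one_diff[OF index2_A2 x(2)] in blast)+
  then show ?thesis by blast
qed

context four_cover_split
begin

text \<open>Since the right actions agree, the opposite ring supplies no splitting element. Instead
  the set \<open>T\<close> of all r with r d in the intersection is built up: it contains A4 and v,
  hence c, then every element of both A1 and A2, then every element in both or neither, and w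
  supplies the rest.\<close>

lemma right_kernelI:
  assumes same: "\<And>x. x \<in> A1 \<Longrightarrow> x \<in> A2 \<Longrightarrow> ract A1 R x \<longleftrightarrow> ract A2 R x"
    and d: "d \<in> meet" "\<not> ract A1 R d"
  shows "d \<in> right_kernel"
proof -
  obtain v where v: "v \<in> A3" "v \<notin> A1" "v \<notin> A2" by (rule ex_v)
  have vc: "v \<in> carrier R" using in_carrier v by blast
  have dc: "d \<in> carrier R" using meet_rules(1) d by blast
  have d2: "\<not> ract A2 R d" using same[OF meetD(1,2)[OF d(1)]] d by blast
  have dB: "r \<otimes> d \<in> A1" "r \<otimes> d \<in> A2" if "r \<in> carrier R" for r
    using ract1[OF meetD(1)[OF d(1)] that] ract2[OF meetD(2)[OF d(1)] that] d d2 by blast+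
  have vcc: "v \<oplus> c \<in> carrier R" "v \<oplus> c \<notin> A1" "v \<oplus> c \<notin> A2" using v vc c by simp_all
  have "v \<oplus> c \<notin> A3" using v vc c3 by simp
  then have vc4: "v \<oplus> c \<in> A4" using outside[OF vcc] by blast
  \<comment> \<open>w is an element of A4 in exactly one of A1 and A2: among v v, v c, c v and c c
    only c v distinguishes A1 from A2.\<close>
  define w where "w = (v \<oplus> c) \<otimes> (v \<oplus> c)"
  have w4: "w \<in> A4" unfolding w_def using sub_rules(24)[OF vc4 vc4] .
  have wc: "w \<in> carrier R" using in_carrier(4)[OF w4] .
  have we: "w = (v \<otimes> v \<oplus> v \<otimes> c) \<oplus> (c \<otimes> v \<oplus> c \<otimes> c)"
    unfolding w_def using vc by (simp add: l_distr r_distr a_ac)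
  have "v \<otimes> v \<in> A1 \<longleftrightarrow> v \<otimes> v \<in> A2" using small3[OF sub_rules(18)[OF v(1) v(1)]] .
  moreover have "v \<otimes> c \<in> A1 \<longleftrightarrow> v \<otimes> c \<in> A2"
    using ract1[OF c(1) vc] ract2[OF c(2) vc] same[OF c(1,2)] v by blast
  moreover have "c \<otimes> v \<notin> A1" "c \<otimes> v \<in> A2" using lact1[OF c(1) vc] lact2[OF c(2) vc] v c by blast+
  moreover have "c \<otimes> c \<in> A1" "c \<otimes> c \<in> A2" using sub_rules(6)[OF c(1) c(1)] sub_rules(12)[OF c(2) c(2)] by blast+
  ultimately have w12: "w \<in> A1 \<longleftrightarrow> w \<notin> A2"
    unfolding we using vc index2_1[of "v \<otimes> v \<oplus> v \<otimes> c" "c \<otimes> v \<oplus> c \<otimes> c"] index2_2[of "v \<otimes> v \<oplus> v \<otimes> c" "c \<otimes> v \<oplus> c \<otimes> c"]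
      index2_1[of "v \<otimes> v" "v \<otimes> c"] index2_2[of "v \<otimes> v" "v \<otimes> c"]
      index2_1[of "c \<otimes> v" "c \<otimes> c"] index2_2[of "c \<otimes> v" "c \<otimes> c"] by auto
  define T where "T = {r \<in> carrier R. r \<otimes> d \<in> meet}"
  have Tadd: "x \<in> T \<longleftrightarrow> x \<oplus> y \<in> T" if "x \<in> carrier R" "y \<in> T" for x y
  proof -
    have y: "y \<in> carrier R" "y \<otimes> d \<in> meet" using that by (simp_all add: T_def)
    have "(x \<oplus> y) \<otimes> d \<in> meet \<longleftrightarrow> x \<otimes> d \<in> meet"
      using nonunital_subring_add_iff(2)[OF meet_subring y(2), of "x \<otimes> d"] that y dc by (simp add: l_distr)
    then show ?thesis using that y by (simp add: T_def)
  qed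
  have vd: "v \<otimes> d \<in> A3" using sub_rules(18)[OF v(1) meetD(3)[OF d(1)]] .
  have vT: "v \<in> T" using meetI[OF dB[OF vc] vd] vc by (simp add: T_def)
  have in4: "r \<in> T" if "r \<in> A4" for r
  proof -
    have rc: "r \<in> carrier R" using in_carrier(4)[OF that] .
    have "r \<otimes> d \<in> A4" using sub_rules(24)[OF that meetD(4)[OF d(1)]] .
    then have "r \<otimes> d \<in> A3" using meet3 dB[OF rc] by blast
    then show ?thesis using meetI dB[OF rc] rc by (simp add: T_def)
  qed
  have wT: "w \<in> T" using in4[OF w4] .
  have cT: "c \<in> T" using Tadd[of c v] in4[OF vc4] vT vc by (simp add: a_comm)
  have mT: "r \<in> T" if "r \<in> meet" for r
    using meet_rules(6)[OF that d(1)] meet_rules(1)[OF that] by (simp add: T_def)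
  have BT: "r \<in> T" if "r \<in> A1" "r \<in> A2" for r
  proof (cases "r \<in> A3")
    case True
    then show ?thesis using mT meetI that by blast
  next
    case False
    have rc: "r \<in> carrier R" using in_carrier(1)[OF that(1)] .
    have "r \<oplus> c \<in> A3" using four_cover_pair.index2_meet[OF pair_c that c(1,2)] c3 False by blast
    then have "r \<oplus> c \<in> T" using mT meetI sub_rules(3)[OF that(1) c(1)] sub_rules(9)[OF that(2) c(2)] by blast
    then show ?thesis using Tadd[OF rc cT] by blast
  qed
  have ST: "r \<in> T" if "r \<in> carrier R" "r \<in> A1 \<longleftrightarrow> r \<in> A2" for r
  proof (cases "r \<in> A1")
    case True
    then show ?thesis using BT that by blast
  next
    case False
    then have "r \<oplus> v \<in> T" using BT index2_1[OF that(1) vc] index2_2[OF that(1) vc] v that by blast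
    then show ?thesis using Tadd[OF that(1) vT] by blast
  qed
  have "r \<in> T" if "r \<in> carrier R" for r
  proof (cases "r \<in> A1 \<longleftrightarrow> r \<in> A2")
    case True
    then show ?thesis using ST that by blast
  next
    case False
    have "r \<oplus> w \<in> carrier R" using that wc by simp
    then have "r \<oplus> w \<in> T" using ST index2_1[OF that wc] index2_2[OF that wc] w12 False by blast
    then show ?thesis using Tadd[OF that wT] by blast
  qed
  then show ?thesis using d(1) by (simp add: right_kernel_def T_def)
qed

text \<open>If the right actions differ somewhere, this is \<open>left_scalar\<close> in the
  opposite ring; otherwise \<open>right_kernelI\<close> applies.\<close>

lemma right_scalar: "d \<in> meet \<Longrightarrow> d \<in> right_kernel \<or> d \<ominus> \<one> \<in> right_kernel"
proof -
  assume d: "d \<in> meet"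
  show ?thesis
  proof (cases "\<exists>x. x \<in> A1 \<and> x \<in> A2 \<and> (ract A1 R x \<longleftrightarrow> \<not> ract A2 R x)")
    case True
    then obtain x where x: "x \<in> A1" "x \<in> A2" "ract A1 R x \<longleftrightarrow> \<not> ract A2 R x" by blast
    obtain c' where "four_cover_split (op_ring R) A1 A2 A3 A4 b c'"
      using four_cover_core_II.ex_split_left[OF core_II_op x(1,2)] x(3) by auto
    from four_cover_split.left_scalar[OF this, unfolded op_kernels op_ring_simps, OF d] show ?thesis .
  next
    case False
    then have same: "ract A1 R x \<longleftrightarrow> ract A2 R x" if "x \<in> A1" "x \<in> A2" for x using that by blast
    show ?thesis
    proof (cases "ract A1 R d")
      case True
      then have "\<not> ract A1 R (d \<ominus> \<one>)" using index2_subring.ract_diff_one[OF index2_A1 meetD(1)[OF d]] by blast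
      then show ?thesis using right_kernelI[OF same meet_rules(5)[OF d meet_one]] by blast
    next
      case False
      then show ?thesis using right_kernelI[OF same d] by blast
    qed
  qed
qed

lemma kernels_meet_trivial: "left_kernel \<inter> right_kernel = {\<zero>}"
  by (rule kernels_trivial) (use left_scalar right_scalar in blast)+

text \<open>c e is in the intersection, so its two left actions agree. On R / A2 the factor c makes
  it 0; on R / A1 it is the action of e, which is therefore 0.\<close>

lemma right_kernel_subset: "e \<in> right_kernel \<Longrightarrow> e \<in> left_kernel"
proof -
  assume e: "e \<in> right_kernel"
  then have em: "e \<in> meet" and ce: "c \<otimes> e \<in> meet" by (simp_all add: right_kernel_def)
  have "\<not> lact A1 R e"
    using lact_meet[OF ce] index2_subring.lact_mult[OF index2_A1 c(1) meetD(1)[OF em]]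
      index2_subring.lact_mult[OF index2_A2 c(2) meetD(2)[OF em]] c by blast
  then show ?thesis using left_kernelI[OF meetD(1,2)[OF em]] lact_meet[OF em] by blast
qed

text \<open>One of d and d - 1 is in \<open>right_kernel\<close>, hence in both kernels, hence
  zero.\<close>

lemma meet_eq: "d \<in> meet \<Longrightarrow> d = \<zero> \<or> d = \<one>"
proof -
  assume d: "d \<in> meet"
  have dc: "d \<in> carrier R" using meet_rules(1)[OF d] .
  have "d = \<zero> \<or> d \<ominus> \<one> = \<zero>" using right_scalar[OF d] right_kernel_subset kernels_meet_trivial by blast
  then show ?thesis using dc by (auto simp: r_right_minus_eq)
qed

lemma one_neq_zero: "\<one> \<noteq> \<zero>"
proof
  assume "\<one> = \<zero>"
  then have "x = \<zero>" if "x \<in> carrier R" for x using l_one[OF that] l_null[OF that] by simp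
  then show False using sub_rules(2) in_carrier(1) proper1 by blast
qed

lemma char_2: "x \<in> carrier R \<Longrightarrow> x \<oplus> x = \<zero>"
proof -
  assume x: "x \<in> carrier R"
  have m: "\<one> \<oplus> \<one> \<in> meet" using meet_rules(3)[OF meet_one meet_one] .
  have "\<one> \<oplus> \<one> \<noteq> \<one>" using one_neq_zero by (metis add.r_cancel_one one_closed)
  then have "\<one> \<oplus> \<one> = \<zero>" using meet_eq[OF m] by blast
  then show ?thesis using l_distr[of \<one> \<one> x] x by simp
qed

end

lemma surjects_onto_three_cover:
  fixes \<phi> \<psi> :: "'v::ab_group_add \<Rightarrow> bit"
  assumes R: "ring R" and so: "surjects_onto R m u"
    and \<phi>: "\<And>p q. \<phi> (p + q) = \<phi> p + \<phi> q" "\<And>p q. \<phi> (m p q) = \<phi> p * \<phi> q" "\<exists>p. \<phi> p \<noteq> 0"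
    and \<psi>: "\<And>p q. \<psi> (p + q) = \<psi> p + \<psi> q" "\<And>p q. \<psi> (m p q) = \<psi> p * \<psi> q" "\<exists>p. \<psi> p \<noteq> 0"
    and ne: "\<exists>p. \<phi> p \<noteq> \<psi> p"
  shows "three_cover R"
proof -
  interpret ring R by fact
  obtain c where c: "\<And>x y. x \<in> carrier R \<Longrightarrow> y \<in> carrier R \<Longrightarrow>
      c (x \<oplus>\<^bsub>R\<^esub> y) = c x + c y \<and> c (x \<otimes>\<^bsub>R\<^esub> y) = m (c x) (c y)"
    and surj: "c ` carrier R = UNIV"
    using so unfolding surjects_onto_def by blast
  have pre: "\<exists>x\<in>carrier R. c x = p" for p using surj by (metis UNIV_I imageE)
  have bk: "bit_kernel {x \<in> carrier R. \<theta> (c x) = 0} R"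
    if t: "\<And>p q. \<theta> (p + q) = \<theta> p + \<theta> q" "\<And>p q. \<theta> (m p q) = \<theta> p * \<theta> q" "\<exists>p. \<theta> p \<noteq> 0"
    for \<theta> :: "'v \<Rightarrow> bit"
  proof -
    obtain p where "\<theta> p \<noteq> 0" using t(3) by blast
    moreover obtain x where "x \<in> carrier R" "c x = p" using pre by blast
    ultimately have "{x \<in> carrier R. \<theta> (c x) = 0} \<subset> carrier R" by blast
    moreover have "i + j = 0 \<longleftrightarrow> (i = 0 \<longleftrightarrow> j = 0)" for i j :: bit by (cases i; cases j) simp_all
    moreover have "i * j = 0 \<longleftrightarrow> i = 0 \<or> j = 0" for i j :: bit by (cases i; cases j) simp_all
    moreover have "\<theta> (c (x \<oplus>\<^bsub>R\<^esub> y)) = \<theta> (c x) + \<theta> (c y)" "\<theta> (c (x \<otimes>\<^bsub>R\<^esub> y)) = \<theta> (c x) * \<theta> (c y)"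
      if "x \<in> carrier R" "y \<in> carrier R" for x y
      using c[OF that] t(1)[of "c x" "c y"] t(2)[of "c x" "c y"] by metis+
    ultimately show ?thesis
      unfolding bit_kernel_def by (simp del: add_bit_eq_xor mult_bit_eq_and)
  qed
  obtain p where "\<phi> p \<noteq> \<psi> p" using ne by blast
  moreover obtain x where "x \<in> carrier R" "c x = p" using pre by blast
  ultimately have x: "x \<in> carrier R" "\<phi> (c x) \<noteq> \<psi> (c x)" by blast+
  have "{x \<in> carrier R. \<phi> (c x) = 0} \<noteq> {x \<in> carrier R. \<psi> (c x) = 0}"
  proof
    assume "{x \<in> carrier R. \<phi> (c x) = 0} = {x \<in> carrier R. \<psi> (c x) = 0}"
    then have "\<phi> (c x) = 0 \<longleftrightarrow> \<psi> (c x) = 0" using x(1) by blast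
    then show False using x(2) by (cases "\<phi> (c x)"; cases "\<psi> (c x)") simp_all
  qed
  then show ?thesis by (rule two_bit_kernels_three_cover[OF bk[OF \<phi>] bk[OF \<psi>]])
qed

lemma surjects_onto_map:
  assumes so: "surjects_onto R m u" and t: "surj t" "\<And>p q. t (p + q) = t p + t q"
    "\<And>p q. t (m p q) = m' (t p) (t q)"
  shows "surjects_onto R m' (t u)"
proof -
  obtain c where c: "\<And>x y. x \<in> carrier R \<Longrightarrow> y \<in> carrier R \<Longrightarrow>
      c (x \<oplus>\<^bsub>R\<^esub> y) = c x + c y \<and> c (x \<otimes>\<^bsub>R\<^esub> y) = m (c x) (c y)"
    and c1: "c \<one>\<^bsub>R\<^esub> = u" and surj: "c ` carrier R = UNIV"
    using so unfolding surjects_onto_def by blast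
  have "(t \<circ> c) ` carrier R = UNIV" by (simp only: image_comp[symmetric] surj t(1))
  then show ?thesis
    unfolding surjects_onto_def using c c1 t(2,3) by (intro exI[of _ "t \<circ> c"]) simp
qed

lemma surjects_onto_op:
  assumes "surjects_onto (op_ring R) m u"
  shows "surjects_onto R (\<lambda>p q. m q p) u"
proof -
  obtain c where c: "\<And>x y. x \<in> carrier R \<Longrightarrow> y \<in> carrier R \<Longrightarrow>
      c (x \<oplus>\<^bsub>R\<^esub> y) = c x + c y \<and> c (y \<otimes>\<^bsub>R\<^esub> x) = m (c x) (c y)"
    and "c \<one>\<^bsub>R\<^esub> = u" "c ` carrier R = UNIV"
    using assms unfolding surjects_onto_def op_ring_simps by blast
  then show ?thesis unfolding surjects_onto_def by (intro exI[of _ c]) simp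
qed

section \<open>Multiplication tables in characteristic two\<close>

context four_cover_split
begin

definition bs :: "bit \<Rightarrow> 'a \<Rightarrow> 'a" where "bs k x = (if k = 0 then \<zero> else x)"

lemma bs_simps [simp]: "bs 0 x = \<zero>" "bs 1 x = x" "bs k \<zero> = \<zero>"
  by (simp_all add: bs_def)

lemma bs_closed [simp]: "x \<in> carrier R \<Longrightarrow> bs k x \<in> carrier R"
  by (simp add: bs_def)

lemma bs_add_left: "x \<in> carrier R \<Longrightarrow> bs (k + l) x = bs k x \<oplus> bs l x"
  by (cases k; cases l) (simp_all add: char_2)

lemma bs_add_right: "bs k (x \<oplus> y) = bs k x \<oplus> bs k y"
  by (simp add: bs_def)

lemma bs_mult: "x \<in> carrier R \<Longrightarrow> y \<in> carrier R \<Longrightarrow> bs k x \<otimes> bs l y = bs (k * l) (x \<otimes> y)"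
  by (cases k; cases l) simp_all

lemma bs_mult_left: "x \<in> carrier R \<Longrightarrow> y \<in> carrier R \<Longrightarrow> bs k x \<otimes> y = bs k (x \<otimes> y)"
  by (cases k) simp_all

lemma bs_mult_right: "x \<in> carrier R \<Longrightarrow> y \<in> carrier R \<Longrightarrow> x \<otimes> bs k y = bs k (x \<otimes> y)"
  by (cases k) simp_all

lemma bs_bs: "bs k (bs l x) = bs (k * l) x"
  by (cases k; cases l) simp_all

lemma bs_eq_zero: "bs k x = \<zero> \<Longrightarrow> x \<noteq> \<zero> \<Longrightarrow> k = 0"
  by (cases k) simp_all

lemma minus_char_2: "x \<in> carrier R \<Longrightarrow> \<ominus> x = x"
  using char_2[of x] by (metis minus_equality)

lemma eq_if_add_zero: "x \<in> carrier R \<Longrightarrow> y \<in> carrier R \<Longrightarrow> x \<oplus> y = \<zero> \<Longrightarrow> x = y"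
  using minus_equality[of x y] minus_char_2[of y] by simp

lemma cancel2: "x \<in> carrier R \<Longrightarrow> y \<in> carrier R \<Longrightarrow> (x \<oplus> y) \<oplus> y = x"
  by (simp add: a_assoc char_2)

definition f where "f = \<one> \<oplus> c"

lemma f: "f \<in> A1" "f \<in> A2" "f \<in> carrier R" "\<not> lact A1 R f" "lact A2 R f"
  "ract A1 R f \<longleftrightarrow> \<not> ract A1 R c" "ract A2 R f \<longleftrightarrow> \<not> ract A2 R c"
proof -
  have e: "f = \<one> \<ominus> c" by (simp add: f_def minus_eq minus_char_2)
  show "f \<in> A1" "f \<in> A2" "f \<in> carrier R"
    using sub_rules(3)[OF one_in(1) c(1)] sub_rules(9)[OF one_in(2) c(2)] by (simp_all add: f_def)
  show "\<not> lact A1 R f" "lact A2 R f" "ract A1 R f \<longleftrightarrow> \<not> ract A1 R c" "ract A2 R f \<longleftrightarrow> \<not> ract A2 R c"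
    unfolding e
    using index2_subring.lact_one_diff[OF index2_A1 c(1)] index2_subring.lact_one_diff[OF index2_A2 c(2)]
      index2_subring.ract_one_diff[OF index2_A1 c(1)] index2_subring.ract_one_diff[OF index2_A2 c(2)] c(3,4) by blast+
qed

text \<open>The intersection {0, 1} has index 2 in A1 and A2 together, and c represents the other
  coset.\<close>

lemma both: "x \<in> A1 \<Longrightarrow> x \<in> A2 \<Longrightarrow> x = \<zero> \<or> x = \<one> \<or> x = c \<or> x = f"
proof -
  assume x: "x \<in> A1" "x \<in> A2"
  have xc: "x \<in> carrier R" using in_carrier(1)[OF x(1)] .
  show ?thesis
  proof (cases "x \<in> A3")
    case True
    then show ?thesis using meet_eq meetI x by blast
  next
    case False
    then have "x \<oplus> c \<in> A3" using four_cover_pair.index2_meet[OF pair_c x c(1,2)] c3 by blast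
    then have "x \<oplus> c \<in> meet" using meetI sub_rules(3)[OF x(1) c(1)] sub_rules(9)[OF x(2) c(2)] by blast
    then have "(x \<oplus> c) \<oplus> c = \<zero> \<oplus> c \<or> (x \<oplus> c) \<oplus> c = \<one> \<oplus> c" using meet_eq by metis
    then show ?thesis using cancel2[OF xc c_carrier] by (simp add: f_def)
  qed
qed

text \<open>The pair of left actions separates 0, 1, c and f, and c c has the same pair as
  c.\<close>

lemma cc: "c \<otimes> c = c"
proof -
  have m: "c \<otimes> c \<in> A1" "c \<otimes> c \<in> A2" using sub_rules(6)[OF c(1) c(1)] sub_rules(12)[OF c(2) c(2)] by blast+
  have "lact A1 R (c \<otimes> c)" "\<not> lact A2 R (c \<otimes> c)"
    using index2_subring.lact_mult[OF index2_A1 c(1) c(1)] index2_subring.lact_mult[OF index2_A2 c(2) c(2)] c by blast+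
  then have n: "c \<otimes> c \<noteq> \<zero>" "c \<otimes> c \<noteq> \<one>" "c \<otimes> c \<noteq> f"
    using index2_subring.lact_one[OF index2_A2] f(4) sub_rules(2) by (auto simp: lact_def)
  then show ?thesis using both[OF m] by blast
qed

lemma idem: "c \<otimes> f = \<zero>" "f \<otimes> c = \<zero>" "f \<otimes> f = f" "c \<oplus> f = \<one>" "c \<noteq> \<zero>" "f \<noteq> \<zero>"
proof -
  show 1: "c \<otimes> f = \<zero>" "f \<otimes> c = \<zero>" by (simp_all add: f_def l_distr r_distr cc char_2)
  then show "f \<otimes> f = f" using f(3) by (simp add: f_def l_distr)
  show "c \<oplus> f = \<one>" using cancel2[of \<one> c] a_comm[of c f] f(3) by (simp add: f_def)
  show "c \<noteq> \<zero>" using c3 sub_rules(14) by metis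
  show "f \<noteq> \<zero>" using f(5) sub_rules(8) by (auto simp: lact_def)
qed

lemma spanned:
  assumes U: "U \<in> A2" "U \<notin> A1" and V: "V \<in> A1" "V \<notin> A2" and r: "r \<in> carrier R"
  shows "\<exists>x y z w. r = bs x c \<oplus> bs y U \<oplus> bs z f \<oplus> bs w V"
proof -
  have XY: "U \<in> carrier R" "V \<in> carrier R" using U V in_carrier by blast+
  have B: "\<exists>x z. q = bs x c \<oplus> bs z f" if "q \<in> A1" "q \<in> A2" for q
  proof -
    have "\<zero> = bs 0 c \<oplus> bs 0 f" "\<one> = bs 1 c \<oplus> bs 1 f" "c = bs 1 c \<oplus> bs 0 f" "f = bs 0 c \<oplus> bs 1 f"
      using idem(4) f(3) by simp_all
    then show ?thesis using both[OF that] by metis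
  qed
  \<comment> \<open>y and w record whether r misses A1 and A2. Adding U corrects A1 without touching
    A2, and V does the reverse.\<close>
  define y w :: bit where "y = (if r \<in> A1 then 0 else 1)" and "w = (if r \<in> A2 then 0 else 1)"
  define q where "q = (r \<oplus> bs y U) \<oplus> bs w V"
  have q1: "q \<in> A1"
    using index2_1[of r "bs y U"] index2_1[of "r \<oplus> bs y U" "bs w V"] r XY U V sub_rules(2)
    by (simp add: q_def y_def w_def)
  have q2: "q \<in> A2"
    using index2_2[of r "bs y U"] index2_2[of "r \<oplus> bs y U" "bs w V"] r XY U V sub_rules(8)
    by (simp add: q_def y_def w_def)
  obtain x z where xz: "q = bs x c \<oplus> bs z f" using B[OF q1 q2] by blast
  have "(q \<oplus> bs w V) \<oplus> bs y U = r"
    unfolding q_def using cancel2[of "r \<oplus> bs y U" "bs w V"] cancel2[of r "bs y U"] r XY by simp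
  then have "r = bs x c \<oplus> bs y U \<oplus> bs z f \<oplus> bs w V"
    unfolding xz using XY f(3) by (simp add: a_ac)
  then show ?thesis by blast
qed

lemma independent:
  assumes U: "U \<in> A2" "U \<notin> A1" and V: "V \<in> A1" "V \<notin> A2"
    and z: "bs x c \<oplus> bs y U \<oplus> bs z f \<oplus> bs w V = \<zero>"
  shows "x = 0 \<and> y = 0 \<and> z = 0 \<and> w = 0"
proof -
  have XY: "U \<in> carrier R" "V \<in> carrier R" using U V in_carrier by blast+
  have m: "bs k q \<in> A1" if "q \<in> A1" for k q using that sub_rules(2) by (simp add: bs_def)
  have m2: "bs k q \<in> A2" if "q \<in> A2" for k q using that sub_rules(8) by (simp add: bs_def)
  have y: "y = 0"
  proof -
    have "bs y U \<in> A1"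
      using z sub_rules(2) index2_1[of "bs x c \<oplus> bs y U \<oplus> bs z f" "bs w V"] index2_1[of "bs x c \<oplus> bs y U" "bs z f"]
        index2_1[of "bs x c" "bs y U"] m[OF c(1), of x] m[OF f(1), of z] m[OF V(1), of w] XY f(3) by simp
    then show ?thesis using U by (cases y) simp_all
  qed
  have w: "w = 0"
  proof -
    have "bs w V \<in> A2"
      using z sub_rules(8) index2_2[of "bs x c \<oplus> bs y U \<oplus> bs z f" "bs w V"] index2_2[of "bs x c \<oplus> bs y U" "bs z f"]
        index2_2[of "bs x c" "bs y U"] m2[OF c(2), of x] m2[OF f(2), of z] m2[OF U(1), of y] XY f(3) by simp
    then show ?thesis using V by (cases w) simp_all
  qed
  have xz: "bs x c \<oplus> bs z f = \<zero>" using z f(3) by (simp add: y w)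
  have "c \<otimes> (bs x c \<oplus> bs z f) = bs x c" "f \<otimes> (bs x c \<oplus> bs z f) = bs z f"
    using f(3) idem cc by (simp_all add: r_distr bs_mult_right)
  note h = this[unfolded xz]
  have "bs x c = \<zero>" by (rule trans[OF h(1)[symmetric] r_null[OF c_carrier]])
  moreover have "bs z f = \<zero>" by (rule trans[OF h(2)[symmetric] r_null[OF f(3)]])
  ultimately show ?thesis using bs_eq_zero idem(5,6) y w by blast
qed

lemma coordinates:
  assumes U: "U \<in> A2" "U \<notin> A1" and V: "V \<in> A1" "V \<notin> A2"
    and g: "g = (\<lambda>((x, y), (z, w)). bs x c \<oplus> bs y U \<oplus> bs z f \<oplus> bs w V)"
    and m: "\<And>p q. g (m p q) = g p \<otimes> g q"
  shows "surjects_onto R m ((1, 0), (1, 0))"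
proof (rule surjects_ontoI[OF zeroideal, where g = g])
  have XY: "U \<in> carrier R" "V \<in> carrier R" using U V in_carrier by blast+
  fix p q :: "(bit \<times> bit) \<times> (bit \<times> bit)"
  obtain x y z w where p: "p = ((x, y), (z, w))" by (metis surj_pair)
  obtain x' y' z' w' where q: "q = ((x', y'), (z', w'))" by (metis surj_pair)
  show "g p \<in> carrier R" using XY f(3) by (simp add: g p)
  show "g (p + q) = g p \<oplus> g q" using XY f(3) by (simp add: g p q bs_add_left a_ac del: add_bit_eq_xor)
  show "g (m p q) = g p \<otimes> g q" by (rule m)
  show "p = 0" if "g p \<in> {\<zero>}" using independent[OF U V] that by (simp add: g p zero_prod_def)
next
  show "g ((1, 0), (1, 0)) = \<one>" using idem(4) f(3) by (simp add: g)
  have XY: "U \<in> carrier R" "V \<in> carrier R" using U V in_carrier by blast+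
  fix r assume r: "r \<in> carrier R"
  obtain x y z w where "r = bs x c \<oplus> bs y U \<oplus> bs z f \<oplus> bs w V" using spanned[OF U V r] by blast
  then have "g ((x, y), (z, w)) = r" by (simp add: g)
  then have "r \<ominus> g ((x, y), (z, w)) \<in> {\<zero>}" using r by (simp add: minus_eq r_neg)
  then show "\<exists>p. r \<ominus> g p \<in> {\<zero>}" by blast
qed

lemma ex_12: obtains a1 a2 where "a1 \<in> A1" "a1 \<notin> A2" "a2 \<in> A2" "a2 \<notin> A1" "a1 \<in> carrier R" "a2 \<in> carrier R"
proof -
  obtain a1 y where 1: "a1 \<in> A1" "a1 \<notin> A2" by (rule ex_outside)
  obtain a2 y where 2: "a2 \<in> A2" "a2 \<notin> A1" by (rule four_cover_pair.ex_outside[OF perm12_pair])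
  show ?thesis by (rule that[OF 1 2 in_carrier(1)[OF 1(1)] in_carrier(2)[OF 2(1)]])
qed

text \<open>c acts as 1 on R / A1 and 0 on R / A2 from both sides, so U in c R c and V in f R f keep
  the position of a2 and a1. R is then a product of two rings F_2[t] / (t^2 + \<open>\<xi>\<close> t
  + \<open>\<eta>\<close>), one for each corner.\<close>

lemma ract_case:
  assumes "ract A1 R c" "\<not> ract A2 R c"
  shows "surjects_onto R mult_F4_F4 ((1, 0), (1, 0))"
proof -
  obtain a1 a2 where a: "a1 \<in> A1" "a1 \<notin> A2" "a2 \<in> A2" "a2 \<notin> A1" "a1 \<in> carrier R" "a2 \<in> carrier R"
    by (rule ex_12)
  define U V where "U = c \<otimes> a2 \<otimes> c" and "V = f \<otimes> a1 \<otimes> f"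
  have XY: "U \<in> carrier R" "V \<in> carrier R" using a f(3) by (simp_all add: U_def V_def)
  have ca: "c \<otimes> a2 \<in> carrier R" "f \<otimes> a1 \<in> carrier R" using a f(3) by simp_all
  have U: "U \<in> A2" "U \<notin> A1"
  proof -
    show "U \<in> A2" unfolding U_def using c a sub_rules(12) by blast
    show "U \<notin> A1" unfolding U_def using lact1[OF c(1) a(6)] ract1[OF c(1) ca(1)] a assms c by blast
  qed
  have V: "V \<in> A1" "V \<notin> A2"
  proof -
    show "V \<in> A1" unfolding V_def using f a sub_rules(6) by blast
    show "V \<notin> A2" unfolding V_def using lact2[OF f(2) a(5)] ract2[OF f(2) ca(2)] a assms f by blast
  qed
  have cX: "c \<otimes> U = U" "U \<otimes> c = U" "f \<otimes> U = \<zero>" "U \<otimes> f = \<zero>"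
    and fY: "f \<otimes> V = V" "V \<otimes> f = V" "c \<otimes> V = \<zero>" "V \<otimes> c = \<zero>"
  proof -
    have l: "p \<otimes> (p' \<otimes> a \<otimes> q) = (p \<otimes> p') \<otimes> (a \<otimes> q)" "(p \<otimes> a \<otimes> q) \<otimes> q' = (p \<otimes> a) \<otimes> (q \<otimes> q')"
      if "p \<in> carrier R" "p' \<in> carrier R" "q \<in> carrier R" "q' \<in> carrier R" "a \<in> carrier R" for p p' q q' a
      using that by (simp_all add: m_assoc)
    show "c \<otimes> U = U" "U \<otimes> c = U" "f \<otimes> U = \<zero>" "U \<otimes> f = \<zero>" "f \<otimes> V = V" "V \<otimes> f = V" "c \<otimes> V = \<zero>" "V \<otimes> c = \<zero>"
      unfolding U_def V_def using a f(3) by (simp_all add: l cc idem) (simp_all add: m_assoc)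
  qed
  have XYz: "U \<otimes> V = \<zero>" "V \<otimes> U = \<zero>"
  proof -
    have "U \<otimes> V = (U \<otimes> c) \<otimes> V" using cX by simp
    also have "\<dots> = U \<otimes> (c \<otimes> V)" by (rule m_assoc[OF XY(1) c_carrier XY(2)])
    finally show "U \<otimes> V = \<zero>" using fY XY by simp
    have "V \<otimes> U = (V \<otimes> f) \<otimes> U" using fY by simp
    also have "\<dots> = V \<otimes> (f \<otimes> U)" by (rule m_assoc[OF XY(2) f(3) XY(1)])
    finally show "V \<otimes> U = \<zero>" using cX XY by simp
  qed
  obtain \<eta> \<xi> where XX: "U \<otimes> U = bs \<eta> c \<oplus> bs \<xi> U"
  proof -
    obtain x y z w where r: "U \<otimes> U = bs x c \<oplus> bs y U \<oplus> bs z f \<oplus> bs w V"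
      using spanned[OF U V, of "U \<otimes> U"] XY by blast
    have "U \<otimes> U = c \<otimes> (U \<otimes> U)" using m_assoc[OF c_carrier XY(1) XY(1)] cX by simp
    also have "\<dots> = bs x c \<oplus> bs y U" unfolding r using XY f(3) by (simp add: r_distr bs_mult_right cc cX fY idem)
    finally show ?thesis by (rule that)
  qed
  obtain \<eta>' \<xi>' where YY: "V \<otimes> V = bs \<eta>' f \<oplus> bs \<xi>' V"
  proof -
    obtain x y z w where r: "V \<otimes> V = bs x c \<oplus> bs y U \<oplus> bs z f \<oplus> bs w V"
      using spanned[OF U V, of "V \<otimes> V"] XY by blast
    have "V \<otimes> V = f \<otimes> (V \<otimes> V)" using m_assoc[OF f(3) XY(2) XY(2)] fY by simp
    also have "\<dots> = bs z f \<oplus> bs w V" unfolding r using XY f(3) by (simp add: r_distr bs_mult_right cc cX fY idem)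
    finally show ?thesis by (rule that)
  qed
  define m where "m = (\<lambda>((x, y), (z, w)) ((x', y'), (z', w')).
    ((x * x' + \<eta> * (y * y'), x * y' + y * x' + \<xi> * (y * y')),
     (z * z' + \<eta>' * (w * w'), z * w' + w * z' + \<xi>' * (w * w'))))"
  define g where "g = (\<lambda>((x, y), (z, w)). bs x c \<oplus> bs y U \<oplus> bs z f \<oplus> bs w V)"
  have so: "surjects_onto R m ((1, 0), (1, 0))"
  proof (rule coordinates[OF U V g_def])
    fix p q :: "(bit \<times> bit) \<times> (bit \<times> bit)"
    obtain x y z w where p: "p = ((x, y), (z, w))" by (metis surj_pair)
    obtain x' y' z' w' where q: "q = ((x', y'), (z', w'))" by (metis surj_pair)
    show "g (m p q) = g p \<otimes> g q"
      using XY f(3)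
      by (simp add: g_def p q m_def l_distr r_distr bs_mult cc idem cX fY XYz XX YY bs_add_left bs_add_right bs_bs mult_ac a_ac
          del: add_bit_eq_xor mult_bit_eq_and)
  qed
  define u where "u = U \<oplus> V"
  have uc: "u \<in> carrier R" using XY by (simp add: u_def)
  have u12: "u \<notin> A1" "u \<notin> A2" using U V XY by (simp_all add: u_def)
  have uu: "u \<otimes> u = g ((\<eta>, \<xi>), (\<eta>', \<xi>'))"
    using XY f(3) by (simp add: u_def l_distr r_distr XYz XX YY g_def a_ac)
  have gadd: "g p \<oplus> g q = g (p + q)" for p q
  proof -
    obtain x y z w where p: "p = ((x, y), (z, w))" by (metis surj_pair)
    obtain x' y' z' w' where q: "q = ((x', y'), (z', w'))" by (metis surj_pair)
    show ?thesis using XY f(3) by (simp add: p q g_def bs_add_left a_ac del: add_bit_eq_xor)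
  qed
  have ginj: "p = q" if "g p = g q" for p q
  proof -
    have gc: "g r \<in> carrier R" for r
    proof -
      obtain x y z w where "r = ((x, y), (z, w))" by (metis surj_pair)
      then show ?thesis using XY f(3) by (simp add: g_def)
    qed
    have "g (p + q) = \<zero>" using that gadd[of p q] char_2[OF gc[of q]] by simp
    moreover obtain x y z w where pq: "p + q = ((x, y), (z, w))" by (metis surj_pair)
    ultimately have "p + q = 0" using independent[OF U V] by (simp add: g_def zero_prod_def)
    moreover have "- q = q"
    proof -
      obtain x y z w where "q = ((x, y), (z, w))" by (metis surj_pair)
      then show ?thesis by simp
    qed
    ultimately show ?thesis using add_eq_0_iff2[of p q] by simp
  qed
  have ge: "\<zero> = g ((0, 0), (0, 0))" "\<one> = g ((1, 0), (1, 0))" "u = g ((0, 1), (0, 1))" "c = g ((1, 0), (0, 0))"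
    using XY f(3) idem(4) by (simp_all add: g_def u_def)
  \<comment> \<open>Adding p moves an element of A3 outside A1 into the intersection {0, 1}, so A3 =
    {0, 1, p, p + 1}.\<close>
  have A3_form: "q = \<zero> \<or> q = \<one> \<or> q = p \<or> q = p \<oplus> \<one>"
    if q: "q \<in> A3" and p: "p \<in> A3" "p \<notin> A1" "p \<notin> A2" for p q
  proof -
    have qc: "q \<in> carrier R" "p \<in> carrier R" using q p in_carrier(3) by blast+
    show ?thesis
    proof (cases "q \<in> A1")
      case True
      then show ?thesis using meet_eq meetI small3[OF q] q by blast
    next
      case False
      then have "q \<oplus> p \<in> A1" "q \<oplus> p \<in> A2" "q \<oplus> p \<in> A3"
        using small3[OF q] index2_1[OF qc] index2_2[OF qc] p sub_rules(15)[OF q p(1)] by blast+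
      then have "q \<oplus> p = \<zero> \<or> q \<oplus> p = \<one>" using meet_eq meetI by blast
      then have "(q \<oplus> p) \<oplus> p = p \<or> (q \<oplus> p) \<oplus> p = p \<oplus> \<one>" using qc by (auto simp: a_comm)
      then show ?thesis using cancel2[OF qc] by simp
    qed
  qed
  \<comment> \<open>u = U + V is outside A1 and A2, so u or u + c is in A3, whose four elements are
    known. Locating its square among them shows that both quadratics are irreducible or neither
    is.\<close>
  have cond: "\<eta> * \<xi> = \<eta>' * \<xi>'"
  proof (cases "u \<in> A3")
    case True
    have "u \<otimes> u = \<zero> \<or> u \<otimes> u = \<one> \<or> u \<otimes> u = u \<or> u \<otimes> u = u \<oplus> \<one>"
      by (rule A3_form[OF sub_rules(18)[OF True True] True u12])
    then have "g ((\<eta>, \<xi>), (\<eta>', \<xi>')) = g ((0, 0), (0, 0)) \<or> g ((\<eta>, \<xi>), (\<eta>', \<xi>')) = g ((1, 0), (1, 0)) \<or>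
        g ((\<eta>, \<xi>), (\<eta>', \<xi>')) = g ((0, 1), (0, 1)) \<or>
        g ((\<eta>, \<xi>), (\<eta>', \<xi>')) = g (((0, 1), (0, 1)) + ((1, 0), (1, 0)))"
      unfolding uu[symmetric] gadd[symmetric] ge(1)[symmetric] ge(2)[symmetric] ge(3)[symmetric] .
    then have "((\<eta>, \<xi>), (\<eta>', \<xi>')) = ((0, 0), (0, 0)) \<or> ((\<eta>, \<xi>), (\<eta>', \<xi>')) = ((1, 0), (1, 0)) \<or>
        ((\<eta>, \<xi>), (\<eta>', \<xi>')) = ((0, 1), (0, 1)) \<or>
        ((\<eta>, \<xi>), (\<eta>', \<xi>')) = ((0, 1), (0, 1)) + ((1, 0), (1, 0))"
      using ginj by blast
    then show ?thesis by auto
  next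
    case False
    define v where "v = u \<oplus> c"
    have v3: "v \<in> A3" unfolding v_def
      using four_cover_pair.outside_add_b[OF pair_c uc u12] False by blast
    have v12: "v \<notin> A1" "v \<notin> A2" unfolding v_def using u12 c uc by simp_all
    have cu: "c \<otimes> u = U" "u \<otimes> c = U" using XY by (simp_all add: u_def l_distr r_distr cX fY)
    have "v \<otimes> v = (u \<otimes> u \<oplus> c) \<oplus> (U \<oplus> U)"
      using uc XY by (simp add: v_def l_distr r_distr cu cc a_ac)
    then have "v \<otimes> v = u \<otimes> u \<oplus> c" using char_2[OF XY(1)] uc by simp
    moreover have "v \<otimes> v = \<zero> \<or> v \<otimes> v = \<one> \<or> v \<otimes> v = v \<or> v \<otimes> v = v \<oplus> \<one>"
      by (rule A3_form[OF sub_rules(18)[OF v3 v3] v3 v12])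
    ultimately have "u \<otimes> u \<oplus> c = \<zero> \<or> u \<otimes> u \<oplus> c = \<one> \<or> u \<otimes> u \<oplus> c = u \<oplus> c \<or> u \<otimes> u \<oplus> c = u \<oplus> c \<oplus> \<one>"
      unfolding v_def by simp
    then have "g (((\<eta>, \<xi>), (\<eta>', \<xi>')) + ((1, 0), (0, 0))) = g ((0, 0), (0, 0)) \<or>
        g (((\<eta>, \<xi>), (\<eta>', \<xi>')) + ((1, 0), (0, 0))) = g ((1, 0), (1, 0)) \<or>
        g (((\<eta>, \<xi>), (\<eta>', \<xi>')) + ((1, 0), (0, 0))) = g (((0, 1), (0, 1)) + ((1, 0), (0, 0))) \<or>
        g (((\<eta>, \<xi>), (\<eta>', \<xi>')) + ((1, 0), (0, 0))) = g (((0, 1), (0, 1)) + ((1, 0), (0, 0)) + ((1, 0), (1, 0)))"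
      unfolding gadd[symmetric] uu[symmetric] ge(1)[symmetric] ge(2)[symmetric] ge(3)[symmetric] ge(4)[symmetric] .
    then have "((\<eta>, \<xi>), (\<eta>', \<xi>')) + ((1, 0), (0, 0)) = ((0, 0), (0, 0)) \<or>
        ((\<eta>, \<xi>), (\<eta>', \<xi>')) + ((1, 0), (0, 0)) = ((1, 0), (1, 0)) \<or>
        ((\<eta>, \<xi>), (\<eta>', \<xi>')) + ((1, 0), (0, 0)) = ((0, 1), (0, 1)) + ((1, 0), (0, 0)) \<or>
        ((\<eta>, \<xi>), (\<eta>', \<xi>')) + ((1, 0), (0, 0)) = ((0, 1), (0, 1)) + ((1, 0), (0, 0)) + ((1, 0), (1, 0))"
      using ginj by blast
    then show ?thesis by (cases \<eta>; cases \<xi>; cases \<eta>'; cases \<xi>'; simp)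
  qed
  show ?thesis
  proof (cases "\<eta> * \<xi> = 0")
    case True
    \<comment> \<open>A reducible quadratic t^2 + \<open>\<xi>\<close> t + \<open>\<eta>\<close>
      over F_2 has \<open>\<eta>\<close> as a root, so U can be sent to \<open>\<eta>\<close>; each
      factor gives one map onto F_2.\<close>
    define \<phi> :: "(bit \<times> bit) \<times> (bit \<times> bit) \<Rightarrow> bit" where "\<phi> = (\<lambda>((x, y), (z, w)). x + \<eta> * y)"
    define \<psi> :: "(bit \<times> bit) \<times> (bit \<times> bit) \<Rightarrow> bit" where "\<psi> = (\<lambda>((x, y), (z, w)). z + \<eta>' * w)"
    have additive: "i + j + k * (i' + j') = (i + k * i') + (j + k * j')" for i j i' j' k :: bit
      by (cases i; cases j; cases k; cases i'; cases j'; simp)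
    have multiplicative: "i * j + k * (i' * j') + k * (i * j' + i' * j + l * (i' * j')) = (i + k * i') * (j + k * j')"
      if "k * l = 0" for i j i' j' k l :: bit
      using that by (cases k; cases l; cases i; cases j; cases i'; cases j'; simp)
    have "three_cover R"
    proof (rule surjects_onto_three_cover[OF ring_axioms so, where \<phi> = \<phi> and \<psi> = \<psi>])
      fix p q :: "(bit \<times> bit) \<times> (bit \<times> bit)"
      obtain x y z w where p: "p = ((x, y), (z, w))" by (metis surj_pair)
      obtain x' y' z' w' where q: "q = ((x', y'), (z', w'))" by (metis surj_pair)
      show "\<phi> (p + q) = \<phi> p + \<phi> q" "\<psi> (p + q) = \<psi> p + \<psi> q"
        unfolding p q \<phi>_def \<psi>_def add_Pair prod.case by (rule additive)+
      show "\<phi> (m p q) = \<phi> p * \<phi> q" "\<psi> (m p q) = \<psi> p * \<psi> q"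
        unfolding p q \<phi>_def \<psi>_def m_def prod.case
        using True cond by (auto intro!: multiplicative simp del: add_bit_eq_xor mult_bit_eq_and)
    next
      show "\<exists>p. \<phi> p \<noteq> 0" by (rule exI[of _ "((1, 0), (0, 0))"]) (simp add: \<phi>_def)
      show "\<exists>p. \<psi> p \<noteq> 0" by (rule exI[of _ "((0, 0), (1, 0))"]) (simp add: \<psi>_def)
      show "\<exists>p. \<phi> p \<noteq> \<psi> p" by (rule exI[of _ "((1, 0), (0, 0))"]) (simp add: \<phi>_def \<psi>_def)
    qed
    then show ?thesis using no_three_cover by blast
  next
    case False
    then have 1: "\<eta> = 1" "\<xi> = 1" "\<eta>' = 1" "\<xi>' = 1"
      using cond by (cases \<eta>; cases \<xi>; cases \<eta>'; cases \<xi>'; simp)+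
    have "m = mult_F4_F4"
      by (intro ext) (auto simp: m_def mult_F4_F4_def mult_F4_def 1 split: prod.splits)
    then show ?thesis using so by simp
  qed
qed

text \<open>The left and right actions of c are opposite, so U lies in c R f and V in f R c, like
  the off-diagonal matrix units.\<close>

lemma ract_case':
  assumes "\<not> ract A1 R c" "ract A2 R c"
  shows "surjects_onto R mult_M2 (1, 0, 0, 1)"
proof -
  obtain a1 a2 where a: "a1 \<in> A1" "a1 \<notin> A2" "a2 \<in> A2" "a2 \<notin> A1" "a1 \<in> carrier R" "a2 \<in> carrier R"
    by (rule ex_12)
  define U V where "U = c \<otimes> a2 \<otimes> f" and "V = f \<otimes> a1 \<otimes> c"
  have XY: "U \<in> carrier R" "V \<in> carrier R" using a f(3) by (simp_all add: U_def V_def)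
  have ca: "c \<otimes> a2 \<in> carrier R" "f \<otimes> a1 \<in> carrier R" using a f(3) by simp_all
  have U: "U \<in> A2" "U \<notin> A1"
  proof -
    show "U \<in> A2" unfolding U_def using c f a sub_rules(12) by blast
    show "U \<notin> A1" unfolding U_def using lact1[OF c(1) a(6)] ract1[OF f(1) ca(1)] a assms c f by blast
  qed
  have V: "V \<in> A1" "V \<notin> A2"
  proof -
    show "V \<in> A1" unfolding V_def using c f a sub_rules(6) by blast
    show "V \<notin> A2" unfolding V_def using lact2[OF f(2) a(5)] ract2[OF c(2) ca(2)] a assms f by blast
  qed
  have cX: "c \<otimes> U = U" "U \<otimes> c = \<zero>" "f \<otimes> U = \<zero>" "U \<otimes> f = U"
    and fY: "f \<otimes> V = V" "V \<otimes> f = \<zero>" "c \<otimes> V = \<zero>" "V \<otimes> c = V"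
  proof -
    have l: "p \<otimes> (p' \<otimes> a \<otimes> q) = (p \<otimes> p') \<otimes> (a \<otimes> q)" "(p \<otimes> a \<otimes> q) \<otimes> q' = (p \<otimes> a) \<otimes> (q \<otimes> q')"
      if "p \<in> carrier R" "p' \<in> carrier R" "q \<in> carrier R" "q' \<in> carrier R" "a \<in> carrier R" for p p' q q' a
      using that by (simp_all add: m_assoc)
    show "c \<otimes> U = U" "U \<otimes> c = \<zero>" "f \<otimes> U = \<zero>" "U \<otimes> f = U" "f \<otimes> V = V" "V \<otimes> f = \<zero>" "c \<otimes> V = \<zero>" "V \<otimes> c = V"
      unfolding U_def V_def using a f(3) by (simp_all add: l cc idem) (simp_all add: m_assoc)
  qed
  have sq: "x \<otimes> y = \<zero>" if "x \<in> carrier R" "y \<in> carrier R" "e \<in> carrier R" "x \<otimes> e = x" "e \<otimes> y = \<zero>" for x y e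
  proof -
    have "x \<otimes> y = (x \<otimes> e) \<otimes> y" using that by simp
    also have "\<dots> = x \<otimes> (e \<otimes> y)" by (rule m_assoc[OF that(1,3,2)])
    finally show ?thesis using that by simp
  qed
  have z: "U \<otimes> U = \<zero>" "V \<otimes> V = \<zero>"
    by (rule sq[OF XY(1) XY(1) f(3)], fact cX, fact cX, rule sq[OF XY(2) XY(2) c_carrier], fact fY, fact fY)
  obtain \<xi> where UV: "U \<otimes> V = bs \<xi> c"
  proof -
    obtain x y z w where r: "U \<otimes> V = bs x c \<oplus> bs y U \<oplus> bs z f \<oplus> bs w V"
      using spanned[OF U V, of "U \<otimes> V"] XY by blast
    have "U \<otimes> V = c \<otimes> (U \<otimes> V) \<otimes> c"
      using m_assoc[OF c_carrier XY(1) XY(2)] m_assoc[OF XY(1) XY(2) c_carrier] cX fY by simp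
    also have "\<dots> = bs x c" unfolding r using XY f(3)
      by (simp add: l_distr r_distr bs_mult_left bs_mult_right cc cX fY idem)
    finally show ?thesis by (rule that)
  qed
  obtain \<zeta> where VU: "V \<otimes> U = bs \<zeta> f"
  proof -
    obtain x y z w where r: "V \<otimes> U = bs x c \<oplus> bs y U \<oplus> bs z f \<oplus> bs w V"
      using spanned[OF U V, of "V \<otimes> U"] XY by blast
    have "V \<otimes> U = f \<otimes> (V \<otimes> U) \<otimes> f"
      using m_assoc[OF f(3) XY(2) XY(1)] m_assoc[OF XY(2) XY(1) f(3)] cX fY by simp
    also have "\<dots> = bs z f" unfolding r using XY f(3)
      by (simp add: l_distr r_distr bs_mult_left bs_mult_right cc cX fY idem)
    finally show ?thesis by (rule that)
  qed
  \<comment> \<open>(U V) U and U (V U) are the two multiples of U.\<close>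
  have eq: "\<zeta> = \<xi>"
  proof -
    have "(U \<otimes> V) \<otimes> U = U \<otimes> (V \<otimes> U)" by (rule m_assoc[OF XY(1) XY(2) XY(1)])
    then have e: "bs \<xi> U = bs \<zeta> U" using XY f(3) by (simp add: UV VU bs_mult_left bs_mult_right cX)
    have "U \<noteq> \<zero>" using U sub_rules(2) by metis
    then show ?thesis using e by (cases \<xi>; cases \<zeta>) auto
  qed
  define m where "m = (\<lambda>((x, y), (z, w)) ((x', y'), (z', w')).
    ((x * x' + \<xi> * (y * w'), x * y' + y * z'), (z * z' + \<xi> * (w * y'), w * x' + z * w')))"
  define g where "g = (\<lambda>((x, y), (z, w)). bs x c \<oplus> bs y U \<oplus> bs z f \<oplus> bs w V)"
  have so: "surjects_onto R m ((1, 0), (1, 0))"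
  proof (rule coordinates[OF U V g_def])
    fix p q :: "(bit \<times> bit) \<times> (bit \<times> bit)"
    obtain x y z' w where p: "p = ((x, y), (z', w))" by (metis surj_pair)
    obtain x' y' z'' w' where q: "q = ((x', y'), (z'', w'))" by (metis surj_pair)
    show "g (m p q) = g p \<otimes> g q"
      using XY f(3)
      by (simp add: g_def p q m_def l_distr r_distr bs_mult cc idem cX fY z UV VU eq bs_add_left bs_add_right bs_bs mult_ac a_ac
          del: add_bit_eq_xor mult_bit_eq_and)
  qed
  show ?thesis
  proof (cases "\<xi> = 0")
    case True
    \<comment> \<open>With \<open>\<xi>\<close> = 0 the off-diagonal products vanish, so both
      diagonal coordinates are homomorphisms onto F_2.\<close>
    define \<phi> :: "(bit \<times> bit) \<times> (bit \<times> bit) \<Rightarrow> bit" where "\<phi> = (\<lambda>((x, y), (z, w)). x)"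
    define \<psi> :: "(bit \<times> bit) \<times> (bit \<times> bit) \<Rightarrow> bit" where "\<psi> = (\<lambda>((x, y), (z, w)). z)"
    have "three_cover R"
    proof (rule surjects_onto_three_cover[OF ring_axioms so, where \<phi> = \<phi> and \<psi> = \<psi>])
      fix p q :: "(bit \<times> bit) \<times> (bit \<times> bit)"
      obtain x y z w where p: "p = ((x, y), (z, w))" by (metis surj_pair)
      obtain x' y' z' w' where q: "q = ((x', y'), (z', w'))" by (metis surj_pair)
      show "\<phi> (p + q) = \<phi> p + \<phi> q" "\<psi> (p + q) = \<psi> p + \<psi> q" "\<phi> (m p q) = \<phi> p * \<phi> q" "\<psi> (m p q) = \<psi> p * \<psi> q"
        unfolding p q \<phi>_def \<psi>_def m_def add_Pair prod.case True by simp_all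
    next
      show "\<exists>p. \<phi> p \<noteq> 0" by (rule exI[of _ "((1, 0), (0, 0))"]) (simp add: \<phi>_def)
      show "\<exists>p. \<psi> p \<noteq> 0" by (rule exI[of _ "((0, 0), (1, 0))"]) (simp add: \<psi>_def)
      show "\<exists>p. \<phi> p \<noteq> \<psi> p" by (rule exI[of _ "((1, 0), (0, 0))"]) (simp add: \<phi>_def \<psi>_def)
    qed
    then show ?thesis using no_three_cover by blast
  next
    case False
    then have 1: "\<xi> = 1" by simp
    \<comment> \<open>The basis order c, U, f, V corresponds to the matrix with rows (x, y) and (w,
      z).\<close>
    define t :: "(bit \<times> bit) \<times> (bit \<times> bit) \<Rightarrow> bit \<times> bit \<times> bit \<times> bit" where "t = (\<lambda>((x, y), (z, w)). (x, y, w, z))"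
    have "surjects_onto R mult_M2 (t ((1, 0), (1, 0)))"
    proof (rule surjects_onto_map[OF so])
      show "surj t"
      proof (rule surjI)
        show "t (case p of (x, y, w, z) \<Rightarrow> ((x, y), (z, w))) = p" for p by (cases p) (simp add: t_def)
      qed
      fix p q :: "(bit \<times> bit) \<times> (bit \<times> bit)"
      obtain x y z w where p: "p = ((x, y), (z, w))" by (metis surj_pair)
      obtain x' y' z' w' where q: "q = ((x', y'), (z', w'))" by (metis surj_pair)
      show "t (p + q) = t p + t q" by (simp add: p q t_def)
      show "t (m p q) = mult_M2 (t p) (t q)"
        by (simp add: p q t_def m_def mult_M2_def 1 add_ac del: add_bit_eq_xor mult_bit_eq_and)
    qed
    then show ?thesis by (simp add: t_def)
  qed
qed

text \<open>If \<open>c\<close> acts on the right as a scalar, \<open>R\<close> acts on the two-element left ideal \<open>R \<otimes> c\<close>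
  and on a two-element right ideal, which gives two maps to the field with two elements.\<close>

lemma no_ract_case:
  assumes r: "\<not> ract A1 R c" "\<not> ract A2 R c"
  shows False
proof -
  obtain a1 a2 where a: "a1 \<in> A1" "a1 \<notin> A2" "a2 \<in> A2" "a2 \<notin> A1" "a1 \<in> carrier R" "a2 \<in> carrier R"
    by (rule ex_12)
  have rc: "x \<otimes> c \<in> A1" "x \<otimes> c \<in> A2" if "x \<in> carrier R" for x
    using ract1[OF c(1) that] ract2[OF c(2) that] r by blast+
  \<comment> \<open>x c lies in {0, 1, c, f} and acts as 0 from the right on R / A1, unlike 1 and
    f.\<close>
  have Rc: "x \<otimes> c = \<zero> \<or> x \<otimes> c = c" if x: "x \<in> carrier R" for x
  proof -
    have "y \<otimes> (x \<otimes> c) \<in> A1" if "y \<in> carrier R" for y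
      using rc(1)[of "y \<otimes> x"] x that by (simp add: m_assoc)
    then have "\<not> ract A1 R (x \<otimes> c)" unfolding ract_def by blast
    then have "x \<otimes> c \<noteq> \<one>" "x \<otimes> c \<noteq> f"
      using index2_subring.ract_one[OF index2_A1] f(6) r(1) by auto
    then show ?thesis using both rc x by blast
  qed
  \<comment> \<open>u generates the two-element right ideal: a product u x stays in c R with (u x) c
    = 0, and among the elements of A1 and A2 only 0 has these properties.\<close>
  define u where "u = c \<otimes> a2 \<otimes> f"
  have uc: "u \<in> carrier R" using a f(3) by (simp add: u_def)
  have u: "c \<otimes> u = u" "u \<otimes> c = \<zero>"
  proof -
    have "c \<otimes> u = (c \<otimes> c) \<otimes> (a2 \<otimes> f)" using a f(3) by (simp add: u_def m_assoc)
    then show "c \<otimes> u = u" using a f(3) by (simp add: u_def cc m_assoc)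
    have "u \<otimes> c = c \<otimes> a2 \<otimes> (f \<otimes> c)" using a f(3) by (simp add: u_def m_assoc)
    then show "u \<otimes> c = \<zero>" using a by (simp add: idem)
  qed
  have u1: "u \<notin> A1"
    unfolding u_def using lact1[OF c(1) a(6)] ract1[OF f(1), of "c \<otimes> a2"] a r f(6) c(3) by simp
  have u2: "u \<in> A2" unfolding u_def using c f a sub_rules(12) by blast
  have u0: "u \<noteq> \<zero>" using u1 sub_rules(2) by metis
  have corner0: "y = \<zero>" if y: "y \<in> A1" "y \<in> A2" "c \<otimes> y = y" "y \<otimes> c = \<zero>" for y
    using both[OF y(1,2)] y(3,4) idem cc by auto
  have uR: "u \<otimes> x = \<zero> \<or> u \<otimes> x = u" if x: "x \<in> carrier R" for x
  proof -
    define y where "y = u \<otimes> x"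
    have yc: "y \<in> carrier R" using x uc by (simp add: y_def)
    have cy: "c \<otimes> y = y" using m_assoc[OF c_carrier uc x] u by (simp add: y_def)
    have "y \<otimes> c = u \<otimes> (x \<otimes> c)" unfolding y_def by (rule m_assoc[OF uc x c_carrier])
    then have yz: "y \<otimes> c = \<zero>" using Rc[OF x] u uc by auto
    have y2: "y \<in> A2" using lact2[OF c(2) yc] c(4) cy by simp
    show ?thesis
    proof (cases "y \<in> A1")
      case True
      then show ?thesis using corner0[OF True y2 cy yz] by (simp add: y_def)
    next
      case False
      have "y \<oplus> u \<in> A1" using index2_1[OF yc uc] False u1 by blast
      moreover have "y \<oplus> u \<in> A2" using sub_rules(9)[OF y2 u2] .
      moreover have "c \<otimes> (y \<oplus> u) = y \<oplus> u" "(y \<oplus> u) \<otimes> c = \<zero>"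
        using yc uc cy yz u by (simp_all add: l_distr r_distr)
      ultimately have "y \<oplus> u = \<zero>" by (rule corner0)
      then show ?thesis using eq_if_add_zero[OF yc uc] by (simp add: y_def)
    qed
  qed
  have two: "p \<oplus> q = \<zero> \<longleftrightarrow> (p = \<zero> \<longleftrightarrow> q = \<zero>)"
    if "p = \<zero> \<or> p = e" "q = \<zero> \<or> q = e" "e \<in> carrier R" "e \<noteq> \<zero>" for p q e
    using that char_2 by auto
  define E F where "E = {x \<in> carrier R. x \<otimes> c = \<zero>}" and "F = {x \<in> carrier R. u \<otimes> x = \<zero>}"
  have E: "bit_kernel E R"
    unfolding bit_kernel_def
  proof (intro conjI ballI)
    have "\<one> \<notin> E" using idem(5) by (simp add: E_def)
    moreover have "E \<subseteq> carrier R" by (auto simp: E_def)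
    ultimately show "E \<subset> carrier R" using one_closed by blast
    fix x y assume xy: "x \<in> carrier R" "y \<in> carrier R"
    show "x \<oplus> y \<in> E \<longleftrightarrow> (x \<in> E \<longleftrightarrow> y \<in> E)"
      using two[OF Rc[OF xy(1)] Rc[OF xy(2)] c_carrier idem(5)] xy by (simp add: E_def l_distr)
    have "(x \<otimes> y) \<otimes> c = x \<otimes> (y \<otimes> c)" by (rule m_assoc[OF xy c_carrier])
    then show "x \<otimes> y \<in> E \<longleftrightarrow> x \<in> E \<or> y \<in> E" using Rc[OF xy(2)] idem(5) xy by (auto simp: E_def)
  qed
  have F: "bit_kernel F R"
    unfolding bit_kernel_def
  proof (intro conjI ballI)
    have "\<one> \<notin> F" using u0 uc by (simp add: F_def)
    moreover have "F \<subseteq> carrier R" by (auto simp: F_def)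
    ultimately show "F \<subset> carrier R" using one_closed by blast
    fix x y assume xy: "x \<in> carrier R" "y \<in> carrier R"
    show "x \<oplus> y \<in> F \<longleftrightarrow> (x \<in> F \<longleftrightarrow> y \<in> F)"
      using two[OF uR[OF xy(1)] uR[OF xy(2)] uc u0] xy uc by (simp add: F_def r_distr)
    have "u \<otimes> (x \<otimes> y) = (u \<otimes> x) \<otimes> y" by (rule m_assoc[OF uc xy, symmetric])
    then show "x \<otimes> y \<in> F \<longleftrightarrow> x \<in> F \<or> y \<in> F" using uR[OF xy(1)] u0 xy by (auto simp: F_def)
  qed
  have "c \<in> F" "c \<notin> E" using u cc idem(5) by (simp_all add: E_def F_def)
  then have "three_cover R" using two_bit_kernels_three_cover[OF E F] by blast
  then show False using no_three_cover by blast
qed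

text \<open>If c acts as 1 from the right on both quotients, 1 - c acts as 0 on both, and
  \<open>swap\<close> reduces this to \<open>no_ract_case\<close>.\<close>

lemma surjects_onto_F4_F4_or_M2:
  "surjects_onto R mult_F4_F4 ((1, 0), (1, 0)) \<or> surjects_onto R mult_M2 (1, 0, 0, 1)"
proof -
  have "\<not> (ract A1 R c \<and> ract A2 R c)"
    using four_cover_split.no_ract_case[OF swap] index2_subring.ract_one_diff[OF index2_A1 c(1)]
      index2_subring.ract_one_diff[OF index2_A2 c(2)] by blast
  then show ?thesis using ract_case ract_case' no_ract_case by blast
qed

end

text \<open>If only the right actions split, the opposite ring is used; the answer is symmetric
  because F_4 x F_4 is commutative and transposition reverses products in M_2(F_2).\<close>

theorem (in four_cover_core_II) surjects_onto_F4_F4_or_M2: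
  "surjects_onto R mult_F4_F4 ((1, 0), (1, 0)) \<or> surjects_onto R mult_M2 (1, 0, 0, 1)"
proof -
  obtain x where x: "x \<in> A1" "x \<in> A2"
    and "(lact A1 R x \<longleftrightarrow> \<not> lact A2 R x) \<or> (ract A1 R x \<longleftrightarrow> \<not> ract A2 R x)" using ex_split by blast
  then show ?thesis
  proof (elim disjE)
    assume "lact A1 R x \<longleftrightarrow> \<not> lact A2 R x"
    then obtain c where "four_cover_split R A1 A2 A3 A4 b c" using ex_split_left x by blast
    then show ?thesis by (rule four_cover_split.surjects_onto_F4_F4_or_M2)
  next
    assume "ract A1 R x \<longleftrightarrow> \<not> ract A2 R x"
    then obtain c where "four_cover_split (op_ring R) A1 A2 A3 A4 b c"
      using four_cover_core_II.ex_split_left[OF core_II_op x] by auto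
    from four_cover_split.surjects_onto_F4_F4_or_M2[OF this] show ?thesis
    proof
      assume "surjects_onto (op_ring R) mult_F4_F4 ((1, 0), (1, 0))"
      from surjects_onto_op[OF this] have "surjects_onto R (\<lambda>p q. mult_F4_F4 q p) ((1, 0), (1, 0))" .
      moreover have "(\<lambda>p q. mult_F4_F4 q p) = mult_F4_F4"
        by (intro ext) (auto simp: mult_F4_F4_def mult_F4_def mult_ac add_ac split: prod.splits
            simp del: add_bit_eq_xor mult_bit_eq_and)
      ultimately show ?thesis by simp
    next
      assume so: "surjects_onto (op_ring R) mult_M2 (1, 0, 0, 1)"
      define t :: "bit \<times> bit \<times> bit \<times> bit \<Rightarrow> bit \<times> bit \<times> bit \<times> bit" where "t = (\<lambda>(x, y, z, w). (x, z, y, w))"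
      have "surjects_onto R mult_M2 (t (1, 0, 0, 1))"
      proof (rule surjects_onto_map[OF surjects_onto_op[OF so]])
        show "surj t"
        proof (rule surjI)
          show "t (t p) = p" for p by (cases p) (simp add: t_def)
        qed
        fix p q :: "bit \<times> bit \<times> bit \<times> bit"
        obtain x y z w where p: "p = (x, y, z, w)" by (metis surj_pair)
        obtain x' y' z' w' where q: "q = (x', y', z', w')" by (metis surj_pair)
        show "t (p + q) = t p + t q" by (simp add: p q t_def)
        show "t (mult_M2 q p) = mult_M2 (t p) (t q)"
          by (simp add: p q t_def mult_M2_def mult_ac del: add_bit_eq_xor mult_bit_eq_and)
      qed
      then show ?thesis by (simp add: t_def)
    qed
  qed
qed

section \<open>Conclusion\<close>

lemma (in four_cover_core) surjects_onto_cases: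
  "surjects_onto R mult_T2 (1, 0, 1) \<or> surjects_onto R mult_F3xy (1, 0, 0) \<or>
   surjects_onto R mult_F4_F4 ((1, 0), (1, 0)) \<or> surjects_onto R mult_M2 (1, 0, 0, 1)"
  using I_or_II
proof
  assume "four_cover_I R A1 A2 A3 A4"
  then have "four_cover_core_I R A1 A2 A3 A4"
    using four_cover_core_axioms by (simp add: four_cover_core_I_def)
  from four_cover_core_I.surjects_onto_T2_or_F3xy[OF this] show ?thesis by (elim disjE) simp_all
next
  assume "\<exists>B1 B2 B3 B4 b. four_cover_II R B1 B2 B3 B4 b \<and> B1 \<inter> B2 \<inter> B3 \<inter> B4 = A1 \<inter> A2 \<inter> A3 \<inter> A4"
  then obtain B1 B2 B3 B4 b where II: "four_cover_II R B1 B2 B3 B4 b"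
    and B: "B1 \<inter> B2 \<inter> B3 \<inter> B4 = A1 \<inter> A2 \<inter> A3 \<inter> A4" by blast
  have "four_cover R B1 B2 B3 B4"
    using II by (simp add: four_cover_II_def four_cover_pair_def)
  \<comment> \<open>The relabelled subrings have the same common intersection, so unitality and the
    core condition carry over.\<close>
  moreover have one: "\<one> \<in> B1 \<inter> B2 \<inter> B3 \<inter> B4" unfolding B using one_in by blast
  ultimately have "four_cover_unital R B1 B2 B3 B4"
    by (intro four_cover_unital.intro four_cover_unital_axioms.intro) auto
  then have "four_cover_core R B1 B2 B3 B4"
    by (intro four_cover_core.intro four_cover_core_axioms.intro) (simp_all only: B core)
  then have "four_cover_core_II R B1 B2 B3 B4 b"
    using II by (simp add: four_cover_core_II_def)
  from four_cover_core_II.surjects_onto_F4_F4_or_M2[OF this] show ?thesis by (elim disjE) simp_all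
qed

theorem theorem1p2:
  fixes R :: "('a, 'm) ring_scheme"
  assumes "ring R"
  shows "covering_number R = 4 \<longleftrightarrow>
           covering_number R \<noteq> 3 \<and>
           (has_quotient_iso R (RDirProd F4 F4) \<or>
            has_quotient_iso R M2_F2 \<or>
            has_quotient_iso R F3xy_quot \<or>
            has_quotient_iso R T2_F3)"
proof -
  let ?four = "surjects_onto R mult_F4_F4 ((1, 0), (1, 0)) \<or> surjects_onto R mult_M2 (1, 0, 0, 1) \<or>
    surjects_onto R mult_F3xy (1, 0, 0) \<or> surjects_onto R mult_T2 (1, 0, 1)"
  have "covering_number R = 4 \<longleftrightarrow> covering_number R \<noteq> 3 \<and> ?four"
  proof
    assume four: "covering_number R = 4"
    obtain A1 A2 A3 A4 where A:
      "nonunital_subring A1 R" "nonunital_subring A2 R" "nonunital_subring A3 R" "nonunital_subring A4 R"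
      "A1 \<noteq> carrier R" "A2 \<noteq> carrier R" "A3 \<noteq> carrier R" "A4 \<noteq> carrier R"
      "carrier R = A1 \<union> A2 \<union> A3 \<union> A4" "\<not> three_cover R"
      by (rule covering_number_eq_4E[OF four])
    have "four_cover R A1 A2 A3 A4"
      by (intro four_cover.intro four_cover_axioms.intro assms A)
    from four_cover.ex_unital[OF this] obtain B1 B2 B3 B4 where "four_cover_unital R B1 B2 B3 B4"
      by (elim exE)
    from four_cover_unital.ex_core[OF this] obtain R' :: "'a set ring" and C1 C2 C3 C4 h
      where core: "four_cover_core R' C1 C2 C3 C4"
        and h: "h \<in> Ring.ring_hom R R'" "h ` carrier R = carrier R'" by (elim exE conjE)
    have "?four"
      using four_cover_core.surjects_onto_cases[OF core] by (elim disjE) (simp_all add: surjects_onto_comp[OF assms h])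
    moreover have "covering_number R \<noteq> 3" unfolding four by simp
    ultimately show "covering_number R \<noteq> 3 \<and> ?four" by (intro conjI)
  next
    assume c: "covering_number R \<noteq> 3 \<and> ?four"
    then have "?four" ..
    then have le: "covering_number R \<le> 4"
      by (elim disjE F4_F4_covering_number_le_4[OF assms] M2_covering_number_le_4[OF assms]
          F3xy_covering_number_le_4[OF assms] T2_covering_number_le_4[OF assms])
    have "3 \<le> n \<Longrightarrow> n \<le> 4 \<Longrightarrow> n \<noteq> 3 \<Longrightarrow> n = 4" for n :: enat
      by (cases n) (auto simp: numeral_eq_enat)
    from this[OF ring.covering_number_ge_3[OF assms] le conjunct1[OF c]] show "covering_number R = 4" .
  qed
  then show ?thesis
    unfolding has_quotient_iso_F4_F4[OF assms] has_quotient_iso_M2[OF assms]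
        has_quotient_iso_F3xy[OF assms] has_quotient_iso_T2[OF assms] .
qed

end
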